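(* Let $\widehat{\mathbf W}=\widehat{\mathbf W}_{(1:p)}\in\mathbb R^{n\times m}$ and let $\widehat{\mathbf P},\widehat{\mathbf Q},\widehat{\mathbf S},\widehat{\mathbf R}$ be the matrices computed by the RBGS algorithm (described in the context) with coarse unit roundoff $u_{crs}$, fine unit roundoff $u_{fine}$ and sketching matrix $\mathbf\Theta\in\mathbb R^{k\times n}$, using in step 2 a backward-stable least-squares solver satisfying assumption (B) of the context. Suppose assumptions (A1)–(A4) of the context hold, and that $\mathbf\Theta$ is an $\varepsilon$-embedding for $\widehat{\mathbf Q}_{(1:p-1)}$ and for $\widehat{\mathbf W}$, with $\varepsilon\le1/2$. If $$u_{crs}\le 10^{-3}\,\mathrm{cond}(\widehat{\mathbf W})^{-1}m^{-2}\quad\text{and}\quad u_{fine}\le 10^{-2}m^{-1/2}n^{-3/2}u_{crs},$$ then $\Delta^{(p)}=\|\mathbf I-\widehat{\mathbf S}^{\mathrm T}\widehat{\mathbf S}\|_{\mathrm F}$ and $\tilde\Delta^{(p)}=\|\widehat{\mathbf P}-\widehat{\mathbf S}\widehat{\mathbf R}\|_{\mathrm F}/\|\widehat{\mathbf P}\|_{\mathrm F}$ are bounded by $$\tilde\Delta^{(p)}\le 4.2\,u_{crs}m^{3/2}\,\|\widehat{\mathbf W}\|_{\mathrm F}/\|\widehat{\mathbf P}\|_{\mathrm F}\le 6\,u_{crs}m^{3/2},$$ $$\Delta^{(p)}\le 20\,u_{crs}\,m^{2}\,\mathrm{cond}(\widehat{\mathbf W}).$$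
   Context: Notation. $\|\cdot\|$ is the $\ell_2$ (spectral) norm, $\|\cdot\|_{\mathrm F}$ the Frobenius norm, $\langle\cdot,\cdot\rangle$ the Euclidean inner product; $\sigma_{min},\sigma_{max}$ are the smallest and largest singular values and $\mathrm{cond}=\sigma_{max}/\sigma_{min}$. For matrices, $|\mathbf X|$ is the entrywise absolute value and $\mathbf X\le\mathbf Y$ is meant entrywise. Hats denote quantities computed in finite precision arithmetic (and the input matrix as stored). Let $m=m_pp$ and $m\le k\le n$. An $n\times m$ matrix is partitioned into $p$ column blocks with $m_p$ columns each, $\mathbf X=[\mathbf X_{(1)},\dots,\mathbf X_{(p)}]$, and $\mathbf X_{(a:b)}=[\mathbf X_{(a)},\dots,\mathbf X_{(b)}]$ (empty if $b<a$); the same partition is used for the $k\times m$ matrices $\mathbf P,\mathbf S$. The $m\times m$ matrix $\mathbf R$ is upper triangular, with $m_p\times m_p$ blocks $\mathbf R_{(i,j)}$; $\mathbf R_{(a:b,j)}$ is the submatrix of blocks $(i,j)$, $a\le i\le b$. $\varepsilon$-embedding. For $\varepsilon<1$, $\mathbf\Theta\in\mathbb R^{k\times n}$ is an $\varepsilon$-embedding for a subspace $V\subset\mathbb R^n$ if $|\langle\mathbf x,\mathbf y\rangle-\langle\mathbf\Theta\mathbf x,\mathbf\Theta\mathbf y\rangle|\le\varepsilon\|\mathbf x\|\|\mathbf y\|$ for all $\mathbf x,\mathbf y\in V$. It is an $\varepsilon$-embedding for a matrix if it is one for the column space of that matrix. RBGS algorithm (randomized block Gram–Schmidt) applied to $\mathbf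 W$ with a fixed $\mathbf\Theta\in\mathbb R^{k\times n}$. For $i=1,\dots,p$: 1. Sketch: $\mathbf P_{(i)}=\mathbf\Theta\mathbf W_{(i)}$ (roundoff $u_{fine}$). 2. Solve the least-squares problem $\mathbf R_{(1:i-1,i)}=\arg\min_{\mathbf Y}\|\mathbf S_{(1:i-1)}\mathbf Y-\mathbf P_{(i)}\|_{\mathrm F}$ by some solver (roundoff $u_{fine}$); $\widehat{\mathbf R}_{(1:i-1,i)}$ denotes the matrix the solver returns. 3. Compute $\mathbf Q'_{(i)}=\mathbf W_{(i)}-\mathbf Q_{(1:i-1)}\mathbf R_{(1:i-1,i)}$ (roundoff $u_{crs}$). 4–5. Compute a QR factorization $\mathbf Q_{(i)}\mathbf R_{(i,i)}=\mathbf Q'_{(i)}$, with $\mathbf R_{(i,i)}$ upper triangular, with respect to the sketched inner product $\langle\mathbf\Theta\cdot,\mathbf\Theta\cdot\rangle$, and compute the sketch $\mathbf S_{(i)}=\mathbf\Theta\mathbf Q_{(i)}$ (roundoff $u_{fine}$). For $i=1$, $\mathbf Q_{(1:0)}$ and $\mathbf R_{(1:0,1)}$ are empty, so $\mathbf Q'_{(1)}=\mathbf W_{(1)}$. Output: $\mathbf Q=\mathbf Q_{(1:p)}$, $\mathbf R=\mathbf R_{(1:p,1:p)}$ (zero blocks below the block diagonal). Here $u_{fine}\le u_{crs}$. The sketches are matrix products computed with the standard floating point model, so that $|\widehat{\mathbf P}-\mathbf\Theta\widehat{\mathbf W}|\le 1.02\,n\,u_{fine}|\mathbf\Theta||\widehat{\mathbf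 W}|$ and $|\widehat{\mathbf S}-\mathbf\Theta\widehat{\mathbf Q}|\le 1.02\,n\,u_{fine}|\mathbf\Theta||\widehat{\mathbf Q}|$. Let $\mathbf\Delta\mathbf Q'_{(i)}=\widehat{\mathbf Q}'_{(i)}-(\widehat{\mathbf W}_{(i)}-\widehat{\mathbf Q}_{(1:i-1)}\widehat{\mathbf R}_{(1:i-1,i)})$ be the rounding error of step 3. Assumptions. For some $\varepsilon_0\le 1/2$ and all $1\le i\le p$: (A1) $\|\mathbf\Theta\|_{\mathrm F}\le\sqrt{1+\varepsilon_0}\sqrt n$. (A2) $|\mathbf\Delta\mathbf Q'_{(i)}|\le 1.02\,u_{crs}\big(|\widehat{\mathbf W}_{(i)}|+i\,m_p|\widehat{\mathbf Q}_{(1:i-1)}||\widehat{\mathbf R}_{(1:i-1,i)}|\big)$ and $\|\mathbf\Theta\mathbf\Delta\mathbf Q'_{(i)}\|_{\mathrm F}\le 1.02\,u_{crs}\sqrt{1+\varepsilon_0}\,\big\||\widehat{\mathbf W}_{(i)}|+i\,m_p|\widehat{\mathbf Q}_{(1:i-1)}||\widehat{\mathbf R}_{(1:i-1,i)}|\big\|_{\mathrm F}$. (A3) In steps 4–5: $|\widehat{\mathbf Q}'_{(i)}-\widehat{\mathbf Q}_{(i)}\widehat{\mathbf R}_{(i,i)}|\le u_{fine}m\big(|\widehat{\mathbf Q}'_{(i)}|+|\widehat{\mathbf Q}_{(i)}||\widehat{\mathbf R}_{(i,i)}|\big)\le 0.1u_{crs}|\widehat{\mathbf Q}_{(i)}||\widehat{\mathbf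 R}_{(i,i)}|$ and $\|\mathbf\Theta(\widehat{\mathbf Q}'_{(i)}-\widehat{\mathbf Q}_{(i)}\widehat{\mathbf R}_{(i,i)})\|_{\mathrm F}\le u_{fine}m\|\mathbf\Theta\|_{\mathrm F}\big\||\widehat{\mathbf Q}'_{(i)}|+|\widehat{\mathbf Q}_{(i)}||\widehat{\mathbf R}_{(i,i)}|\big\|\le 0.1u_{crs}\|\widehat{\mathbf Q}_{(i)}\|\|\widehat{\mathbf R}_{(i,i)}\|$. (A4) In steps 4–5: if $\mathbf\Theta$ is an $\eta$-embedding for $\widehat{\mathbf Q}'_{(i)}$ for some $\eta<1$, then $1-0.1u_{crs}\mathrm{cond}(\widehat{\mathbf Q}'_{(i)})\le\sigma_{min}(\mathbf\Theta\widehat{\mathbf Q}_{(i)})\le\sigma_{max}(\mathbf\Theta\widehat{\mathbf Q}_{(i)})\le 1+0.1u_{crs}\mathrm{cond}(\widehat{\mathbf Q}'_{(i)})$ and $\|\widehat{\mathbf Q}_{(i)}\|\le(1-\eta)^{-1/2}\|\mathbf\Theta\widehat{\mathbf Q}_{(i)}\|$. (B) Backward stability of step 2: for each $i$ and each $1\le j\le m_p$, the $j$-th column $\widehat{\mathbf x}$ of $\widehat{\mathbf R}_{(1:i-1,i)}$ and the $j$-th column $\widehat{\mathbf p}$ of $\widehat{\mathbf P}_{(i)}$ satisfy $\widehat{\mathbf x}=\arg\min_{\mathbf y}\|(\widehat{\mathbf S}_{(1:i-1)}+\mathbf\Delta\mathbf S)\mathbf y-(\widehat{\mathbf p}+\mathbf\Delta\mathbf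 p)\|$ for some perturbations $\mathbf\Delta\mathbf S,\mathbf\Delta\mathbf p$ (which may depend on $(i,j)$) with $\|\mathbf\Delta\mathbf S\|_{\mathrm F}\le0.01u_{crs}\|\widehat{\mathbf S}_{(1:i-1)}\|$ and $\|\mathbf\Delta\mathbf p\|\le0.01u_{crs}\|\widehat{\mathbf p}\|$. *)

theory Defs
  imports
    "HOL-Library.Extended_Real"
    "Jordan_Normal_Form.Char_Poly"
    "Jordan_Normal_Form.VS_Connect"
begin

section \<open>Norms, singular values, condition number\<close>

definition vnorm :: "real vec \<Rightarrow> real" where
  "vnorm x = sqrt (x \<bullet> x)"

definition fro_norm :: "real mat \<Rightarrow> real" where
  "fro_norm X = sqrt (\<Sum>i<dim_row X. \<Sum>j<dim_col X. (X $$ (i, j))\<^sup>2)"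

text \<open>The supremum is over the closed unit ball and not the unit sphere, so that the set is nonempty,
  and the norm is 0, also for a matrix without columns.\<close>

definition spec_norm :: "real mat \<Rightarrow> real" where
  "spec_norm X = (SUP x \<in> {x \<in> carrier_vec (dim_col X). vnorm x \<le> 1}. vnorm (X *\<^sub>v x))"

text \<open>A matrix with \<open>a\<close> rows and \<open>b\<close> columns has \<open>min a b\<close> singular values (with multiplicity),
  hence the smaller one of the two Gram matrices.\<close>

definition singular_values :: "real mat \<Rightarrow> real set" where
  "singular_values X =
     sqrt ` {e. eigenvalue (if dim_col X \<le> dim_row X then X\<^sup>T * X else X * X\<^sup>T) e}"

definition sigma_min :: "real mat \<Rightarrow> real" where
  "sigma_min X = Min (singular_values X)"

definition sigma_max :: "real mat \<Rightarrow> real" where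
  "sigma_max X = Max (singular_values X)"

text \<open>Extended-real valued: with real division, a rank-deficient matrix would have condition
  number 0 instead of infinity.\<close>

definition cond :: "real mat \<Rightarrow> ereal" where
  "cond X = (if sigma_min X = 0 then \<infinity> else ereal (sigma_max X / sigma_min X))"

abbreviation mat_abs :: "real mat \<Rightarrow> real mat" where
  "mat_abs X \<equiv> map_mat abs X"


section \<open>Block partition\<close>

text \<open>Blocks are numbered from 1 and have \<open>mp\<close> columns (and, for \<open>sub_blocks\<close>, \<open>mp\<close> rows) each;
  a range \<open>a..b\<close> with \<open>b < a\<close> is empty.\<close>

definition col_blocks :: "nat \<Rightarrow> real mat \<Rightarrow> nat \<Rightarrow> nat \<Rightarrow> real mat" where
  "col_blocks mp X a b =
     mat (dim_row X) (b * mp - (a - 1) * mp) (\<lambda>(r, c). X $$ (r, (a - 1) * mp + c))"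

definition sub_blocks :: "nat \<Rightarrow> real mat \<Rightarrow> nat \<Rightarrow> nat \<Rightarrow> nat \<Rightarrow> nat \<Rightarrow> real mat" where
  "sub_blocks mp X a b c d =
     mat (b * mp - (a - 1) * mp) (d * mp - (c - 1) * mp)
       (\<lambda>(s, t). X $$ ((a - 1) * mp + s, (c - 1) * mp + t))"

abbreviation col_block :: "nat \<Rightarrow> real mat \<Rightarrow> nat \<Rightarrow> real mat" where
  "col_block mp X i \<equiv> col_blocks mp X i i"


section \<open>Embeddings\<close>

definition eps_embedding :: "real \<Rightarrow> real mat \<Rightarrow> real vec set \<Rightarrow> bool" where
  "eps_embedding \<epsilon> \<Theta> V \<longleftrightarrow> \<epsilon> < 1 \<and>
     (\<forall>x\<in>V. \<forall>y\<in>V. \<bar>x \<bullet> y - (\<Theta> *\<^sub>v x) \<bullet> (\<Theta> *\<^sub>v y)\<bar> \<le> \<epsilon> * vnorm x * vnorm y)"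

definition eps_embedding_mat :: "real \<Rightarrow> real mat \<Rightarrow> real mat \<Rightarrow> bool" where
  "eps_embedding_mat \<epsilon> \<Theta> X \<longleftrightarrow> eps_embedding \<epsilon> \<Theta> (vec_space.col_space (dim_row X) X)"


section \<open>Randomized block Gram--Schmidt in finite precision\<close>

text \<open>For \<open>i = 1, ..., p\<close> the algorithm sketches \<open>P_i = \<Theta> W_i\<close>, obtains the blocks \<open>R_(1:i-1, i)\<close> by
  minimising the Frobenius norm of \<open>S_(1:i-1) Y - P_i\<close> over \<open>Y\<close>, updates
  \<open>Q'_i = W_i - Q_(1:i-1) R_(1:i-1, i)\<close>, factors \<open>Q'_i = Q_i R_(i, i)\<close> by a QR factorization with
  respect to the sketched inner product and sketches \<open>S_i = \<Theta> Q_i\<close>.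

  All matrices below are the computed ones, and the computed blocks \<open>Q'_i\<close> are the column blocks of
  one matrix \<open>Q'\<close>. Each step performed in finite precision is described by the rounding error
  bounds that its computed result satisfies.\<close>

definition sketch_computed :: "real \<Rightarrow> real mat \<Rightarrow> real mat \<Rightarrow> real mat \<Rightarrow> bool" where
  "sketch_computed ufine \<Theta> X Y \<longleftrightarrow>
     mat_abs (Y - \<Theta> * X) \<le> (1.02 * real (dim_col \<Theta>) * ufine) \<cdot>\<^sub>m (mat_abs \<Theta> * mat_abs X)"

definition ls_backward_stable :: "nat \<Rightarrow> real \<Rightarrow> real mat \<Rightarrow> real mat \<Rightarrow> real mat \<Rightarrow> nat \<Rightarrow> bool" where
  "ls_backward_stable mp ucrs P S R i \<longleftrightarrow>
     (let Si = col_blocks mp S 1 (i - 1); Ri = sub_blocks mp R 1 (i - 1) i i; Pi = col_block mp P i in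
      \<forall>j < mp. \<exists>dS \<in> carrier_mat (dim_row Si) (dim_col Si). \<exists>dp \<in> carrier_vec (dim_row Pi).
        is_arg_min (\<lambda>y. vnorm ((Si + dS) *\<^sub>v y - (col Pi j + dp)))
          (\<lambda>y. y \<in> carrier_vec (dim_col Si)) (col Ri j) \<and>
        fro_norm dS \<le> 0.01 * ucrs * spec_norm Si \<and>
        vnorm dp \<le> 0.01 * ucrs * vnorm (col Pi j))"

definition update_error :: "nat \<Rightarrow> real mat \<Rightarrow> real mat \<Rightarrow> real mat \<Rightarrow> real mat \<Rightarrow> nat \<Rightarrow> real mat" where
  "update_error mp W Q Q' R i =
     col_block mp Q' i - (col_block mp W i - col_blocks mp Q 1 (i - 1) * sub_blocks mp R 1 (i - 1) i i)"

definition sketch_norm_bound :: "real \<Rightarrow> real mat \<Rightarrow> bool" where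
  "sketch_norm_bound \<epsilon>0 \<Theta> \<longleftrightarrow> fro_norm \<Theta> \<le> sqrt (1 + \<epsilon>0) * sqrt (real (dim_col \<Theta>))"

definition update_stable ::
    "nat \<Rightarrow> real \<Rightarrow> real \<Rightarrow> real mat \<Rightarrow> real mat \<Rightarrow> real mat \<Rightarrow> real mat \<Rightarrow> real mat \<Rightarrow> nat \<Rightarrow> bool" where
  "update_stable mp \<epsilon>0 ucrs \<Theta> W Q Q' R i \<longleftrightarrow>
     (let dQ' = update_error mp W Q Q' R i;
          B = mat_abs (col_block mp W i) + real (i * mp) \<cdot>\<^sub>m
                (mat_abs (col_blocks mp Q 1 (i - 1)) * mat_abs (sub_blocks mp R 1 (i - 1) i i)) in
      mat_abs dQ' \<le> (1.02 * ucrs) \<cdot>\<^sub>m B \<and>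
      fro_norm (\<Theta> * dQ') \<le> 1.02 * ucrs * sqrt (1 + \<epsilon>0) * fro_norm B)"

definition qr_backward_stable ::
    "nat \<Rightarrow> real \<Rightarrow> real \<Rightarrow> real mat \<Rightarrow> real mat \<Rightarrow> real mat \<Rightarrow> real mat \<Rightarrow> nat \<Rightarrow> bool" where
  "qr_backward_stable mp ucrs ufine \<Theta> Q Q' R i \<longleftrightarrow>
     (let Qi = col_block mp Q i; Qi' = col_block mp Q' i; Rii = sub_blocks mp R i i i i;
          m = real (dim_col Q); E = Qi' - Qi * Rii;
          B = mat_abs Qi' + mat_abs Qi * mat_abs Rii in
      mat_abs E \<le> (ufine * m) \<cdot>\<^sub>m B \<and>
      (ufine * m) \<cdot>\<^sub>m B \<le> (0.1 * ucrs) \<cdot>\<^sub>m (mat_abs Qi * mat_abs Rii) \<and>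
      fro_norm (\<Theta> * E) \<le> ufine * m * fro_norm \<Theta> * spec_norm B \<and>
      ufine * m * fro_norm \<Theta> * spec_norm B \<le> 0.1 * ucrs * spec_norm Qi * spec_norm Rii)"

definition qr_sketch_orthonormal ::
    "nat \<Rightarrow> real \<Rightarrow> real mat \<Rightarrow> real mat \<Rightarrow> real mat \<Rightarrow> nat \<Rightarrow> bool" where
  "qr_sketch_orthonormal mp ucrs \<Theta> Q Q' i \<longleftrightarrow>
     (let Qi = col_block mp Q i; Qi' = col_block mp Q' i in
      \<forall>\<eta><1. eps_embedding_mat \<eta> \<Theta> Qi' \<longrightarrow>
        1 - ereal (0.1 * ucrs) * cond Qi' \<le> ereal (sigma_min (\<Theta> * Qi)) \<and>
        sigma_min (\<Theta> * Qi) \<le> sigma_max (\<Theta> * Qi) \<and>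
        ereal (sigma_max (\<Theta> * Qi)) \<le> 1 + ereal (0.1 * ucrs) * cond Qi' \<and>
        spec_norm Qi \<le> (1 - \<eta>) powr (-1/2) * spec_norm (\<Theta> * Qi))"

end

theory Submission
  imports Defs "HOL-Analysis.L2_Norm"
begin

text \<open>
Write \<open>u\<close> for the coarse roundoff \<open>ucrs\<close>. The rounding errors of the update and of the QR
factorizations add up to one matrix \<open>F\<close> with \<open>W + F = Q R\<close>. Each block of \<open>F\<close> and of \<open>\<Theta> F\<close> has
Frobenius norm at most \<open>15/4 u m^(3/2)\<close> times that of the same block of \<open>W\<close>; this is
\<open>block_defect_bounds\<close>. The smallness assumption on \<open>u\<close> makes \<open>F\<close> a perturbation of \<open>W\<close> of less
than one percent of the smallest singular value \<open>\<sigma>\<close> of \<open>W\<close>.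

Everything that is needed about the new block \<open>Q'_i\<close> follows from this backward error. With \<open>z\<close>
solving \<open>R_(1:i-1,1:i-1) z = - R_(1:i-1,i) y\<close>, the vector \<open>Q'_i y\<close> is the perturbed \<open>W_(1:i)\<close>
applied to \<open>(z, y)\<close>, so that it differs from a vector of the range of \<open>W\<close> by less than one percent
(\<open>Qp_near_range_W\<close>). An ill-conditioned \<open>R\<close> does not amplify this difference, because it is
measured against the vector of the range, which grows with \<open>z\<close>. Hence \<open>\<Theta>\<close> embeds
the range of \<open>Q'_i\<close>, with 5/9 in place of 1/2, and \<open>Q'_i\<close> has smallest singular value at least
\<open>99/100 \<sigma>\<close>. These two facts make the assumption on the QR factorization applicable: it says that
\<open>\<Theta> Q_i\<close> is almost orthonormal, and it bounds \<open>Q_i\<close>.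

The residual \<open>P - S R\<close> is \<open>-\<Theta> F\<close> up to the errors of the two sketches, which are smaller because
they are committed in the fine precision (\<open>sketch_residual_le\<close>).

For the loss of orthogonality, the diagonal blocks of \<open>I - S^T S\<close> are controlled by the QR
factorizations (\<open>Sb_near\<close>). The block above the diagonal satisfies
\<open>S_(1:i-1)^T S_i R_(i,i) = S_(1:i-1)^T (P_i - S_(1:i-1) R_(1:i-1,i)) - S_(1:i-1)^T (P_i - S_(1:i) R_(1:i,i))\<close>.
The first term is the least-squares residual tested against the range of \<open>S_(1:i-1)\<close>, which backward
stability makes of order \<open>u\<close>; the second is the residual above. Since \<open>R_(i,i)\<close> is bounded below by
a multiple of \<open>\<sigma>\<close>, the block is of order \<open>u m^(3/2) / \<sigma>\<close> times the norm of \<open>W_i\<close>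
(\<open>cross_gram_le\<close>). Squares of Frobenius norms add over blocks, and \<open>W\<close> has Frobenius norm at most
\<open>m^(1/2)\<close> times its largest singular value, whence the factor \<open>m^2 cond W\<close>.

The whole argument is an induction over the blocks, because the step for block \<open>i\<close> uses that
\<open>S_(1:i-1)\<close> is almost orthonormal and that the preceding blocks of \<open>F\<close> are small
(\<open>invariant_Suc\<close>). Its numerical constants are decimal roundings of the sums that arise.
\<close>


section \<open>Euclidean and Frobenius norms\<close>

lemma vnorm_eq_L2: "vnorm x = L2_set (\<lambda>i. x $ i) {0..<dim_vec x}"
  by (simp add: vnorm_def L2_set_def scalar_prod_def power2_eq_square)

lemma vnorm_nonneg [simp]: "0 \<le> vnorm x"
  by (simp add: vnorm_eq_L2)

lemma vnorm_sq: "(vnorm x)\<^sup>2 = x \<bullet> x"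
proof -
  have "0 \<le> x \<bullet> x" by (simp add: scalar_prod_def sum_nonneg)
  then show ?thesis by (simp add: vnorm_def)
qed

lemma vnorm_zero [simp]: "vnorm (0\<^sub>v n) = 0"
  by (simp add: vnorm_def)

lemma vnorm_pos: "x \<in> carrier_vec n \<Longrightarrow> x \<noteq> 0\<^sub>v n \<Longrightarrow> 0 < vnorm x"
proof -
  assume x: "x \<in> carrier_vec n" "x \<noteq> 0\<^sub>v n"
  then obtain i where "i < n" "x $ i \<noteq> 0"
    by (metis carrier_vecD eq_vecI index_zero_vec(1) index_zero_vec(2))
  then have "vnorm x \<noteq> 0" using x by (auto simp: vnorm_eq_L2 L2_set_eq_0_iff)
  then show ?thesis using vnorm_nonneg[of x] by linarith
qed

lemma vnorm_smult [simp]: "vnorm (c \<cdot>\<^sub>v x) = \<bar>c\<bar> * vnorm x"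
  by (simp add: vnorm_def real_sqrt_mult flip: mult.assoc)

lemma vnorm_uminus [simp]: "vnorm (- x) = vnorm x"
  by (simp add: vnorm_def)

lemma abs_scalar_prod_le: 
  assumes "x \<in> carrier_vec n" "y \<in> carrier_vec n"
  shows "\<bar>x \<bullet> y\<bar> \<le> vnorm x * vnorm y"
proof -
  have "\<bar>x \<bullet> y\<bar> \<le> (\<Sum>i\<in>{0..<n}. \<bar>x $ i\<bar> * \<bar>y $ i\<bar>)"
    using assms by (auto simp: scalar_prod_def abs_mult intro: order_trans[OF sum_abs])
  also have "\<dots> \<le> vnorm x * vnorm y"
    using assms L2_set_mult_ineq[of "\<lambda>i. x $ i" "\<lambda>i. y $ i" "{0..<n}"] by (simp add: vnorm_eq_L2)
  finally show ?thesis .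
qed

lemma vnorm_add_le:
  assumes "x \<in> carrier_vec n" "y \<in> carrier_vec n"
  shows "vnorm (x + y) \<le> vnorm x + vnorm y"
proof -
  have "vnorm (x + y) = L2_set (\<lambda>i. x $ i + y $ i) {0..<n}"
    using assms by (auto simp: vnorm_eq_L2 intro!: L2_set_cong)
  also have "\<dots> \<le> vnorm x + vnorm y"
    using assms L2_set_triangle_ineq[of "\<lambda>i. x $ i" "\<lambda>i. y $ i"] by (simp add: vnorm_eq_L2)
  finally show ?thesis .
qed

lemma vnorm_diff_le:
  assumes "x \<in> carrier_vec n" "y \<in> carrier_vec n"
  shows "vnorm (x - y) \<le> vnorm x + vnorm y"
proof -
  have "x - y = x + (- y)" using assms by auto
  then show ?thesis using vnorm_add_le[of x n "- y"] assms by simp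
qed

lemma vnorm_diff_ge:
  assumes "x \<in> carrier_vec n" "y \<in> carrier_vec n"
  shows "vnorm x - vnorm y \<le> vnorm (x - y)" "vnorm x - vnorm y \<le> vnorm (x + y)"
proof -
  have "x = (x - y) + y" "x = (x + y) - y" using assms by auto
  then show "vnorm x - vnorm y \<le> vnorm (x - y)" "vnorm x - vnorm y \<le> vnorm (x + y)"
    using vnorm_add_le[of "x - y" n y] vnorm_diff_le[of "x + y" n y] assms by auto
qed

lemma vnorm_unit [simp]: "i < n \<Longrightarrow> vnorm (unit_vec n i) = 1"
  by (simp add: vnorm_def)

lemma fro_norm_eq_L2: "fro_norm X = L2_set (\<lambda>ij. X $$ ij) ({..<dim_row X} \<times> {..<dim_col X})"
  by (simp add: fro_norm_def L2_set_def sum.cartesian_product)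

lemma fro_norm_nonneg [simp]: "0 \<le> fro_norm X"
  by (simp add: fro_norm_eq_L2)

lemma fro_norm_sq: "(fro_norm X)\<^sup>2 = (\<Sum>i<dim_row X. \<Sum>j<dim_col X. (X $$ (i, j))\<^sup>2)"
  by (simp add: fro_norm_def sum_nonneg)

lemma fro_norm_sq_cols: "(fro_norm X)\<^sup>2 = (\<Sum>j<dim_col X. (vnorm (col X j))\<^sup>2)"
  unfolding fro_norm_sq 
  by (subst sum.swap) (simp add: vnorm_sq scalar_prod_def lessThan_atLeast0 flip: power2_eq_square)

lemma fro_norm_transpose [simp]: "fro_norm (X\<^sup>T) = fro_norm X"
  unfolding fro_norm_def by (subst sum.swap) (auto intro!: sum.cong arg_cong[of _ _ sqrt])

lemma fro_norm_abs [simp]: "fro_norm (mat_abs X) = fro_norm X"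
  by (simp add: fro_norm_def)

lemma fro_norm_smult [simp]: "fro_norm (c \<cdot>\<^sub>m X) = \<bar>c\<bar> * fro_norm X"
  by (simp add: fro_norm_def power_mult_distrib real_sqrt_mult flip: sum_distrib_left)

lemma fro_norm_uminus [simp]: "fro_norm (- X) = fro_norm X"
  by (simp add: fro_norm_def)

lemma fro_norm_add_le:
  assumes "X \<in> carrier_mat r c" "Y \<in> carrier_mat r c"
  shows "fro_norm (X + Y) \<le> fro_norm X + fro_norm Y"
proof -
  have "fro_norm (X + Y) = L2_set (\<lambda>ij. X $$ ij + Y $$ ij) ({..<r} \<times> {..<c})"
    using assms by (auto simp: fro_norm_eq_L2 intro!: L2_set_cong)
  also have "\<dots> \<le> fro_norm X + fro_norm Y"
    using assms L2_set_triangle_ineq[of "\<lambda>ij. X $$ ij" "\<lambda>ij. Y $$ ij"] by (simp add: fro_norm_eq_L2)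
  finally show ?thesis .
qed

lemma fro_norm_diff_le:
  assumes "X \<in> carrier_mat r c" "Y \<in> carrier_mat r c"
  shows "fro_norm (X - Y) \<le> fro_norm X + fro_norm Y"
proof -
  have "X - Y = X + (- Y)" using assms by (intro eq_matI) auto
  then show ?thesis using fro_norm_add_le[of X r c "- Y"] assms by simp
qed

lemma fro_norm_abs_mono:
  assumes "mat_abs X \<le> Y"
  shows "fro_norm X \<le> fro_norm Y"
proof -
  have d: "dim_row X = dim_row Y" "dim_col X = dim_col Y"
    and le: "\<And>i j. i < dim_row Y \<Longrightarrow> j < dim_col Y \<Longrightarrow> \<bar>X $$ (i,j)\<bar> \<le> Y $$ (i,j)"
    using assms unfolding less_eq_mat_def by auto
  have "fro_norm X = L2_set (\<lambda>ij. \<bar>X $$ ij\<bar>) ({..<dim_row Y} \<times> {..<dim_col Y})"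
    using d by (simp add: fro_norm_eq_L2 L2_set_def)
  also have "\<dots> \<le> fro_norm Y"
    unfolding fro_norm_eq_L2 using le by (intro L2_set_mono) auto
  finally show ?thesis .
qed

lemma col_mult_vec: "j < dim_col B \<Longrightarrow> col (A * B) j = A *\<^sub>v col B j"
  by (intro eq_vecI) auto

text \<open>The next two estimates hold because the Frobenius norm sees a product \<open>A * B\<close> one column \<open>A b\<close> at a time.\<close>

lemma fro_norm_mult_le_bound:
  assumes A: "A \<in> carrier_mat r n" and B: "B \<in> carrier_mat n c" and "0 \<le> a"
    and le: "\<And>v. v \<in> carrier_vec n \<Longrightarrow> vnorm (A *\<^sub>v v) \<le> a * vnorm v"
  shows "fro_norm (A * B) \<le> a * fro_norm B"
proof -
  have "(fro_norm (A * B))\<^sup>2 = (\<Sum>j<c. (vnorm (A *\<^sub>v col B j))\<^sup>2)"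
    using A B by (simp add: fro_norm_sq_cols mult_mat_vec_def)
  also have "\<dots> \<le> (\<Sum>j<c. (a * vnorm (col B j))\<^sup>2)"
    using B by (intro sum_mono power_mono le) auto
  also have "\<dots> = (a * fro_norm B)\<^sup>2"
    using B by (simp add: fro_norm_sq_cols power_mult_distrib sum_distrib_left)
  finally show ?thesis by (rule power2_le_imp_le) (simp add: \<open>0 \<le> a\<close>)
qed

lemma fro_norm_mult_ge_bound:
  assumes A: "A \<in> carrier_mat r n" and B: "B \<in> carrier_mat n c" and "0 \<le> a"
    and le: "\<And>v. v \<in> carrier_vec n \<Longrightarrow> a * vnorm v \<le> vnorm (A *\<^sub>v v)"
  shows "a * fro_norm B \<le> fro_norm (A * B)"
proof -
  have "(a * fro_norm B)\<^sup>2 = (\<Sum>j<c. (a * vnorm (col B j))\<^sup>2)"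
    using B by (simp add: fro_norm_sq_cols power_mult_distrib sum_distrib_left)
  also have "\<dots> \<le> (\<Sum>j<c. (vnorm (A *\<^sub>v col B j))\<^sup>2)"
    using B \<open>0 \<le> a\<close> by (intro sum_mono power_mono le) auto
  also have "\<dots> = (fro_norm (A * B))\<^sup>2"
    using A B by (simp add: fro_norm_sq_cols mult_mat_vec_def)
  finally show ?thesis by (rule power2_le_imp_le) simp
qed

lemma vnorm_mult_le_fro:
  assumes A: "A \<in> carrier_mat r n" and v: "v \<in> carrier_vec n"
  shows "vnorm (A *\<^sub>v v) \<le> fro_norm A * vnorm v"
proof -
  have "(vnorm (A *\<^sub>v v))\<^sup>2 = (\<Sum>i<r. (row A i \<bullet> v)\<^sup>2)"
    using A v by (simp add: vnorm_sq scalar_prod_def[of "A *\<^sub>v v"] lessThan_atLeast0 flip: power2_eq_square)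
  also have "\<dots> \<le> (\<Sum>i<r. (vnorm (row A i) * vnorm v)\<^sup>2)"
    using A v by (intro sum_mono abs_le_square_iff[THEN iffD1])
      (auto intro: order_trans[OF abs_scalar_prod_le[of _ n]])
  also have "\<dots> = (vnorm v)\<^sup>2 * (\<Sum>i<r. (vnorm (row A i))\<^sup>2)"
    by (simp add: power_mult_distrib sum_distrib_left mult.commute)
  also have "(\<Sum>i<r. (vnorm (row A i))\<^sup>2) = (fro_norm A)\<^sup>2"
    using A fro_norm_sq_cols[of "A\<^sup>T"] by (auto intro!: sum.cong)
  finally have "(vnorm (A *\<^sub>v v))\<^sup>2 \<le> (fro_norm A * vnorm v)\<^sup>2"
    by (simp add: power_mult_distrib mult.commute)
  then show ?thesis by (rule power2_le_imp_le) simp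
qed

lemma fro_norm_mult_le:
  assumes A: "A \<in> carrier_mat r n" and B: "B \<in> carrier_mat n c"
  shows "fro_norm (A * B) \<le> fro_norm A * fro_norm B"
  by (rule fro_norm_mult_le_bound[OF A B]) (auto intro: vnorm_mult_le_fro[OF A])

text \<open>An operator and its adjoint have the same norm: \<open>|A^T w|^2 = w \<bullet> A (A^T w)\<close>.\<close>

lemma transpose_bound:
  assumes A: "A \<in> carrier_mat r n" and "0 \<le> a"
    and le: "\<And>v. v \<in> carrier_vec n \<Longrightarrow> vnorm (A *\<^sub>v v) \<le> a * vnorm v"
    and w: "w \<in> carrier_vec r"
  shows "vnorm (A\<^sup>T *\<^sub>v w) \<le> a * vnorm w"
proof -
  define z where "z = A\<^sup>T *\<^sub>v w"
  have z: "z \<in> carrier_vec n" using A w by (auto simp: z_def)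
  have "(vnorm z)\<^sup>2 = w \<bullet> (A *\<^sub>v z)"
    unfolding vnorm_sq using transpose_vec_mult_scalar[OF A z w] by (simp add: z_def)
  also have "\<dots> \<le> vnorm w * vnorm (A *\<^sub>v z)"
    using abs_scalar_prod_le[OF w, of "A *\<^sub>v z"] mult_mat_vec_carrier[OF A z] by linarith
  also have "\<dots> \<le> vnorm w * (a * vnorm z)"
    using le[OF z] by (intro mult_left_mono) auto
  finally have "vnorm z * vnorm z \<le> (a * vnorm w) * vnorm z"
    by (simp add: power2_eq_square algebra_simps)
  moreover have "0 \<le> a * vnorm w" using \<open>0 \<le> a\<close> by simp
  ultimately have "vnorm z \<le> a * vnorm w"
    using vnorm_nonneg[of z] mult_right_le_imp_le[of "vnorm z" "vnorm z" "a * vnorm w"]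
    by (cases "vnorm z = 0") linarith+
  then show ?thesis by (simp add: z_def)
qed

lemma invertible_of_lower_bound:
  assumes R: "R \<in> carrier_mat n n" and "0 < a"
    and le: "\<And>v. v \<in> carrier_vec n \<Longrightarrow> a * vnorm v \<le> vnorm (R *\<^sub>v v)"
  obtains R' where "R' \<in> carrier_mat n n" "R * R' = 1\<^sub>m n" "R' * R = 1\<^sub>m n"
proof -
  have "det R \<noteq> 0"
  proof
    assume "det R = 0"
    then obtain v where v: "v \<in> carrier_vec n" "v \<noteq> 0\<^sub>v n" "R *\<^sub>v v = 0\<^sub>v n"
      using det_0_iff_vec_prod_zero_field[OF R] by auto
    from le[OF v(1)] v(3) vnorm_pos[OF v(1,2)] \<open>0 < a\<close> show False
      by (simp add: mult_le_0_iff)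
  qed
  from det_non_zero_imp_unit[OF R this] that show thesis
    unfolding Units_def ring_mat_def by auto
qed

text \<open>Multiplication from the right acts on rows, so it is the adjoint of the inverse of \<open>R\<close> that has to be
  bounded. This is where a lower bound for \<open>R\<close> is traded for an upper bound for the factor \<open>M\<close>.\<close>

lemma fro_norm_mult_right_ge:
  assumes M: "M \<in> carrier_mat q n" and R: "R \<in> carrier_mat n n" and "0 < a"
    and le: "\<And>v. v \<in> carrier_vec n \<Longrightarrow> a * vnorm v \<le> vnorm (R *\<^sub>v v)"
  shows "a * fro_norm M \<le> fro_norm (M * R)"
proof -
  obtain R' where R': "R' \<in> carrier_mat n n" "R * R' = 1\<^sub>m n" "R' * R = 1\<^sub>m n"
    by (rule invertible_of_lower_bound[OF R \<open>0 < a\<close> le])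
  have b: "vnorm (R' *\<^sub>v v) \<le> (1 / a) * vnorm v" if v: "v \<in> carrier_vec n" for v
  proof -
    have "R *\<^sub>v (R' *\<^sub>v v) = v"
      using assoc_mult_mat_vec[OF R R'(1) v] R'(2) v by simp
    then show ?thesis using le[of "R' *\<^sub>v v"] R' v \<open>0 < a\<close> by (auto simp: field_simps)
  qed
  have "(M * R) * R' = M" using assoc_mult_mat[OF M R R'(1)] R'(2) M by simp
  then have "M\<^sup>T = R'\<^sup>T * (M * R)\<^sup>T"
    using transpose_mult[OF mult_carrier_mat[OF M R] R'(1)] by simp
  moreover have "fro_norm (R'\<^sup>T * (M * R)\<^sup>T) \<le> (1 / a) * fro_norm ((M * R)\<^sup>T)"
    using M R R' \<open>0 < a\<close> by (intro fro_norm_mult_le_bound[of _ n n _ q] transpose_bound[OF R'(1) _ b]) auto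
  ultimately have "fro_norm M \<le> (1 / a) * fro_norm (M * R)"
    using fro_norm_transpose[of M] fro_norm_transpose[of "M * R"] by simp
  then show ?thesis using \<open>0 < a\<close> by (simp add: field_simps)
qed


section \<open>Extremal singular values and the spectral norm\<close>

lemma vnorm_mult_sq:
  assumes X: "X \<in> carrier_mat r n" and v: "v \<in> carrier_vec n"
  shows "v \<bullet> ((X\<^sup>T * X) *\<^sub>v v) = (vnorm (X *\<^sub>v v))\<^sup>2"
proof -
  have Xv: "X *\<^sub>v v \<in> carrier_vec r" using X v by simp
  have "v \<bullet> ((X\<^sup>T * X) *\<^sub>v v) = v \<bullet> (X\<^sup>T *\<^sub>v (X *\<^sub>v v))"
    using X v by (subst assoc_mult_mat_vec[of _ n r _ n]) auto
  also have "\<dots> = (X\<^sup>T *\<^sub>v (X *\<^sub>v v)) \<bullet> v"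
    using X v by (intro comm_scalar_prod[of _ n]) auto
  also have "\<dots> = (X *\<^sub>v v) \<bullet> (X *\<^sub>v v)"
    by (rule transpose_vec_mult_scalar[OF X v Xv])
  finally show ?thesis by (simp add: vnorm_sq)
qed

lemma quadratic_form_le_fro:
  assumes A: "A \<in> carrier_mat n n" and v: "v \<in> carrier_vec n"
  shows "\<bar>v \<bullet> (A *\<^sub>v v)\<bar> \<le> fro_norm A * (vnorm v)\<^sup>2"
proof -
  have "\<bar>v \<bullet> (A *\<^sub>v v)\<bar> \<le> vnorm v * vnorm (A *\<^sub>v v)"
    by (rule abs_scalar_prod_le[of _ n]) (use A v in auto)
  also have "\<dots> \<le> vnorm v * (fro_norm A * vnorm v)"
    by (intro mult_left_mono vnorm_mult_le_fro[OF A v]) simp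
  finally show ?thesis by (simp add: power2_eq_square ac_simps)
qed

text \<open>Evaluate the nonnegative form at \<open>v - s B v\<close>, where \<open>s\<close> is so small that the quadratic term in \<open>s\<close>
  is at most half of the linear one. A positive semidefinite form thus controls \<open>B v\<close>, and an
  invertible one is bounded away from 0.\<close>

lemma psd_mult_sq_le:
  assumes B: "B \<in> carrier_mat n n" and sym: "B\<^sup>T = B"
    and psd: "\<And>v. v \<in> carrier_vec n \<Longrightarrow> 0 \<le> v \<bullet> (B *\<^sub>v v)" and v: "v \<in> carrier_vec n"
  shows "(vnorm (B *\<^sub>v v))\<^sup>2 \<le> (fro_norm B + 1) * (v \<bullet> (B *\<^sub>v v))"
proof -
  define F where "F = fro_norm B + 1"
  have F: "F > 0" "fro_norm B \<le> F" using fro_norm_nonneg[of B] by (auto simp: F_def add_nonneg_pos)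
  define s where "s = 1 / F"
  define y where "y = B *\<^sub>v v"
  have y: "y \<in> carrier_vec n" using B v by (auto simp: y_def)
  have By: "B *\<^sub>v y \<in> carrier_vec n" using B y by auto
  have vBy: "v \<bullet> (B *\<^sub>v y) = y \<bullet> y"
    using transpose_vec_mult_scalar[OF B y v] comm_scalar_prod[OF v By]
      comm_scalar_prod[OF y By] transpose_vec_mult_scalar[OF B v y] sym
    by (metis y_def)
  have "0 \<le> (v - s \<cdot>\<^sub>v y) \<bullet> (B *\<^sub>v (v - s \<cdot>\<^sub>v y))"
    using v y by (intro psd) auto
  also have "B *\<^sub>v (v - s \<cdot>\<^sub>v y) = y - s \<cdot>\<^sub>v (B *\<^sub>v y)"
    using B v y by (simp add: mult_minus_distrib_mat_vec[of _ n n] mult_mat_vec[of _ n n] y_def)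
  also have "(v - s \<cdot>\<^sub>v y) \<bullet> (y - s \<cdot>\<^sub>v (B *\<^sub>v y)) = v \<bullet> y - 2 * s * (y \<bullet> y) + s\<^sup>2 * (y \<bullet> (B *\<^sub>v y))"
    using v y By vBy
    by (simp add: minus_scalar_prod_distrib[of _ n] scalar_prod_minus_distrib[of _ n]
        power2_eq_square algebra_simps)
  also have "s\<^sup>2 * (y \<bullet> (B *\<^sub>v y)) \<le> s\<^sup>2 * (F * (y \<bullet> y))"
    using quadratic_form_le_fro[OF B y] mult_right_mono[OF F(2), of "y \<bullet> y"]
    by (intro mult_left_mono) (auto simp: vnorm_sq simp flip: vnorm_sq)
  also have "s\<^sup>2 * (F * (y \<bullet> y)) = s * (y \<bullet> y)"
    using F by (simp add: s_def power2_eq_square)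
  finally have "s * (y \<bullet> y) \<le> v \<bullet> y" by simp
  then show ?thesis
    unfolding F_def[symmetric] y_def[symmetric] vnorm_sq using F by (simp add: s_def field_simps)
qed

lemma smult_mat_mult_vec:
  fixes A :: "real mat"
  shows "v \<in> carrier_vec (dim_col A) \<Longrightarrow> (c \<cdot>\<^sub>m A) *\<^sub>v v = c \<cdot>\<^sub>v (A *\<^sub>v v)"
  by (intro eq_vecI) auto

text \<open>The infimum \<open>\<mu>\<close> of the Rayleigh quotient is an eigenvalue, which is seen here without compactness of
  the sphere: \<open>B = A - \<mu> I\<close> is positive semidefinite, and if it were invertible, then
  \<open>psd_mult_sq_le\<close> would bound its form below by a positive multiple of \<open>|v|^2\<close>, so that \<open>\<mu>\<close> would not be
  the greatest lower bound.\<close>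

lemma symmetric_least_eigenvalue:
  assumes A: "A \<in> carrier_mat n n" and sym: "A\<^sup>T = A" and n: "1 \<le> n"
  obtains \<mu> where "eigenvalue A \<mu>" "\<And>v. v \<in> carrier_vec n \<Longrightarrow> \<mu> * (vnorm v)\<^sup>2 \<le> v \<bullet> (A *\<^sub>v v)"
proof -
  define V where "V = {v \<in> carrier_vec n. vnorm v = 1}"
  define q where "q = (\<lambda>v. v \<bullet> (A *\<^sub>v v))"
  define \<mu> where "\<mu> = Inf (q ` V)"
  have ne: "unit_vec n 0 \<in> V" using n by (auto simp: V_def)
  have bdd: "bdd_below (q ` V)"
  proof (rule bdd_belowI2)
    fix v assume "v \<in> V"
    then show "- fro_norm A \<le> q v"
      using quadratic_form_le_fro[OF A, of v] by (auto simp: V_def q_def abs_le_iff)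
  qed
  have low: "\<mu> * (vnorm v)\<^sup>2 \<le> v \<bullet> (A *\<^sub>v v)" if v: "v \<in> carrier_vec n" for v
  proof (cases "v = 0\<^sub>v n")
    case True
    then show ?thesis using A by simp
  next
    case False
    define c where "c = 1 / vnorm v"
    have pos: "0 < vnorm v" using vnorm_pos[OF v False] .
    then have "c \<cdot>\<^sub>v v \<in> V" using v by (auto simp: V_def c_def)
    then have "\<mu> \<le> q (c \<cdot>\<^sub>v v)" unfolding \<mu>_def using bdd by (intro cINF_lower)
    also have "\<dots> = c\<^sup>2 * (v \<bullet> (A *\<^sub>v v))"
      using A v by (simp add: q_def mult_mat_vec[of _ n n] power2_eq_square)
    finally show ?thesis using pos by (simp add: c_def field_simps)
  qed
  define B where "B = A - \<mu> \<cdot>\<^sub>m 1\<^sub>m n"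
  have B: "B \<in> carrier_mat n n" using A by (auto simp: B_def)
  have Bv: "B *\<^sub>v v = A *\<^sub>v v - \<mu> \<cdot>\<^sub>v v" if v: "v \<in> carrier_vec n" for v
    using A v by (simp add: B_def minus_mult_distrib_mat_vec[of _ n n] smult_mat_mult_vec)
  have symB: "B\<^sup>T = B"
  proof (rule eq_matI)
    fix i j assume "i < dim_row B" "j < dim_col B"
    then show "B\<^sup>T $$ (i, j) = B $$ (i, j)"
      using A B arg_cong[OF sym, of "\<lambda>M. M $$ (i, j)"] by (auto simp: B_def)
  qed (use B in auto)
  have Bq: "v \<bullet> (B *\<^sub>v v) = v \<bullet> (A *\<^sub>v v) - \<mu> * (vnorm v)\<^sup>2" if v: "v \<in> carrier_vec n" for v
    using A v by (simp add: Bv scalar_prod_minus_distrib[of _ n] vnorm_sq)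
  have "det B = 0"
  proof (rule ccontr)
    assume "det B \<noteq> 0"
    from det_non_zero_imp_unit[OF B this] obtain B' where B': "B' \<in> carrier_mat n n" "B' * B = 1\<^sub>m n"
      unfolding Units_def ring_mat_def by auto
    define C where "C = (fro_norm B')\<^sup>2 * (fro_norm B + 1) + 1"
    have C: "C > 0" "C \<ge> (fro_norm B')\<^sup>2 * (fro_norm B + 1)"
      using fro_norm_nonneg[of B] by (auto simp: C_def intro!: add_nonneg_pos mult_nonneg_nonneg)
    have "\<mu> + 1 / C \<le> q v" if "v \<in> V" for v
    proof -
      have v: "v \<in> carrier_vec n" "vnorm v = 1" using that by (auto simp: V_def)
      have nn: "0 \<le> v \<bullet> (B *\<^sub>v v)" using low[OF v(1)] Bq[OF v(1)] v by auto
      have "v = B' *\<^sub>v (B *\<^sub>v v)" using assoc_mult_mat_vec[OF B'(1) B v(1)] B'(2) v(1) by simp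
      then have "1 \<le> fro_norm B' * vnorm (B *\<^sub>v v)"
        using vnorm_mult_le_fro[OF B'(1), of "B *\<^sub>v v"] B v by simp
      then have "1 \<le> (fro_norm B' * vnorm (B *\<^sub>v v))\<^sup>2" by (rule one_le_power)
      also have "\<dots> \<le> (fro_norm B')\<^sup>2 * ((fro_norm B + 1) * (v \<bullet> (B *\<^sub>v v)))"
        unfolding power_mult_distrib using low Bq symB
        by (intro mult_left_mono psd_mult_sq_le[OF B _ _ v(1)]) auto
      also have "\<dots> \<le> C * (v \<bullet> (B *\<^sub>v v))"
        using mult_right_mono[OF C(2) nn] by (simp add: mult.assoc)
      finally have "1 / C \<le> v \<bullet> (B *\<^sub>v v)" using C by (simp add: field_simps)
      then show ?thesis using Bq[OF v(1)] v(2) by (simp add: q_def)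
    qed
    then have "\<mu> + 1 / C \<le> \<mu>" unfolding \<mu>_def using ne by (intro cINF_greatest) auto
    then show False using C by simp
  qed
  then obtain v where v: "v \<in> carrier_vec n" "v \<noteq> 0\<^sub>v n" "B *\<^sub>v v = 0\<^sub>v n"
    using det_0_iff_vec_prod_zero_field[OF B] by auto
  have "A *\<^sub>v v = \<mu> \<cdot>\<^sub>v v"
  proof (rule eq_vecI)
    fix i assume "i < dim_vec (\<mu> \<cdot>\<^sub>v v)"
    then show "(A *\<^sub>v v) $ i = (\<mu> \<cdot>\<^sub>v v) $ i"
      using A v(1) arg_cong[OF v(3)[unfolded Bv[OF v(1)]], of "\<lambda>w. w $ i"] by (auto simp del: index_mult_mat_vec)
  qed (use A v in auto)
  then have "eigenvalue A \<mu>" using A v unfolding eigenvalue_def eigenvector_def by auto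
  then show thesis using low by (rule that)
qed

lemma singular_values_attained:
  assumes X: "X \<in> carrier_mat r n" and "n \<le> r" and s: "s \<in> singular_values X"
  shows "0 \<le> s" "\<exists>v\<in>carrier_vec n. v \<noteq> 0\<^sub>v n \<and> vnorm (X *\<^sub>v v) = s * vnorm v"
proof -
  obtain e v where e: "s = sqrt e" and v: "v \<in> carrier_vec n" "v \<noteq> 0\<^sub>v n" "(X\<^sup>T * X) *\<^sub>v v = e \<cdot>\<^sub>v v"
    using s X \<open>n \<le> r\<close> unfolding singular_values_def eigenvalue_def eigenvector_def by auto
  have pos: "0 < vnorm v" using vnorm_pos v by auto
  have eq: "(vnorm (X *\<^sub>v v))\<^sup>2 = e * (vnorm v)\<^sup>2"
    using vnorm_mult_sq[OF X v(1)] v by (simp add: vnorm_sq)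
  then have "0 \<le> e * (vnorm v)\<^sup>2" by (metis zero_le_power2)
  then have e0: "0 \<le> e" using pos by (simp add: zero_le_mult_iff)
  then show "0 \<le> s" by (simp add: e)
  have "vnorm (X *\<^sub>v v) = sqrt (e * (vnorm v)\<^sup>2)" unfolding eq[symmetric] by simp
  also have "\<dots> = s * vnorm v" by (simp add: e real_sqrt_mult)
  finally show "\<exists>v\<in>carrier_vec n. v \<noteq> 0\<^sub>v n \<and> vnorm (X *\<^sub>v v) = s * vnorm v" using v by blast
qed

lemma finite_singular_values: "finite (singular_values X)"
proof -
  define G where "G = (if dim_col X \<le> dim_row X then X\<^sup>T * X else X * X\<^sup>T)"
  have G: "G \<in> carrier_mat (dim_row G) (dim_row G)" by (auto simp: G_def)
  have "char_poly G \<noteq> 0" using degree_monic_char_poly[OF G] by auto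
  then have "finite {e. eigenvalue G e}"
    unfolding eigenvalue_root_char_poly[OF G] by (rule poly_roots_finite)
  then show ?thesis unfolding singular_values_def G_def by simp
qed

text \<open>The smallest eigenvalues of \<open>X^T X\<close> and of \<open>- X^T X\<close> give the two inequalities; that the sets of
  singular values are nonempty and finite makes the minimum and maximum of the definitions
  meaningful.\<close>

lemma extremal_singular_values:
  assumes X: "X \<in> carrier_mat r n" and "n \<le> r" and "1 \<le> n"
  shows "sigma_min X \<in> singular_values X" "sigma_max X \<in> singular_values X"
    and "\<And>v. v \<in> carrier_vec n \<Longrightarrow> sigma_min X * vnorm v \<le> vnorm (X *\<^sub>v v)"
    and "\<And>v. v \<in> carrier_vec n \<Longrightarrow> vnorm (X *\<^sub>v v) \<le> sigma_max X * vnorm v"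
proof -
  define G where "G = X\<^sup>T * X"
  have G: "G \<in> carrier_mat n n" "- G \<in> carrier_mat n n" using X by (auto simp: G_def)
  have sym: "G\<^sup>T = G" using X by (simp add: G_def transpose_mult[of _ n r _ n])
  have sym': "(- G)\<^sup>T = - G"
  proof -
    have "(- G)\<^sup>T = - (G\<^sup>T)" by (rule eq_matI) auto
    then show ?thesis using sym by simp
  qed
  have sv: "sqrt e \<in> singular_values X" if "eigenvalue G e" for e
    using that X \<open>n \<le> r\<close> by (auto simp: singular_values_def G_def)
  have mono: "a * vnorm v \<le> b" if "a \<le> sqrt e" "e * (vnorm v)\<^sup>2 \<le> b\<^sup>2" "0 \<le> b" for a b e v
  proof -
    have "sqrt (e * (vnorm v)\<^sup>2) \<le> b" using that by (intro real_le_lsqrt) auto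
    then have "sqrt e * vnorm v \<le> b" by (simp add: real_sqrt_mult)
    then show ?thesis using mult_right_mono[OF that(1) vnorm_nonneg[of v]] by linarith
  qed
  obtain \<mu> where \<mu>: "eigenvalue G \<mu>" "\<And>v. v \<in> carrier_vec n \<Longrightarrow> \<mu> * (vnorm v)\<^sup>2 \<le> v \<bullet> (G *\<^sub>v v)"
    using symmetric_least_eigenvalue[OF G(1) sym \<open>1 \<le> n\<close>] by blast
  obtain \<nu> where \<nu>: "eigenvalue (- G) \<nu>" "\<And>v. v \<in> carrier_vec n \<Longrightarrow> \<nu> * (vnorm v)\<^sup>2 \<le> v \<bullet> ((- G) *\<^sub>v v)"
    using symmetric_least_eigenvalue[OF G(2) sym' \<open>1 \<le> n\<close>] by blast
  have ev: "eigenvalue G (- \<nu>)"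
  proof -
    obtain v where v: "v \<in> carrier_vec n" "v \<noteq> 0\<^sub>v n" "(- G) *\<^sub>v v = \<nu> \<cdot>\<^sub>v v"
      using \<nu>(1) G unfolding eigenvalue_def eigenvector_def by auto
    have "G *\<^sub>v v = - ((- G) *\<^sub>v v)" using v(1) G by simp
    also have "\<dots> = (- \<nu>) \<cdot>\<^sub>v v" unfolding v(3) by (intro eq_vecI) auto
    finally show ?thesis using v G unfolding eigenvalue_def eigenvector_def by auto
  qed
  have ne: "singular_values X \<noteq> {}" using sv[OF \<mu>(1)] by blast
  show "sigma_min X \<in> singular_values X" "sigma_max X \<in> singular_values X"
    unfolding sigma_min_def sigma_max_def using finite_singular_values ne by auto
  show "sigma_min X * vnorm v \<le> vnorm (X *\<^sub>v v)" if v: "v \<in> carrier_vec n" for v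
  proof (rule mono)
    show "sigma_min X \<le> sqrt \<mu>" unfolding sigma_min_def using finite_singular_values sv[OF \<mu>(1)] by auto
    show "\<mu> * (vnorm v)\<^sup>2 \<le> (vnorm (X *\<^sub>v v))\<^sup>2" 
      using \<mu>(2)[OF v] vnorm_mult_sq[OF X v] by (simp add: G_def)
  qed simp
  show "vnorm (X *\<^sub>v v) \<le> sigma_max X * vnorm v" if v: "v \<in> carrier_vec n" for v
  proof -
    have "sqrt (- \<nu>) \<le> sigma_max X" unfolding sigma_max_def using finite_singular_values sv[OF ev] by auto
    then have 1: "sqrt (- \<nu>) * vnorm v \<le> sigma_max X * vnorm v" by (rule mult_right_mono) simp
    have "v \<bullet> ((- G) *\<^sub>v v) = - (v \<bullet> (G *\<^sub>v v))" using v G by simp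
    then have "(vnorm (X *\<^sub>v v))\<^sup>2 \<le> (- \<nu>) * (vnorm v)\<^sup>2"
      using \<nu>(2)[OF v] vnorm_mult_sq[OF X v] by (simp add: G_def)
    then have "vnorm (X *\<^sub>v v) \<le> sqrt ((- \<nu>) * (vnorm v)\<^sup>2)" by (rule real_le_rsqrt)
    also have "\<dots> = sqrt (- \<nu>) * vnorm v" by (simp add: real_sqrt_mult del: mult_minus_left)
    finally show ?thesis using 1 by linarith
  qed
qed

lemma sigma_min_ge:
  assumes X: "X \<in> carrier_mat r n" and "n \<le> r" and "1 \<le> n"
    and le: "\<And>v. v \<in> carrier_vec n \<Longrightarrow> c * vnorm v \<le> vnorm (X *\<^sub>v v)"
  shows "c \<le> sigma_min X"
proof -
  obtain v where v: "v \<in> carrier_vec n" "v \<noteq> 0\<^sub>v n" "vnorm (X *\<^sub>v v) = sigma_min X * vnorm v"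
    using singular_values_attained(2)[OF X \<open>n \<le> r\<close> extremal_singular_values(1)[OF X \<open>n \<le> r\<close> \<open>1 \<le> n\<close>]] by blast
  then show ?thesis using le[OF v(1)] vnorm_pos[OF v(1,2)] by simp
qed

lemma sigma_max_le:
  assumes X: "X \<in> carrier_mat r n" and "n \<le> r" and "1 \<le> n"
    and le: "\<And>v. v \<in> carrier_vec n \<Longrightarrow> vnorm (X *\<^sub>v v) \<le> c * vnorm v"
  shows "sigma_max X \<le> c"
proof -
  obtain v where v: "v \<in> carrier_vec n" "v \<noteq> 0\<^sub>v n" "vnorm (X *\<^sub>v v) = sigma_max X * vnorm v"
    using singular_values_attained(2)[OF X \<open>n \<le> r\<close> extremal_singular_values(2)[OF X \<open>n \<le> r\<close> \<open>1 \<le> n\<close>]] by blast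
  then show ?thesis using le[OF v(1)] vnorm_pos[OF v(1,2)] by simp
qed

lemma spec_norm_le:
  assumes X: "X \<in> carrier_mat r n"
    and le: "\<And>v. v \<in> carrier_vec n \<Longrightarrow> vnorm (X *\<^sub>v v) \<le> c * vnorm v" and "0 \<le> c"
  shows "spec_norm X \<le> c"
  unfolding spec_norm_def
proof (rule cSUP_least)
  show "{x \<in> carrier_vec (dim_col X). vnorm x \<le> 1} \<noteq> {}"
    by (auto intro!: exI[of _ "0\<^sub>v (dim_col X)"])
  fix x assume "x \<in> {x \<in> carrier_vec (dim_col X). vnorm x \<le> 1}"
  then show "vnorm (X *\<^sub>v x) \<le> c"
    using le[of x] X mult_left_mono[of "vnorm x" 1 c] \<open>0 \<le> c\<close> by auto
qed

lemma spec_norm_le_fro: "spec_norm X \<le> fro_norm X"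
  by (rule spec_norm_le) (auto intro: vnorm_mult_le_fro)

lemma spec_norm_upper:
  assumes "x \<in> carrier_vec (dim_col X)" "vnorm x \<le> 1"
  shows "vnorm (X *\<^sub>v x) \<le> spec_norm X"
  unfolding spec_norm_def
proof (rule cSUP_upper)
  show "bdd_above ((\<lambda>x. vnorm (X *\<^sub>v x)) ` {x \<in> carrier_vec (dim_col X). vnorm x \<le> 1})"
  proof (rule bdd_aboveI2)
    fix x assume x: "x \<in> {x \<in> carrier_vec (dim_col X). vnorm x \<le> 1}"
    then have "vnorm (X *\<^sub>v x) \<le> fro_norm X * vnorm x" by (intro vnorm_mult_le_fro) auto
    then show "vnorm (X *\<^sub>v x) \<le> fro_norm X"
      using x mult_left_mono[of "vnorm x" 1 "fro_norm X"] by auto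
  qed
qed (use assms in simp)

lemma spec_norm_nonneg [simp]: "0 \<le> spec_norm X"
  by (rule order_trans[OF vnorm_nonneg spec_norm_upper[of "0\<^sub>v (dim_col X)"]]) auto

lemma vnorm_mult_le_spec:
  assumes X: "X \<in> carrier_mat r n" and v: "v \<in> carrier_vec n"
  shows "vnorm (X *\<^sub>v v) \<le> spec_norm X * vnorm v"
proof (cases "v = 0\<^sub>v n")
  case True
  have "X *\<^sub>v 0\<^sub>v n = 0\<^sub>v r" using X by (intro eq_vecI) auto
  then show ?thesis using True by simp
next
  case False
  have pos: "0 < vnorm v" using vnorm_pos[OF v False] .
  have "vnorm (X *\<^sub>v ((1 / vnorm v) \<cdot>\<^sub>v v)) \<le> spec_norm X"
    using X v pos by (intro spec_norm_upper) auto
  moreover have "X *\<^sub>v ((1 / vnorm v) \<cdot>\<^sub>v v) = (1 / vnorm v) \<cdot>\<^sub>v (X *\<^sub>v v)" by (rule mult_mat_vec[OF X v])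
  ultimately show ?thesis using pos by (simp add: field_simps)
qed

lemma fro_norm_le_sqrt_spec:
  assumes X: "X \<in> carrier_mat r n" and "0 \<le> c"
    and le: "\<And>v. v \<in> carrier_vec n \<Longrightarrow> vnorm (X *\<^sub>v v) \<le> c * vnorm v"
  shows "fro_norm X \<le> sqrt (real n) * c"
proof -
  have col: "col X j = X *\<^sub>v unit_vec n j" if "j < n" for j
    using X that by (intro eq_vecI) auto
  have "(fro_norm X)\<^sup>2 = (\<Sum>j<n. (vnorm (X *\<^sub>v unit_vec n j))\<^sup>2)"
    using X by (simp add: fro_norm_sq_cols col)
  also have "\<dots> \<le> (\<Sum>j<n. c\<^sup>2)"
  proof (intro sum_mono power_mono)
    fix j assume "j \<in> {..<n}"
    then show "vnorm (X *\<^sub>v unit_vec n j) \<le> c" using le[of "unit_vec n j"] by simp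
  qed simp
  also have "\<dots> = (sqrt (real n) * c)\<^sup>2" by (simp add: power_mult_distrib)
  finally show ?thesis by (rule power2_le_imp_le) (simp add: \<open>0 \<le> c\<close>)
qed


section \<open>Backward stable least squares\<close>

text \<open>If the gradient \<open>g = A^T (b - A x)\<close> were nonzero, a short step from \<open>x\<close> in the direction \<open>g\<close> would
  decrease the residual.\<close>

lemma least_squares_normal_equation:
  assumes A: "A \<in> carrier_mat r n" and b: "b \<in> carrier_vec r"
    and min: "is_arg_min (\<lambda>y. vnorm (A *\<^sub>v y - b)) (\<lambda>y. y \<in> carrier_vec n) x"
  shows "A\<^sup>T *\<^sub>v (b - A *\<^sub>v x) = 0\<^sub>v n"
proof (rule ccontr)
  assume ne: "A\<^sup>T *\<^sub>v (b - A *\<^sub>v x) \<noteq> 0\<^sub>v n"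
  define \<rho> where "\<rho> = b - A *\<^sub>v x"
  define g where "g = A\<^sup>T *\<^sub>v \<rho>"
  define F where "F = (fro_norm A)\<^sup>2 + 1"
  define t where "t = 1 / F"
  have F: "F > 0" "(fro_norm A)\<^sup>2 \<le> F" by (auto simp: F_def add_nonneg_pos)
  have x: "x \<in> carrier_vec n" and least: "\<And>y. y \<in> carrier_vec n \<Longrightarrow> vnorm (A *\<^sub>v x - b) \<le> vnorm (A *\<^sub>v y - b)"
    using min by (auto simp: is_arg_min_def not_less)
  have \<rho>: "\<rho> \<in> carrier_vec r" using A x b by (auto simp: \<rho>_def)
  have g: "g \<in> carrier_vec n" using A \<rho> by (auto simp: g_def)
  have Ag: "A *\<^sub>v g \<in> carrier_vec r" using A g by auto
  have gpos: "0 < (vnorm g)\<^sup>2" using vnorm_pos[OF g] ne by (simp add: g_def \<rho>_def)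
  have "vnorm \<rho> = vnorm (A *\<^sub>v x - b)"
  proof -
    have "\<rho> = - (A *\<^sub>v x - b)" using A x b by (auto simp: \<rho>_def)
    then show ?thesis by simp
  qed
  also have "\<dots> \<le> vnorm (A *\<^sub>v (x + t \<cdot>\<^sub>v g) - b)" using x g by (intro least) auto
  also have "A *\<^sub>v (x + t \<cdot>\<^sub>v g) - b = - (\<rho> - t \<cdot>\<^sub>v (A *\<^sub>v g))"
    using A x g b by (auto simp: \<rho>_def mult_add_distrib_mat_vec[of _ r n] mult_mat_vec[of _ r n])
  finally have "(vnorm \<rho>)\<^sup>2 \<le> (vnorm (\<rho> - t \<cdot>\<^sub>v (A *\<^sub>v g)))\<^sup>2" by (intro power_mono) auto
  also have "\<dots> = (vnorm \<rho>)\<^sup>2 - 2 * t * (\<rho> \<bullet> (A *\<^sub>v g)) + t\<^sup>2 * (vnorm (A *\<^sub>v g))\<^sup>2"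
    unfolding vnorm_sq using \<rho> Ag comm_scalar_prod[OF Ag \<rho>]
    by (simp add: minus_scalar_prod_distrib[of _ r] scalar_prod_minus_distrib[of _ r]
        power2_eq_square algebra_simps)
  also have "\<rho> \<bullet> (A *\<^sub>v g) = (vnorm g)\<^sup>2"
    using transpose_vec_mult_scalar[OF A g \<rho>] by (simp add: g_def vnorm_sq)
  finally have 1: "2 * t * (vnorm g)\<^sup>2 \<le> t\<^sup>2 * (vnorm (A *\<^sub>v g))\<^sup>2" by simp
  have "(vnorm (A *\<^sub>v g))\<^sup>2 \<le> (fro_norm A * vnorm g)\<^sup>2"
    by (intro power_mono vnorm_mult_le_fro[OF A g]) simp
  also have "\<dots> \<le> F * (vnorm g)\<^sup>2" unfolding power_mult_distrib using F by (intro mult_right_mono) auto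
  finally have "t\<^sup>2 * (vnorm (A *\<^sub>v g))\<^sup>2 \<le> t\<^sup>2 * (F * (vnorm g)\<^sup>2)" by (rule mult_left_mono) simp
  also have "\<dots> = t * (vnorm g)\<^sup>2" using F by (simp add: t_def power2_eq_square)
  finally have "t * (vnorm g)\<^sup>2 \<le> 0" using 1 by simp
  then show False using F gpos by (simp add: t_def mult_le_0_iff field_simps)
qed

lemma near_orthonormal_bounds:
  assumes S: "S \<in> carrier_mat k s" and near: "fro_norm (1\<^sub>m s - S\<^sup>T * S) \<le> 1/50"
    and y: "y \<in> carrier_vec s"
  shows "98/100 * vnorm y \<le> vnorm (S *\<^sub>v y)" "vnorm (S *\<^sub>v y) \<le> 101/100 * vnorm y"
proof -
  have C: "1\<^sub>m s - S\<^sup>T * S \<in> carrier_mat s s" using S by auto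
  have "y \<bullet> ((1\<^sub>m s - S\<^sup>T * S) *\<^sub>v y) = y \<bullet> (y - (S\<^sup>T * S) *\<^sub>v y)"
    using S y by (subst minus_mult_distrib_mat_vec[of _ s s]) (auto simp del: assoc_mult_mat_vec)
  also have "\<dots> = (vnorm y)\<^sup>2 - (vnorm (S *\<^sub>v y))\<^sup>2"
    unfolding vnorm_mult_sq[OF S y, symmetric] vnorm_sq[of y]
    by (rule scalar_prod_minus_distrib[of _ s]) (use y mult_mat_vec_carrier[OF mult_carrier_mat[OF _ S] y, of "S\<^sup>T" s] S in auto)
  finally have "\<bar>(vnorm y)\<^sup>2 - (vnorm (S *\<^sub>v y))\<^sup>2\<bar> \<le> fro_norm (1\<^sub>m s - S\<^sup>T * S) * (vnorm y)\<^sup>2"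
    using quadratic_form_le_fro[OF C y] by simp
  also have "\<dots> \<le> 1/50 * (vnorm y)\<^sup>2" by (intro mult_right_mono near) simp
  finally have b: "(vnorm y)\<^sup>2 * (49/50) \<le> (vnorm (S *\<^sub>v y))\<^sup>2" "(vnorm (S *\<^sub>v y))\<^sup>2 \<le> (51/50) * (vnorm y)\<^sup>2"
    by linarith+
  show "98/100 * vnorm y \<le> vnorm (S *\<^sub>v y)"
  proof (rule power2_le_imp_le)
    have "(98/100 * vnorm y)\<^sup>2 = 9604/10000 * (vnorm y)\<^sup>2" by (simp add: power2_eq_square)
    then show "(98/100 * vnorm y)\<^sup>2 \<le> (vnorm (S *\<^sub>v y))\<^sup>2"
      using b(1) zero_le_power2[of "vnorm y"] by linarith
  qed simp
  show "vnorm (S *\<^sub>v y) \<le> 101/100 * vnorm y"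
  proof (rule power2_le_imp_le)
    have "(101/100 * vnorm y)\<^sup>2 = 10201/10000 * (vnorm y)\<^sup>2" by (simp add: power2_eq_square)
    then show "(vnorm (S *\<^sub>v y))\<^sup>2 \<le> (101/100 * vnorm y)\<^sup>2"
      using b(2) zero_le_power2[of "vnorm y"] by linarith
  qed simp
qed

text \<open>The computed solution satisfies the normal equations of the perturbed problem exactly. Expressing
  the residual \<open>p - S x\<close> through the perturbed residual costs one term \<open>dS x - dp\<close> of order \<open>u\<close>, and
  replacing \<open>S^T\<close> by \<open>(S + dS)^T\<close> in front of the perturbed residual, which annihilates it, another one.\<close>

lemma backward_stable_least_squares:
  assumes S: "S \<in> carrier_mat k s" and near: "fro_norm (1\<^sub>m s - S\<^sup>T * S) \<le> 1/50"
    and pc: "p \<in> carrier_vec k" and dS: "dS \<in> carrier_mat k s" and dp: "dp \<in> carrier_vec k"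
    and min: "is_arg_min (\<lambda>y. vnorm ((S + dS) *\<^sub>v y - (p + dp))) (\<lambda>y. y \<in> carrier_vec s) x"
    and dS_le: "fro_norm dS \<le> (1/100) * u * spec_norm S" and dp_le: "vnorm dp \<le> (1/100) * u * vnorm p"
    and u: "0 < u" "u \<le> 1/1000"
  shows "vnorm x \<le> (103/100) * vnorm p" "vnorm (p - S *\<^sub>v x) \<le> (10001/10000) * vnorm p"
    and "vnorm (S\<^sup>T *\<^sub>v (p - S *\<^sub>v x)) \<le> (32/1000) * u * vnorm p"
proof -
  define A where "A = S + dS"
  define b where "b = p + dp"
  define \<rho> where "\<rho> = b - A *\<^sub>v x"
  define N where "N = vnorm p"
  have N: "0 \<le> N" "0 \<le> u * N" "u * N \<le> 1/1000 * N"
    using u mult_right_mono[OF u(2), of N] by (auto simp: N_def)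
  have A: "A \<in> carrier_mat k s" and b: "b \<in> carrier_vec k" using S dS pc dp by (auto simp: A_def b_def)
  have x: "x \<in> carrier_vec s" using min by (simp add: is_arg_min_def)
  have Ax: "A *\<^sub>v x \<in> carrier_vec k" and Sx: "S *\<^sub>v x \<in> carrier_vec k" and dSx: "dS *\<^sub>v x \<in> carrier_vec k"
    using A S dS x by auto
  have \<rho>: "\<rho> \<in> carrier_vec k" using b Ax by (auto simp: \<rho>_def)
  have Ax_eq: "A *\<^sub>v x = S *\<^sub>v x + dS *\<^sub>v x" unfolding A_def by (rule add_mult_distrib_mat_vec[OF S dS x])
  have normal: "A\<^sup>T *\<^sub>v \<rho> = 0\<^sub>v s"
    unfolding \<rho>_def by (rule least_squares_normal_equation[OF A b]) (use min in \<open>simp add: A_def b_def\<close>)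
  have specS: "spec_norm S \<le> 101/100"
    by (rule spec_norm_le[OF S]) (use near_orthonormal_bounds(2)[OF S near] in auto)
  have dS_le': "fro_norm dS \<le> (101/10000) * u"
  proof -
    have "(1/100) * u * spec_norm S \<le> (1/100) * u * (101/100)" using u specS by (intro mult_left_mono) auto
    then show ?thesis using dS_le by linarith
  qed
  have dS_small: "fro_norm dS \<le> (1/10000)" using dS_le' u by simp
  have b_le: "vnorm b \<le> (100001/100000) * N"
    using vnorm_add_le[OF pc dp] dp_le N by (simp add: b_def N_def)
  \<comment> \<open>By the normal equations \<open>A x\<close> is orthogonal to the residual, so both are bounded by \<open>b\<close>.\<close>
  have orth: "\<rho> \<bullet> (A *\<^sub>v x) = 0"
    using transpose_vec_mult_scalar[OF A x \<rho>] normal x by simp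
  have "(vnorm b)\<^sup>2 = (vnorm \<rho>)\<^sup>2 + (vnorm (A *\<^sub>v x))\<^sup>2"
  proof -
    have "b = \<rho> + A *\<^sub>v x" unfolding \<rho>_def by (rule eq_vecI) (use b A in auto)
    then show ?thesis
      using \<rho> Ax orth comm_scalar_prod[OF Ax \<rho>]
      by (simp add: vnorm_sq add_scalar_prod_distrib[of _ k] scalar_prod_add_distrib[of _ k])
  qed
  then have le_b: "vnorm \<rho> \<le> vnorm b" "vnorm (A *\<^sub>v x) \<le> vnorm b"
    by (auto intro!: power2_le_imp_le[of "vnorm \<rho>"] power2_le_imp_le[of "vnorm (A *\<^sub>v x)"])
  have dSx_le: "vnorm (dS *\<^sub>v x) \<le> fro_norm dS * vnorm x" by (rule vnorm_mult_le_fro[OF dS x])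
  have "98/100 * vnorm x \<le> vnorm (S *\<^sub>v x)" by (rule near_orthonormal_bounds(1)[OF S near x])
  also have "\<dots> \<le> vnorm (A *\<^sub>v x) + vnorm (dS *\<^sub>v x)"
  proof -
    have "S *\<^sub>v x = A *\<^sub>v x - dS *\<^sub>v x" unfolding Ax_eq by (rule eq_vecI) (use S dS x in auto)
    then show ?thesis using vnorm_diff_le[OF Ax dSx] by simp
  qed
  also have "\<dots> \<le> (100001/100000) * N + (1/10000) * vnorm x"
    using le_b b_le dSx_le mult_right_mono[OF dS_small vnorm_nonneg[of x]] by linarith
  finally show x_le: "vnorm x \<le> (103/100) * vnorm p" using N by (simp add: N_def)
  have "fro_norm dS * vnorm x \<le> ((101/10000) * u) * ((103/100) * N)"
    using dS_le' x_le u by (intro mult_mono) (auto simp: N_def)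
  then have dSx_le': "vnorm (dS *\<^sub>v x) \<le> (105/10000) * (u * N)" using dSx_le N by simp
  define d where "d = dS *\<^sub>v x - dp"
  have d: "d \<in> carrier_vec k" using dSx dp by (auto simp: d_def)
  have d_le: "vnorm d \<le> (205/10000) * (u * N)"
    using vnorm_diff_le[OF dSx dp] dSx_le' dp_le by (simp add: d_def N_def)
  have res: "p - S *\<^sub>v x = \<rho> + d"
    unfolding \<rho>_def b_def d_def Ax_eq by (rule eq_vecI) (use pc dp S dS x in auto)
  show "vnorm (p - S *\<^sub>v x) \<le> (10001/10000) * vnorm p"
    unfolding res using vnorm_add_le[OF \<rho> d] d_le le_b b_le N by (simp add: N_def)
  have "S\<^sup>T *\<^sub>v \<rho> = - (dS\<^sup>T *\<^sub>v \<rho>)"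
  proof -
    have "S\<^sup>T *\<^sub>v \<rho> + dS\<^sup>T *\<^sub>v \<rho> = 0\<^sub>v s"
      using normal S dS \<rho> by (simp add: A_def transpose_add[of _ k s] add_mult_distrib_mat_vec[of _ s k])
    moreover have "x = - y" if "x + y = 0\<^sub>v s" "x \<in> carrier_vec s" "y \<in> carrier_vec s" for x y :: "real vec"
    proof (rule eq_vecI)
      fix i assume "i < dim_vec (- y)"
      then show "x $ i = (- y) $ i" using arg_cong[OF that(1), of "\<lambda>v. v $ i"] that(2,3) by auto
    qed (use that in auto)
    ultimately show ?thesis using S dS \<rho> by auto
  qed
  then have "vnorm (S\<^sup>T *\<^sub>v \<rho>) = vnorm (dS\<^sup>T *\<^sub>v \<rho>)" by simp
  also have "\<dots> \<le> fro_norm dS * vnorm \<rho>"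
    by (rule transpose_bound[OF dS]) (auto intro: vnorm_mult_le_fro[OF dS] \<rho>)
  also have "\<dots> \<le> ((101/10000) * u) * ((100001/100000) * N)"
    using dS_le' le_b b_le u by (intro mult_mono) auto
  finally have 1: "vnorm (S\<^sup>T *\<^sub>v \<rho>) \<le> (11/1000) * (u * N)" using N by simp
  have "vnorm (S\<^sup>T *\<^sub>v d) \<le> 101/100 * vnorm d"
    by (rule transpose_bound[OF S]) (auto intro: near_orthonormal_bounds(2)[OF S near, simplified] d)
  then have 2: "vnorm (S\<^sup>T *\<^sub>v d) \<le> (21/1000) * (u * N)" using d_le N by simp
  have "S\<^sup>T *\<^sub>v (p - S *\<^sub>v x) = S\<^sup>T *\<^sub>v \<rho> + S\<^sup>T *\<^sub>v d"
    unfolding res using S \<rho> d by (intro mult_add_distrib_mat_vec[of _ s k]) auto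
  then have "vnorm (S\<^sup>T *\<^sub>v (p - S *\<^sub>v x)) \<le> vnorm (S\<^sup>T *\<^sub>v \<rho>) + vnorm (S\<^sup>T *\<^sub>v d)"
    using S \<rho> d by (simp add: vnorm_add_le[of _ s])
  then show "vnorm (S\<^sup>T *\<^sub>v (p - S *\<^sub>v x)) \<le> (32/1000) * u * vnorm p" using 1 2 by (simp add: N_def)
qed

lemma fro_norm_le_cols:
  assumes "dim_col X = dim_col Y" "0 \<le> c"
    and "\<And>j. j < dim_col Y \<Longrightarrow> vnorm (col X j) \<le> c * vnorm (col Y j)"
  shows "fro_norm X \<le> c * fro_norm Y"
proof -
  have "(fro_norm X)\<^sup>2 \<le> (\<Sum>j<dim_col Y. (c * vnorm (col Y j))\<^sup>2)"
    unfolding fro_norm_sq_cols assms(1) using assms(3) by (intro sum_mono power_mono) auto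
  also have "\<dots> = (c * fro_norm Y)\<^sup>2"
    by (simp add: fro_norm_sq_cols power_mult_distrib sum_distrib_left)
  finally show ?thesis by (rule power2_le_imp_le) (simp add: assms(2))
qed


section \<open>Sketches, condition numbers and Gram matrices\<close>

lemma eps_embedding_mat_iff:
  assumes X: "X \<in> carrier_mat n c"
  shows "eps_embedding_mat \<epsilon> \<Theta> X \<longleftrightarrow> \<epsilon> < 1 \<and> (\<forall>v\<in>carrier_vec c. \<forall>v'\<in>carrier_vec c.
    \<bar>(X *\<^sub>v v) \<bullet> (X *\<^sub>v v') - (\<Theta> *\<^sub>v (X *\<^sub>v v)) \<bullet> (\<Theta> *\<^sub>v (X *\<^sub>v v'))\<bar> \<le> \<epsilon> * vnorm (X *\<^sub>v v) * vnorm (X *\<^sub>v v'))"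
proof -
  interpret vec_space "TYPE(real)" n .
  have "col_space X = (\<lambda>v. X *\<^sub>v v) ` carrier_vec c"
    using col_space_eq[OF X] X by auto
  then show ?thesis using X unfolding eps_embedding_mat_def eps_embedding_def by simp
qed

text \<open>Here \<open>a\<close> and \<open>f\<close> stand for the sketches of \<open>w\<close> and \<open>e\<close>. A relative perturbation by \<open>0.0075\<close> raises the
  constant 1/2 to at most \<open>0.535 / 0.985\<close>. The bound 5/9 is chosen because \<open>(1 - 5/9)^(-1/2) = 3/2\<close> is
  rational.\<close>

lemma embedding_perturbed:
  assumes car: "w \<in> carrier_vec n" "w' \<in> carrier_vec n" "e \<in> carrier_vec n" "e' \<in> carrier_vec n"
      "a \<in> carrier_vec k" "a' \<in> carrier_vec k" "f \<in> carrier_vec k" "f' \<in> carrier_vec k"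
    and emb: "\<bar>w \<bullet> w' - a \<bullet> a'\<bar> \<le> 1/2 * (vnorm w * vnorm w')"
    and a: "vnorm a \<le> (1225/1000) * vnorm w" "vnorm a' \<le> (1225/1000) * vnorm w'"
    and e: "vnorm e \<le> (75/10000) * vnorm w" "vnorm e' \<le> (75/10000) * vnorm w'"
    and f: "vnorm f \<le> (75/10000) * vnorm w" "vnorm f' \<le> (75/10000) * vnorm w'"
  shows "\<bar>(w + e) \<bullet> (w' + e') - (a + f) \<bullet> (a' + f')\<bar> \<le> 5/9 * (vnorm (w + e) * vnorm (w' + e'))"
proof -
  define N where "N = vnorm w * vnorm w'"
  have N: "0 \<le> N" by (simp add: N_def)
  have prod: "x \<bullet> y \<le> c * d * N" "- (x \<bullet> y) \<le> c * d * N" if "x \<in> carrier_vec l" "y \<in> carrier_vec l" 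
    "vnorm x \<le> c * vnorm w" "vnorm y \<le> d * vnorm w'" "0 \<le> c" for x y c d l
  proof -
    have "\<bar>x \<bullet> y\<bar> \<le> vnorm x * vnorm y" by (rule abs_scalar_prod_le[OF that(1,2)])
    also have "\<dots> \<le> (c * vnorm w) * (d * vnorm w')" using that by (intro mult_mono) auto
    finally have "\<bar>x \<bullet> y\<bar> \<le> c * d * N" by (simp add: N_def ac_simps)
    then show "x \<bullet> y \<le> c * d * N" "- (x \<bullet> y) \<le> c * d * N" by (auto simp: abs_le_iff)
  qed
  have split: "(w + e) \<bullet> (w' + e') - (a + f) \<bullet> (a' + f') =
     (w \<bullet> w' - a \<bullet> a') + w \<bullet> e' + e \<bullet> w' + e \<bullet> e' - a \<bullet> f' - f \<bullet> a' - f \<bullet> f'"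
    using car by (simp add: add_scalar_prod_distrib[of _ n] scalar_prod_add_distrib[of _ n]
        add_scalar_prod_distrib[of _ k] scalar_prod_add_distrib[of _ k])
  have ab: "\<bar>(w + e) \<bullet> (w' + e') - (a + f) \<bullet> (a' + f')\<bar> \<le> (535/1000) * N"
  proof -
    have emb': "w \<bullet> w' - a \<bullet> a' \<le> 1/2 * N" "- (w \<bullet> w' - a \<bullet> a') \<le> 1/2 * N"
      using emb unfolding N_def by linarith+
    note bounds = emb' prod[of w n e' 1 "75/10000"] prod[of e n w' "75/10000" 1] prod[of e n e' "75/10000" "75/10000"]
      prod[of a k f' "1225/1000" "75/10000"] prod[of f k a' "75/10000" "1225/1000"] prod[of f k f' "75/10000" "75/10000"]
    show ?thesis
      unfolding split by (rule abs_leI) (use bounds car a e f N in simp_all)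
  qed
  have "(9925/10000) * vnorm w \<le> vnorm (w + e)" "(9925/10000) * vnorm w' \<le> vnorm (w' + e')"
    using vnorm_diff_ge(2)[of w n e] vnorm_diff_ge(2)[of w' n e'] car e by auto
  then have "((9925/10000) * vnorm w) * ((9925/10000) * vnorm w') \<le> vnorm (w + e) * vnorm (w' + e')"
    by (intro mult_mono) auto
  then have "(985/1000) * N \<le> vnorm (w + e) * vnorm (w' + e')"
    using N unfolding N_def by linarith
  then show ?thesis using ab N by linarith
qed

lemma cond_le:
  assumes X: "X \<in> carrier_mat r n" and "n \<le> r" and "1 \<le> n" and "0 < c"
    and lower: "\<And>v. v \<in> carrier_vec n \<Longrightarrow> c * vnorm v \<le> vnorm (X *\<^sub>v v)"
    and upper: "\<And>v. v \<in> carrier_vec n \<Longrightarrow> vnorm (X *\<^sub>v v) \<le> C * vnorm v"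
  obtains \<kappa> where "cond X = ereal \<kappa>" "0 \<le> \<kappa>" "\<kappa> \<le> C / c"
proof
  have min: "c \<le> sigma_min X" by (rule sigma_min_ge[OF X \<open>n \<le> r\<close> \<open>1 \<le> n\<close> lower])
  have max: "sigma_max X \<le> C" by (rule sigma_max_le[OF X \<open>n \<le> r\<close> \<open>1 \<le> n\<close> upper])
  have nn: "0 \<le> sigma_max X"
    by (rule singular_values_attained(1)[OF X \<open>n \<le> r\<close> extremal_singular_values(2)[OF X \<open>n \<le> r\<close> \<open>1 \<le> n\<close>]])
  show "cond X = ereal (sigma_max X / sigma_min X)" using min \<open>0 < c\<close> by (simp add: cond_def)
  show "0 \<le> sigma_max X / sigma_min X" using nn min \<open>0 < c\<close> by simp
  show "sigma_max X / sigma_min X \<le> C / c" using nn min max \<open>0 < c\<close> by (intro frac_le) auto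
qed

text \<open>Polarization turns the bound for the quadratic form of \<open>I - S^T S\<close> into a bound for each entry. This
  loses a factor \<open>sqrt b\<close> against the sharp estimate, which the diagonal blocks can afford.\<close>

lemma gram_defect_le:
  assumes S: "S \<in> carrier_mat k b" and "0 \<le> \<delta>"
    and near: "\<And>v. v \<in> carrier_vec b \<Longrightarrow> \<bar>(vnorm v)\<^sup>2 - (vnorm (S *\<^sub>v v))\<^sup>2\<bar> \<le> \<delta> * (vnorm v)\<^sup>2"
  shows "fro_norm (1\<^sub>m b - S\<^sup>T * S) \<le> real b * \<delta>"
proof -
  define M where "M = 1\<^sub>m b - S\<^sup>T * S"
  have M: "M \<in> carrier_mat b b" using S by (auto simp: M_def)
  have polar: "4 * (x \<bullet> y) = (vnorm (x + y))\<^sup>2 - (vnorm (x - y))\<^sup>2"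
    and parallel: "(vnorm (x + y))\<^sup>2 + (vnorm (x - y))\<^sup>2 = 2 * (vnorm x)\<^sup>2 + 2 * (vnorm y)\<^sup>2"
    if "x \<in> carrier_vec l" "y \<in> carrier_vec l" for x y l
    unfolding vnorm_sq using that comm_scalar_prod[OF that]
    by (simp_all add: add_scalar_prod_distrib[of _ l] scalar_prod_add_distrib[of _ l]
        minus_scalar_prod_distrib[of _ l] scalar_prod_minus_distrib[of _ l])
  have entry: "\<bar>M $$ (i, j)\<bar> \<le> \<delta>" if ij: "i < b" "j < b" for i j
  proof -
    define x where "x = (unit_vec b i :: real vec)"
    define y where "y = (unit_vec b j :: real vec)"
    have xy: "x \<in> carrier_vec b" "y \<in> carrier_vec b" by (auto simp: x_def y_def)
    have Sxy: "S *\<^sub>v x \<in> carrier_vec k" "S *\<^sub>v y \<in> carrier_vec k" using S xy by auto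
    have "col S i = S *\<^sub>v x" "col S j = S *\<^sub>v y"
      using S ij by (auto simp: x_def y_def intro!: eq_vecI)
    then have "M $$ (i, j) = x \<bullet> y - (S *\<^sub>v x) \<bullet> (S *\<^sub>v y)"
      using S ij by (auto simp: M_def x_def y_def)
    then have "4 * M $$ (i, j) = ((vnorm (x + y))\<^sup>2 - (vnorm (S *\<^sub>v (x + y)))\<^sup>2)
        - ((vnorm (x - y))\<^sup>2 - (vnorm (S *\<^sub>v (x - y)))\<^sup>2)"
      using polar[OF xy] polar[OF Sxy] S xy
      by (simp add: mult_add_distrib_mat_vec[of _ k b] mult_minus_distrib_mat_vec[of _ k b])
    moreover have "\<delta> * (vnorm (x + y))\<^sup>2 + \<delta> * (vnorm (x - y))\<^sup>2 = 4 * \<delta>"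
      using parallel[OF xy] ij by (simp add: x_def y_def flip: distrib_left)
    moreover have "x + y \<in> carrier_vec b" "x - y \<in> carrier_vec b" using xy by auto
    ultimately show ?thesis using near[of "x + y"] near[of "x - y"] by linarith
  qed
  have "(fro_norm M)\<^sup>2 = (\<Sum>i<b. \<Sum>j<b. (M $$ (i, j))\<^sup>2)" using M by (simp add: fro_norm_sq)
  also have "\<dots> \<le> (\<Sum>i<b. \<Sum>j<b. \<delta>\<^sup>2)"
    using entry \<open>0 \<le> \<delta>\<close> by (intro sum_mono) (auto simp flip: abs_le_square_iff)
  also have "\<dots> = (real b * \<delta>)\<^sup>2" by (simp add: power2_eq_square)
  finally show ?thesis unfolding M_def by (rule power2_le_imp_le) (simp add: \<open>0 \<le> \<delta>\<close>)
qed


section \<open>One block step\<close>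

text \<open>One step of the algorithm, in terms of the leading blocks (suffix \<open>0\<close>, with \<open>s\<close> columns in total),
  the current block (suffix \<open>b\<close>, with \<open>b\<close> columns), the block \<open>Qp\<close> of \<open>Q'\<close>, and the blocks
  \<open>R0\<close>, \<open>Rc\<close> and \<open>Rb\<close> of the triangular factor, of which \<open>Rc\<close> couples the current block to the leading ones.
  The number \<open>r\<close> stands for the square root of the total number of columns, \<open>\<sigma>\<close> for the smallest
  singular value of the whole input matrix, and \<open>\<omega>\<close> for an upper bound of its Frobenius norm. The last
  three assumptions are the induction hypothesis. The whole input matrix is seen only through the
  combinations \<open>W0 z + Wb y\<close>, which range over its values on vectors supported in the first \<open>s + b\<close>
  coordinates.\<close>

locale block_step =
  fixes n k s b :: nat and r u \<sigma> \<omega> :: real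
    and \<Theta> W0 Wb Pb Q0 Qb Qp S0 Sb R0 Rc Rb :: "real mat"
  assumes \<Theta>: "\<Theta> \<in> carrier_mat k n"
    and W0: "W0 \<in> carrier_mat n s" and Wb: "Wb \<in> carrier_mat n b" and Pb: "Pb \<in> carrier_mat k b"
    and Q0: "Q0 \<in> carrier_mat n s" and Qb: "Qb \<in> carrier_mat n b" and Qp: "Qp \<in> carrier_mat n b"
    and S0: "S0 \<in> carrier_mat k s" and Sb: "Sb \<in> carrier_mat k b"
    and R0: "R0 \<in> carrier_mat s s" and Rc: "Rc \<in> carrier_mat s b" and Rb: "Rb \<in> carrier_mat b b"
    and b: "1 \<le> b" and bk: "b \<le> k" and kn: "k \<le> n"
    and r: "1 \<le> r" and sb: "real s + real b \<le> r\<^sup>2"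
    and u: "0 < u" and \<sigma>: "0 < \<sigma>" and small: "u * r^3 * \<omega> \<le> \<sigma> / 1000"
    and Wb_le: "fro_norm Wb \<le> \<omega>"
    and W_lower: "\<And>z y. z \<in> carrier_vec s \<Longrightarrow> y \<in> carrier_vec b \<Longrightarrow>
        \<sigma> * vnorm z \<le> vnorm (W0 *\<^sub>v z + Wb *\<^sub>v y) \<and> \<sigma> * vnorm y \<le> vnorm (W0 *\<^sub>v z + Wb *\<^sub>v y)"
    and W_embed: "\<And>z y z' y'. z \<in> carrier_vec s \<Longrightarrow> y \<in> carrier_vec b \<Longrightarrow> z' \<in> carrier_vec s \<Longrightarrow> y' \<in> carrier_vec b \<Longrightarrow>
        \<bar>(W0 *\<^sub>v z + Wb *\<^sub>v y) \<bullet> (W0 *\<^sub>v z' + Wb *\<^sub>v y')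
          - (\<Theta> *\<^sub>v (W0 *\<^sub>v z + Wb *\<^sub>v y)) \<bullet> (\<Theta> *\<^sub>v (W0 *\<^sub>v z' + Wb *\<^sub>v y'))\<bar>
        \<le> 1/2 * (vnorm (W0 *\<^sub>v z + Wb *\<^sub>v y) * vnorm (W0 *\<^sub>v z' + Wb *\<^sub>v y'))"
    and Q0_embed: "(fro_norm Q0)\<^sup>2 \<le> 2 * (fro_norm (\<Theta> * Q0))\<^sup>2"
    and sketch_P: "fro_norm (Pb - \<Theta> * Wb) \<le> 1/80 * (u / r) * fro_norm Wb"
    and sketch_S0: "fro_norm (S0 - \<Theta> * Q0) \<le> 1/80 * (u / r) * fro_norm Q0"
    and sketch_Sb: "fro_norm (Sb - \<Theta> * Qb) \<le> 1/80 * (u / r) * fro_norm Qb"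
    and least_squares: "\<And>j. j < b \<Longrightarrow> \<exists>dS\<in>carrier_mat k s. \<exists>dp\<in>carrier_vec k.
        is_arg_min (\<lambda>y. vnorm ((S0 + dS) *\<^sub>v y - (col Pb j + dp))) (\<lambda>y. y \<in> carrier_vec s) (col Rc j)
        \<and> fro_norm dS \<le> 1/100 * u * spec_norm S0 \<and> vnorm dp \<le> 1/100 * u * vnorm (col Pb j)"
    and update: "fro_norm (Qp - (Wb - Q0 * Rc)) \<le> 102/100 * u * (fro_norm Wb + r\<^sup>2 * (fro_norm Q0 * fro_norm Rc))"
    and update_sketch: "fro_norm (\<Theta> * (Qp - (Wb - Q0 * Rc)))
        \<le> 102/100 * u * (1225/1000) * (fro_norm Wb + r\<^sup>2 * (fro_norm Q0 * fro_norm Rc))"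
    and qr: "fro_norm (Qp - Qb * Rb) \<le> 1/10 * u * (fro_norm Qb * fro_norm Rb)"
    and qr_sketch: "fro_norm (\<Theta> * (Qp - Qb * Rb)) \<le> 1/10 * u * (spec_norm Qb * spec_norm Rb)"
    and qr_orth: "\<And>\<eta>. \<eta> < 1 \<Longrightarrow> eps_embedding_mat \<eta> \<Theta> Qp \<Longrightarrow>
        1 - ereal (1/10 * u) * cond Qp \<le> ereal (sigma_min (\<Theta> * Qb))
        \<and> ereal (sigma_max (\<Theta> * Qb)) \<le> 1 + ereal (1/10 * u) * cond Qp
        \<and> spec_norm Qb \<le> (1 - \<eta>) powr (-1/2) * spec_norm (\<Theta> * Qb)"
    and S0_near: "fro_norm (1\<^sub>m s - S0\<^sup>T * S0) \<le> 1/50"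
    and F0: "fro_norm (Q0 * R0 - W0) \<le> 15/4 * (u * r^3) * \<omega>"
    and F0_sketch: "fro_norm (\<Theta> * (Q0 * R0 - W0)) \<le> 15/4 * (u * r^3) * \<omega>"
begin

lemma carriers [simp]:
  "\<Theta> * Wb \<in> carrier_mat k b" "\<Theta> * Q0 \<in> carrier_mat k s" "\<Theta> * Qb \<in> carrier_mat k b" "\<Theta> * Qp \<in> carrier_mat k b"
  "S0 * Rc \<in> carrier_mat k b" "Sb * Rb \<in> carrier_mat k b" "Q0 * Rc \<in> carrier_mat n b" "Qb * Rb \<in> carrier_mat n b"
  "Pb - \<Theta> * Wb \<in> carrier_mat k b" "S0 - \<Theta> * Q0 \<in> carrier_mat k s" "Sb - \<Theta> * Qb \<in> carrier_mat k b"
  "Pb - S0 * Rc \<in> carrier_mat k b" "Qp - (Wb - Q0 * Rc) \<in> carrier_mat n b" "Qp - Qb * Rb \<in> carrier_mat n b"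
  "Q0 * R0 \<in> carrier_mat n s" "Q0 * R0 - W0 \<in> carrier_mat n s"
  using \<Theta> W0 Wb Pb Q0 Qb Qp S0 Sb R0 Rc Rb by auto

abbreviation w :: real where "w \<equiv> fro_norm Wb"

abbreviation D :: "real mat" where "D \<equiv> Qp - (Wb - Q0 * Rc)"

text \<open>The embedding bounds the sketch by \<open>sqrt (3/2)\<close>, which is less than \<open>1.225\<close>.\<close>

lemma W_upper:
  assumes "z \<in> carrier_vec s" "y \<in> carrier_vec b"
  shows "vnorm (\<Theta> *\<^sub>v (W0 *\<^sub>v z + Wb *\<^sub>v y)) \<le> 1225/1000 * vnorm (W0 *\<^sub>v z + Wb *\<^sub>v y)"
proof -
  define x where "x = W0 *\<^sub>v z + Wb *\<^sub>v y"
  have "\<bar>(vnorm x)\<^sup>2 - (vnorm (\<Theta> *\<^sub>v x))\<^sup>2\<bar> \<le> 1/2 * (vnorm x)\<^sup>2"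
    using W_embed[OF assms assms] by (simp only: x_def vnorm_sq flip: power2_eq_square)
  then have "(vnorm (\<Theta> *\<^sub>v x))\<^sup>2 \<le> 3/2 * (vnorm x)\<^sup>2" by linarith
  also have "\<dots> \<le> (1225/1000 * vnorm x)\<^sup>2"
    unfolding power_mult_distrib by (intro mult_right_mono) (auto simp: power2_eq_square)
  finally show ?thesis unfolding x_def by (rule power2_le_imp_le) simp
qed

lemma w_bounds:
  shows "\<sigma> \<le> w" "0 < w" "w \<le> \<omega>" "u * r^3 * w \<le> \<sigma> / 1000" "u * r^3 \<le> 1/1000" "u \<le> u * r^3" "u * r \<le> u * r^3"
    "u \<le> u * r" "u \<le> 1/1000" "u / r \<le> u" "0 < u / r"
proof -
  have 0: "W0 *\<^sub>v 0\<^sub>v s = 0\<^sub>v n" using W0 by (intro eq_vecI) auto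
  have Wb_low: "\<sigma> * vnorm y \<le> vnorm (Wb *\<^sub>v y)" if y: "y \<in> carrier_vec b" for y
  proof -
    have "W0 *\<^sub>v 0\<^sub>v s + Wb *\<^sub>v y = Wb *\<^sub>v y" unfolding 0 using Wb y by (intro left_zero_vec) auto
    then show ?thesis using W_lower[of "0\<^sub>v s" y] y by simp
  qed
  have "\<sigma> * 1 \<le> vnorm (Wb *\<^sub>v unit_vec b 0)" using Wb_low[of "unit_vec b 0"] b by simp
  also have "\<dots> \<le> w * 1" using vnorm_mult_le_fro[OF Wb, of "unit_vec b 0"] b by simp
  finally show 1: "\<sigma> \<le> w" by simp
  then show 2: "0 < w" using \<sigma> by simp
  show 3: "w \<le> \<omega>" by (rule Wb_le)
  have t: "0 < u * r^3" using u r by simp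
  have "u * r^3 * w \<le> u * r^3 * \<omega>" using 3 t by (intro mult_left_mono) auto
  then show 4: "u * r^3 * w \<le> \<sigma> / 1000" using small by simp
  then have "u * r^3 * w \<le> 1/1000 * w" using 1 by simp
  then show 5: "u * r^3 \<le> 1/1000" using 2 by (rule mult_right_le_imp_le)
  have p: "1 \<le> r^3" "r \<le> r^3" using r power_increasing[of 1 3 r] by auto
  show 6: "u \<le> u * r^3" "u * r \<le> u * r^3" "u \<le> u * r" using u p r by (auto intro: mult_left_mono simp: mult_le_cancel_left1)
  show "u \<le> 1/1000" using 5 6 by linarith
  show "u / r \<le> u" "0 < u / r" using u r by (auto simp: field_simps)
qed

lemma s_le: "sqrt (real s) \<le> r" and b_le: "sqrt (real b) \<le> r"
  using sb r by (auto intro!: real_le_lsqrt)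

text \<open>The computed sketch \<open>S0\<close> is almost orthonormal and \<open>\<Theta>\<close> does not shrink \<open>Q0\<close> by more than \<open>sqrt 2\<close>; the
  sketching error is relative to \<open>Q0\<close> itself and is absorbed on the left-hand side.\<close>

lemma Q0_le: "fro_norm Q0 \<le> 145/100 * r"
proof -
  have S0_le: "fro_norm S0 \<le> 101/100 * r"
  proof -
    have "fro_norm S0 \<le> sqrt (real s) * (101/100)"
      by (rule fro_norm_le_sqrt_spec[OF S0 _ near_orthonormal_bounds(2)[OF S0 S0_near]]) auto
    then show ?thesis using s_le by simp
  qed
  have "\<Theta> * Q0 = S0 - (S0 - \<Theta> * Q0)" by (rule eq_matI) (use S0 \<Theta> Q0 in auto)
  then have 1: "fro_norm (\<Theta> * Q0) \<le> fro_norm S0 + fro_norm (S0 - \<Theta> * Q0)"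
    using fro_norm_diff_le[OF S0, of "S0 - \<Theta> * Q0"] S0 \<Theta> Q0 by simp
  have "1/80 * (u / r) * fro_norm Q0 \<le> 1/80000 * fro_norm Q0"
    using w_bounds by (intro mult_right_mono) auto
  then have 2: "fro_norm (\<Theta> * Q0) \<le> 101/100 * r + 1/80000 * fro_norm Q0" using 1 S0_le sketch_S0 by linarith
  have "(fro_norm Q0)\<^sup>2 \<le> (1415/1000 * fro_norm (\<Theta> * Q0))\<^sup>2"
  proof -
    have "2 * (fro_norm (\<Theta> * Q0))\<^sup>2 \<le> (1415/1000)\<^sup>2 * (fro_norm (\<Theta> * Q0))\<^sup>2"
      by (intro mult_right_mono) (auto simp: power2_eq_square)
    then show ?thesis using Q0_embed unfolding power_mult_distrib by linarith
  qed
  then have "fro_norm Q0 \<le> 1415/1000 * fro_norm (\<Theta> * Q0)" by (rule power2_le_imp_le) simp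
  then show ?thesis using 2 r by linarith
qed

lemma Pb_le: "fro_norm Pb \<le> 12251/10000 * w"
proof -
  have "\<Theta> * Wb \<in> carrier_mat k b" using \<Theta> Wb by auto
  have "fro_norm (\<Theta> * Wb) \<le> 1225/1000 * w"
  proof (rule fro_norm_le_cols)
    fix j assume j: "j < dim_col Wb"
    have 0: "W0 *\<^sub>v 0\<^sub>v s = 0\<^sub>v n" using W0 by (intro eq_vecI) auto
    have e: "unit_vec b j \<in> carrier_vec b" by simp
    have "Wb *\<^sub>v unit_vec b j = col Wb j" using Wb j by (intro eq_vecI) auto
    then have "W0 *\<^sub>v 0\<^sub>v s + Wb *\<^sub>v unit_vec b j = col Wb j" unfolding 0 using Wb j by auto
    then show "vnorm (col (\<Theta> * Wb) j) \<le> 1225/1000 * vnorm (col Wb j)"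
      using W_upper[of "0\<^sub>v s", OF _ e] j col_mult_vec[of j Wb \<Theta>] by simp
  qed auto
  moreover have "Pb = (Pb - \<Theta> * Wb) + \<Theta> * Wb" by (rule eq_matI) (use \<Theta> Pb Wb in auto)
  then have "fro_norm Pb \<le> fro_norm (Pb - \<Theta> * Wb) + fro_norm (\<Theta> * Wb)"
    using fro_norm_add_le[of "Pb - \<Theta> * Wb" k b "\<Theta> * Wb"] \<Theta> Pb Wb by simp
  moreover have "1/80 * (u / r) * w \<le> 1/80000 * w"
    using w_bounds by (intro mult_right_mono) auto
  ultimately show ?thesis using sketch_P w_bounds(2) by linarith
qed

lemma least_squares_bounds:
  shows "fro_norm Rc \<le> 127/100 * w" "fro_norm (Pb - S0 * Rc) \<le> 1226/1000 * w"
    "fro_norm (S0\<^sup>T * (Pb - S0 * Rc)) \<le> 4/100 * u * w"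
proof -
  have cols: "vnorm (col Rc j) \<le> 103/100 * vnorm (col Pb j)
     \<and> vnorm (col Pb j - S0 *\<^sub>v col Rc j) \<le> 10001/10000 * vnorm (col Pb j)
     \<and> vnorm (S0\<^sup>T *\<^sub>v (col Pb j - S0 *\<^sub>v col Rc j)) \<le> 32/1000 * u * vnorm (col Pb j)" if j: "j < b" for j
  proof -
    obtain dS dp where d: "dS \<in> carrier_mat k s" "dp \<in> carrier_vec k"
      "is_arg_min (\<lambda>y. vnorm ((S0 + dS) *\<^sub>v y - (col Pb j + dp))) (\<lambda>y. y \<in> carrier_vec s) (col Rc j)"
      "fro_norm dS \<le> 1/100 * u * spec_norm S0" "vnorm dp \<le> 1/100 * u * vnorm (col Pb j)"
      using least_squares[OF j] by blast
    have "col Pb j \<in> carrier_vec k" using Pb j by auto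
    from backward_stable_least_squares[OF S0 S0_near this d] u w_bounds(9) show ?thesis by simp
  qed
  have dc: "dim_col Pb = b" "dim_col Rc = b" "dim_col (Pb - S0 * Rc) = b" "dim_col (S0\<^sup>T * (Pb - S0 * Rc)) = b"
    using Pb Rc by auto
  have c1: "col (Pb - S0 * Rc) j = col Pb j - S0 *\<^sub>v col Rc j" if "j < b" for j
    using that Pb Rc S0 by (intro eq_vecI) auto
  have c2: "col (S0\<^sup>T * (Pb - S0 * Rc)) j = S0\<^sup>T *\<^sub>v (col Pb j - S0 *\<^sub>v col Rc j)" if "j < b" for j
    using that c1 dc col_mult_vec[of j "Pb - S0 * Rc"] by simp
  have "fro_norm Rc \<le> 103/100 * fro_norm Pb"
    by (rule fro_norm_le_cols) (use dc cols in auto)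
  then show "fro_norm Rc \<le> 127/100 * w" using Pb_le w_bounds(2) by linarith
  have "fro_norm (Pb - S0 * Rc) \<le> 10001/10000 * fro_norm Pb"
  proof (rule fro_norm_le_cols)
    fix j assume "j < dim_col Pb"
    then have j: "j < b" using dc by simp
    show "vnorm (col (Pb - S0 * Rc) j) \<le> 10001/10000 * vnorm (col Pb j)"
      unfolding c1[OF j] using cols[OF j] by blast
  qed (use dc in auto)
  then show "fro_norm (Pb - S0 * Rc) \<le> 1226/1000 * w" using Pb_le w_bounds(2) by linarith
  have "fro_norm (S0\<^sup>T * (Pb - S0 * Rc)) \<le> (32/1000 * u) * fro_norm Pb"
  proof (rule fro_norm_le_cols)
    fix j assume "j < dim_col Pb"
    then have j: "j < b" using dc by simp
    show "vnorm (col (S0\<^sup>T * (Pb - S0 * Rc)) j) \<le> (32/1000 * u) * vnorm (col Pb j)"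
      unfolding c2[OF j] using cols[OF j] by blast
  qed (use dc u in auto)
  also have "\<dots> \<le> (32/1000 * u) * (12251/10000 * w)" using u Pb_le by (intro mult_left_mono) auto
  also have "\<dots> \<le> 4/100 * u * w" using u w_bounds(2) by simp
  finally show "fro_norm (S0\<^sup>T * (Pb - S0 * Rc)) \<le> 4/100 * u * w" .
qed

lemma Q0_Rc_le: "fro_norm Q0 * fro_norm Rc \<le> 18415/10000 * (r * w)"
proof -
  have "fro_norm Q0 * fro_norm Rc \<le> (145/100 * r) * (127/100 * w)"
    using r by (intro mult_mono Q0_le least_squares_bounds) auto
  then show ?thesis by simp
qed

lemma update_bounds:
  shows "fro_norm D \<le> 29/10 * (u * r^3 * w)" "fro_norm (\<Theta> * D) \<le> 356/100 * (u * r^3 * w)"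
proof -
  have "r\<^sup>2 * (fro_norm Q0 * fro_norm Rc) \<le> r\<^sup>2 * (18415/10000 * (r * w))"
    by (intro mult_left_mono Q0_Rc_le) auto
  also have "\<dots> = 18415/10000 * (r^3 * w)" by (simp add: power2_eq_square power3_eq_cube)
  moreover have "w \<le> r^3 * w" using r w_bounds(2) by simp
  ultimately have 1: "fro_norm Wb + r\<^sup>2 * (fro_norm Q0 * fro_norm Rc) \<le> 28415/10000 * (r^3 * w)" by linarith
  have nn: "0 \<le> u * r^3 * w" using u r w_bounds(2) by simp
  have 2: "u * (fro_norm Wb + r\<^sup>2 * (fro_norm Q0 * fro_norm Rc)) \<le> 28415/10000 * (u * r^3 * w)"
    using mult_left_mono[OF 1, of u] u by simp
  show "fro_norm D \<le> 29/10 * (u * r^3 * w)" 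
    using update 2 nn by simp
  show "fro_norm (\<Theta> * D) \<le> 356/100 * (u * r^3 * w)"
    using update_sketch 2 nn by simp
qed

text \<open>Since \<open>Q0 R0\<close> is close to \<open>W0\<close>, which \<open>\<sigma>\<close> bounds below, \<open>R0\<close> is bounded below, hence invertible.\<close>

lemma R0_lower:
  assumes z: "z \<in> carrier_vec s"
  shows "\<sigma> / (2 * r) * vnorm z \<le> vnorm (R0 *\<^sub>v z)"
proof -
  have W0z: "W0 *\<^sub>v z \<in> carrier_vec n" using W0 z by auto
  have "Wb *\<^sub>v 0\<^sub>v b = 0\<^sub>v n" using Wb by (intro eq_vecI) auto
  then have 1: "\<sigma> * vnorm z \<le> vnorm (W0 *\<^sub>v z)"
    using W_lower[OF z, of "0\<^sub>v b"] W0z by simp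
  have F0z: "vnorm ((Q0 * R0 - W0) *\<^sub>v z) \<le> 15/4000 * (\<sigma> * vnorm z)"
  proof -
    have "vnorm ((Q0 * R0 - W0) *\<^sub>v z) \<le> fro_norm (Q0 * R0 - W0) * vnorm z"
      by (rule vnorm_mult_le_fro[OF carriers(16) z])
    also have "\<dots> \<le> (15/4000 * \<sigma>) * vnorm z"
      using F0 small by (intro mult_right_mono) auto
    finally show ?thesis by simp
  qed
  have "Q0 *\<^sub>v (R0 *\<^sub>v z) = W0 *\<^sub>v z + (Q0 * R0 - W0) *\<^sub>v z"
    unfolding minus_mult_distrib_mat_vec[OF carriers(15) W0 z] assoc_mult_mat_vec[OF Q0 R0 z]
    by (rule eq_vecI) (use Q0 R0 W0 z in auto)
  then have "vnorm (W0 *\<^sub>v z) - vnorm ((Q0 * R0 - W0) *\<^sub>v z) \<le> vnorm (Q0 *\<^sub>v (R0 *\<^sub>v z))"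
    using vnorm_diff_ge(2)[OF W0z, of "(Q0 * R0 - W0) *\<^sub>v z"] mult_mat_vec_carrier[OF carriers(16) z] by simp
  also have "\<dots> \<le> fro_norm Q0 * vnorm (R0 *\<^sub>v z)"
    by (rule vnorm_mult_le_fro[OF Q0]) (use R0 z in auto)
  also have "\<dots> \<le> 145/100 * r * vnorm (R0 *\<^sub>v z)" using Q0_le by (intro mult_right_mono) auto
  moreover have "0 \<le> r * vnorm (R0 *\<^sub>v z)" using r by simp
  ultimately have "\<sigma> * vnorm z \<le> 2 * (r * vnorm (R0 *\<^sub>v z))"
    using 1 F0z by simp
  then show ?thesis using r by (simp add: field_simps)
qed

text \<open>The witness \<open>z\<close> solves \<open>R0 z = - Rc y\<close>, so that \<open>Q0 R0 z\<close> cancels \<open>Q0 Rc y\<close>. The error is then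
  \<open>e = (Q0 R0 - W0) z + D y\<close>. It is measured against \<open>|z|\<close> and \<open>|y|\<close>, which \<open>W0 z + Wb y\<close> bounds through \<open>\<sigma>\<close>,
  so that a large \<open>z\<close>, caused by an ill-conditioned \<open>R0\<close>, does no harm.\<close>

lemma Qp_near_range_W:
  assumes y: "y \<in> carrier_vec b"
  obtains z e where "z \<in> carrier_vec s" "e \<in> carrier_vec n" "Qp *\<^sub>v y = (W0 *\<^sub>v z + Wb *\<^sub>v y) + e"
    "vnorm e \<le> 75/10000 * vnorm (W0 *\<^sub>v z + Wb *\<^sub>v y)"
    "vnorm (\<Theta> *\<^sub>v e) \<le> 75/10000 * vnorm (W0 *\<^sub>v z + Wb *\<^sub>v y)"
proof -
  have "0 < \<sigma> / (2 * r)" using \<sigma> r by simp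
  then obtain R' where R': "R' \<in> carrier_mat s s" "R0 * R' = 1\<^sub>m s"
    using invertible_of_lower_bound[OF R0 _ R0_lower] by blast
  define c where "c = Rc *\<^sub>v y"
  have c: "c \<in> carrier_vec s" using Rc y by (auto simp: c_def)
  define z where "z = - (R' *\<^sub>v c)"
  have z: "z \<in> carrier_vec s" using R' c by (auto simp: z_def)
  have R0z: "R0 *\<^sub>v z = - c"
  proof -
    have "R0 *\<^sub>v z = - (R0 *\<^sub>v (R' *\<^sub>v c))"
      unfolding z_def using R0 R' c by (intro eq_vecI) (auto simp: scalar_prod_uminus_right)
    also have "R0 *\<^sub>v (R' *\<^sub>v c) = c" using assoc_mult_mat_vec[OF R0 R'(1) c] R'(2) c by simp
    finally show ?thesis .
  qed
  define F where "F = Q0 * R0 - W0"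
  have F: "F \<in> carrier_mat n s" and Dc: "D \<in> carrier_mat n b" by (simp_all add: F_def)
  define e where "e = F *\<^sub>v z + D *\<^sub>v y"
  define x where "x = W0 *\<^sub>v z + Wb *\<^sub>v y"
  have Fz: "F *\<^sub>v z \<in> carrier_vec n" and Dy: "D *\<^sub>v y \<in> carrier_vec n"
    using mult_mat_vec_carrier[OF F z] mult_mat_vec_carrier[OF Dc y] by auto
  have e: "e \<in> carrier_vec n" using Fz Dy by (auto simp: e_def)
  have "F *\<^sub>v z = - (Q0 *\<^sub>v c) - W0 *\<^sub>v z"
  proof -
    have "F *\<^sub>v z = Q0 *\<^sub>v (- c) - W0 *\<^sub>v z"
      unfolding F_def minus_mult_distrib_mat_vec[OF carriers(15) W0 z] assoc_mult_mat_vec[OF Q0 R0 z] R0z ..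
    also have "Q0 *\<^sub>v (- c) = - (Q0 *\<^sub>v c)" using Q0 c by (intro eq_vecI) auto
    finally show ?thesis .
  qed
  moreover have "D *\<^sub>v y = Qp *\<^sub>v y - (Wb *\<^sub>v y - Q0 *\<^sub>v c)"
    unfolding minus_mult_distrib_mat_vec[OF Qp minus_carrier_mat[OF carriers(7)] y]
      minus_mult_distrib_mat_vec[OF Wb carriers(7) y] assoc_mult_mat_vec[OF Q0 Rc y] c_def ..
  ultimately have eq: "Qp *\<^sub>v y = x + e"
    unfolding x_def e_def by (intro eq_vecI) (use Qp Wb Q0 W0 z y c in auto)
  have low: "\<sigma> * vnorm z \<le> vnorm x" "\<sigma> * vnorm y \<le> vnorm x"
    using W_lower[OF z y] by (auto simp: x_def)
  have comb: "a * vnorm z + d * vnorm y \<le> 75/10000 * vnorm x"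
    if "a \<le> 15/4000 * \<sigma>" "d \<le> 356/100000 * \<sigma>" for a d
  proof -
    have "a * vnorm z \<le> (15/4000 * \<sigma>) * vnorm z" "d * vnorm y \<le> (356/100000 * \<sigma>) * vnorm y"
      by (rule mult_right_mono[OF _ vnorm_nonneg], fact that)+
    then show ?thesis using low vnorm_nonneg[of x] unfolding mult.assoc by linarith
  qed
  have "vnorm e \<le> fro_norm F * vnorm z + fro_norm D * vnorm y"
    unfolding e_def using vnorm_add_le[OF Fz Dy] vnorm_mult_le_fro[OF F z] vnorm_mult_le_fro[OF Dc y] by linarith
  also have "\<dots> \<le> 75/10000 * vnorm x"
    using F0 small update_bounds(1) w_bounds(4) \<sigma> by (intro comb) (auto simp: F_def)
  finally have e_le: "vnorm e \<le> 75/10000 * vnorm x" .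
  have T: "\<Theta> * F \<in> carrier_mat k s" "\<Theta> * D \<in> carrier_mat k b"
    using mult_carrier_mat[OF \<Theta> F] mult_carrier_mat[OF \<Theta> Dc] by auto
  have Te: "\<Theta> *\<^sub>v e = (\<Theta> * F) *\<^sub>v z + (\<Theta> * D) *\<^sub>v y"
    unfolding e_def mult_add_distrib_mat_vec[OF \<Theta> Fz Dy] assoc_mult_mat_vec[OF \<Theta> F z] assoc_mult_mat_vec[OF \<Theta> Dc y] ..
  have "vnorm (\<Theta> *\<^sub>v e) \<le> fro_norm (\<Theta> * F) * vnorm z + fro_norm (\<Theta> * D) * vnorm y"
    using vnorm_add_le[OF mult_mat_vec_carrier[OF T(1) z] mult_mat_vec_carrier[OF T(2) y]]
      vnorm_mult_le_fro[OF T(1) z] vnorm_mult_le_fro[OF T(2) y] unfolding Te by linarith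
  also have "\<dots> \<le> 75/10000 * vnorm x"
    using F0_sketch small update_bounds(2) w_bounds(4) by (intro comb) (auto simp: F_def)
  finally show thesis using that[OF z e] eq e_le by (simp add: x_def)
qed

lemma Qp_embedding: "eps_embedding_mat (5/9) \<Theta> Qp"
proof -
  have "\<bar>(Qp *\<^sub>v y) \<bullet> (Qp *\<^sub>v y') - (\<Theta> *\<^sub>v (Qp *\<^sub>v y)) \<bullet> (\<Theta> *\<^sub>v (Qp *\<^sub>v y'))\<bar>
      \<le> 5/9 * (vnorm (Qp *\<^sub>v y) * vnorm (Qp *\<^sub>v y'))"
    if y: "y \<in> carrier_vec b" and y': "y' \<in> carrier_vec b" for y y'
  proof -
    obtain z e where z: "z \<in> carrier_vec s" "e \<in> carrier_vec n" "Qp *\<^sub>v y = (W0 *\<^sub>v z + Wb *\<^sub>v y) + e"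
        "vnorm e \<le> 75/10000 * vnorm (W0 *\<^sub>v z + Wb *\<^sub>v y)"
        "vnorm (\<Theta> *\<^sub>v e) \<le> 75/10000 * vnorm (W0 *\<^sub>v z + Wb *\<^sub>v y)"
      by (rule Qp_near_range_W[OF y])
    obtain z' e' where z': "z' \<in> carrier_vec s" "e' \<in> carrier_vec n" "Qp *\<^sub>v y' = (W0 *\<^sub>v z' + Wb *\<^sub>v y') + e'"
        "vnorm e' \<le> 75/10000 * vnorm (W0 *\<^sub>v z' + Wb *\<^sub>v y')"
        "vnorm (\<Theta> *\<^sub>v e') \<le> 75/10000 * vnorm (W0 *\<^sub>v z' + Wb *\<^sub>v y')"
      by (rule Qp_near_range_W[OF y'])
    have x: "W0 *\<^sub>v z + Wb *\<^sub>v y \<in> carrier_vec n" "W0 *\<^sub>v z' + Wb *\<^sub>v y' \<in> carrier_vec n"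
      using W0 Wb z(1) y z'(1) y' by auto
    show ?thesis
      unfolding z(3) z'(3) mult_add_distrib_mat_vec[OF \<Theta> x(1) z(2)] mult_add_distrib_mat_vec[OF \<Theta> x(2) z'(2)]
      by (rule embedding_perturbed[OF x z(2) z'(2)
            mult_mat_vec_carrier[OF \<Theta> x(1)] mult_mat_vec_carrier[OF \<Theta> x(2)]
            mult_mat_vec_carrier[OF \<Theta> z(2)] mult_mat_vec_carrier[OF \<Theta> z'(2)]
            W_embed[OF z(1) y z'(1) y'] W_upper[OF z(1) y] W_upper[OF z'(1) y'] z(4) z'(4) z(5) z'(5)])
  qed
  then show ?thesis by (simp add: eps_embedding_mat_iff[OF Qp] mult.assoc)
qed

lemma Qp_lower:
  assumes y: "y \<in> carrier_vec b"
  shows "99/100 * \<sigma> * vnorm y \<le> vnorm (Qp *\<^sub>v y)"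
proof -
  obtain z e where z: "z \<in> carrier_vec s" "e \<in> carrier_vec n" "Qp *\<^sub>v y = (W0 *\<^sub>v z + Wb *\<^sub>v y) + e"
      "vnorm e \<le> 75/10000 * vnorm (W0 *\<^sub>v z + Wb *\<^sub>v y)"
    using Qp_near_range_W[OF y] by blast
  have "W0 *\<^sub>v z + Wb *\<^sub>v y \<in> carrier_vec n" using W0 Wb z(1) y by auto
  from vnorm_diff_ge(2)[OF this z(2)] z(4) W_lower[OF z(1) y, THEN conjunct2] show ?thesis
    unfolding z(3) mult.assoc using z(4) vnorm_nonneg[of "W0 *\<^sub>v z + Wb *\<^sub>v y"] by linarith
qed

lemma Qp_sketch_lower:
  assumes y: "y \<in> carrier_vec b"
  shows "2/3 * vnorm (Qp *\<^sub>v y) \<le> vnorm (\<Theta> *\<^sub>v (Qp *\<^sub>v y))"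
proof -
  define x where "x = Qp *\<^sub>v y"
  have "\<bar>x \<bullet> x - (\<Theta> *\<^sub>v x) \<bullet> (\<Theta> *\<^sub>v x)\<bar> \<le> 5/9 * vnorm x * vnorm x"
    using Qp_embedding y unfolding eps_embedding_mat_iff[OF Qp] x_def by blast
  then have "\<bar>(vnorm x)\<^sup>2 - (vnorm (\<Theta> *\<^sub>v x))\<^sup>2\<bar> \<le> 5/9 * (vnorm x)\<^sup>2"
    by (simp only: vnorm_sq mult.assoc flip: power2_eq_square)
  moreover have "(2/3 * vnorm x)\<^sup>2 = 4/9 * (vnorm x)\<^sup>2" by (simp add: power2_eq_square)
  ultimately have "(2/3 * vnorm x)\<^sup>2 \<le> (vnorm (\<Theta> *\<^sub>v x))\<^sup>2" by linarith
  then show ?thesis unfolding x_def by (rule power2_le_imp_le) simp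
qed

lemma Qp_le: "fro_norm Qp \<le> 285/100 * (r * w)"
proof -
  have "Qp = (Wb - Q0 * Rc) + D" by (rule eq_matI) (use Qp Wb Q0 Rc in auto)
  then have "fro_norm Qp \<le> fro_norm (Wb - Q0 * Rc) + fro_norm D"
    using fro_norm_add_le[of "Wb - Q0 * Rc" n b D] minus_carrier_mat[OF carriers(7)] by simp
  moreover have "fro_norm (Wb - Q0 * Rc) \<le> w + fro_norm (Q0 * Rc)"
    by (rule fro_norm_diff_le[OF Wb]) simp
  moreover have "fro_norm (Q0 * Rc) \<le> fro_norm Q0 * fro_norm Rc" by (rule fro_norm_mult_le[OF Q0 Rc])
  moreover have "w \<le> r * w" using r w_bounds(2) by simp
  moreover have "u * r^3 * w \<le> 1/1000 * w" using w_bounds(2,5) by (intro mult_right_mono) auto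
  ultimately show ?thesis using Q0_Rc_le update_bounds(1) w_bounds(2) by linarith
qed

text \<open>Up to a constant, the roundoff times the bound for the condition number of \<open>Qp\<close>.\<close>

definition \<rho> :: real where "\<rho> = u * r * w / \<sigma>"

lemma \<rho>_bounds: "u \<le> \<rho>" "\<rho> \<le> 1/1000" "0 < \<rho>"
proof -
  have "u * r * \<sigma> \<le> u * r * w" using u r w_bounds(1) by (intro mult_left_mono) auto
  then have "u * r \<le> \<rho>" using \<sigma> by (simp add: \<rho>_def field_simps)
  then show "u \<le> \<rho>" using w_bounds(8) by linarith
  then show "0 < \<rho>" using u by linarith
  have "u * r * w \<le> u * r^3 * w" using w_bounds(2,7) by (intro mult_right_mono) auto
  then show "\<rho> \<le> 1/1000" using w_bounds(4) \<sigma> by (simp add: \<rho>_def field_simps)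
qed

text \<open>The bounds \<open>Qp_le\<close> and \<open>Qp_lower\<close> give \<open>cond Qp \<le> (285/99) r w / \<sigma>\<close>, which turns the assumption on the
  QR factorization into explicit bounds for the singular values of \<open>\<Theta> * Qb\<close>.\<close>

lemma sketch_Qb_bounds:
  shows "\<And>v. v \<in> carrier_vec b \<Longrightarrow> (1 - 29/100 * \<rho>) * vnorm v \<le> vnorm ((\<Theta> * Qb) *\<^sub>v v)"
    and "\<And>v. v \<in> carrier_vec b \<Longrightarrow> vnorm ((\<Theta> * Qb) *\<^sub>v v) \<le> (1 + 29/100 * \<rho>) * vnorm v"
    and "spec_norm Qb \<le> 151/100"
proof -
  have bn: "b \<le> n" using bk kn by simp
  have up: "vnorm (Qp *\<^sub>v v) \<le> 285/100 * (r * w) * vnorm v" if v: "v \<in> carrier_vec b" for v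
    using vnorm_mult_le_fro[OF Qp v] mult_right_mono[OF Qp_le vnorm_nonneg[of v]] by linarith
  obtain \<kappa> where \<kappa>: "cond Qp = ereal \<kappa>" "0 \<le> \<kappa>" "\<kappa> \<le> (285/100 * (r * w)) / (99/100 * \<sigma>)"
    using cond_le[OF Qp bn b _ Qp_lower up] \<sigma> by auto
  have "u * \<kappa> \<le> u * ((285/100 * (r * w)) / (99/100 * \<sigma>))" using \<kappa>(3) u by (intro mult_left_mono) auto
  also have "\<dots> = 285/99 * \<rho>" using \<sigma> by (simp add: \<rho>_def field_simps)
  finally have uk: "1/10 * u * \<kappa> \<le> 29/100 * \<rho>" using \<rho>_bounds(3) by linarith
  from qr_orth[OF _ Qp_embedding] \<kappa>(1)
  have orth: "1 - 1/10 * u * \<kappa> \<le> sigma_min (\<Theta> * Qb)" "sigma_max (\<Theta> * Qb) \<le> 1 + 1/10 * u * \<kappa>"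
    "spec_norm Qb \<le> (1 - 5/9) powr (-1/2) * spec_norm (\<Theta> * Qb)"
    by (auto simp: one_ereal_def)
  note ext = extremal_singular_values(3,4)[OF carriers(3) bk b]
  show 1: "(1 - 29/100 * \<rho>) * vnorm v \<le> vnorm ((\<Theta> * Qb) *\<^sub>v v)" if v: "v \<in> carrier_vec b" for v
  proof -
    have "1 - 29/100 * \<rho> \<le> sigma_min (\<Theta> * Qb)" using orth(1) uk by linarith
    then show ?thesis using ext(1)[OF v] mult_right_mono[OF _ vnorm_nonneg[of v]] by (meson order_trans)
  qed
  show 2: "vnorm ((\<Theta> * Qb) *\<^sub>v v) \<le> (1 + 29/100 * \<rho>) * vnorm v" if v: "v \<in> carrier_vec b" for v
  proof -
    have "sigma_max (\<Theta> * Qb) \<le> 1 + 29/100 * \<rho>" using orth(2) uk by linarith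
    then show ?thesis using ext(2)[OF v] mult_right_mono[OF _ vnorm_nonneg[of v]] by (meson order_trans)
  qed
  have le: "spec_norm (\<Theta> * Qb) \<le> 1 + 29/100 * \<rho>"
    by (rule spec_norm_le[OF carriers(3) 2]) (use \<rho>_bounds(3) in auto)
  have p: "(1 - 5/9) powr (-1/2) = (3/2 :: real)"
  proof -
    have "(4/9 :: real) powr (-1/2) = 1 / sqrt (4/9)"
      by (simp add: powr_minus_divide powr_half_sqrt flip: minus_divide_left)
    also have "sqrt (4/9 :: real) = 2/3" by (simp add: real_sqrt_divide)
    finally show ?thesis by simp
  qed
  have "spec_norm Qb \<le> 3/2 * spec_norm (\<Theta> * Qb)" using orth(3) unfolding p .
  with le show "spec_norm Qb \<le> 151/100" using \<rho>_bounds(2) by linarith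
qed

lemma Qb_fro_le: "fro_norm Qb \<le> 151/100 * r"
proof -
  have "fro_norm Qb \<le> sqrt (real b) * (151/100)"
  proof (rule fro_norm_le_sqrt_spec[OF Qb])
    fix v :: "real vec" assume v: "v \<in> carrier_vec b"
    show "vnorm (Qb *\<^sub>v v) \<le> 151/100 * vnorm v"
      using vnorm_mult_le_spec[OF Qb v] mult_right_mono[OF sketch_Qb_bounds(3) vnorm_nonneg[of v]] by linarith
  qed simp
  then show ?thesis using b_le by simp
qed

lemma Sb_sketch_error: "fro_norm (Sb - \<Theta> * Qb) \<le> 19/1000 * u"
proof -
  have "1/80 * (u / r) * fro_norm Qb \<le> 1/80 * (u / r) * (151/100 * r)"
    using u r by (intro mult_left_mono Qb_fro_le) auto
  also have "\<dots> = 151/8000 * u" using r by simp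
  finally show ?thesis using sketch_Sb u by linarith
qed

lemma Sb_near: "fro_norm (1\<^sub>m b - Sb\<^sup>T * Sb) \<le> real b * (65/100 * \<rho>)"
proof (rule gram_defect_le[OF Sb])
  show "0 \<le> 65/100 * \<rho>" using \<rho>_bounds(3) by simp
  fix v :: "real vec" assume v: "v \<in> carrier_vec b"
  define N where "N = vnorm v"
  have car: "(\<Theta> * Qb) *\<^sub>v v \<in> carrier_vec k" "(Sb - \<Theta> * Qb) *\<^sub>v v \<in> carrier_vec k"
    using mult_mat_vec_carrier[OF carriers(3) v] mult_mat_vec_carrier[OF carriers(11) v] by auto
  have Sv: "Sb *\<^sub>v v = (\<Theta> * Qb) *\<^sub>v v + (Sb - \<Theta> * Qb) *\<^sub>v v"
    unfolding minus_mult_distrib_mat_vec[OF Sb carriers(3) v]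
    by (rule eq_vecI) (use Sb \<Theta> Qb v in auto)
  have "vnorm ((Sb - \<Theta> * Qb) *\<^sub>v v) \<le> 19/1000 * u * N"
    using vnorm_mult_le_fro[OF carriers(11) v] mult_right_mono[OF Sb_sketch_error vnorm_nonneg[of v]]
    unfolding N_def by linarith
  also have "\<dots> \<le> 19/1000 * \<rho> * N" using \<rho>_bounds(1) by (intro mult_right_mono) (auto simp: N_def)
  finally have d: "vnorm ((Sb - \<Theta> * Qb) *\<^sub>v v) \<le> 19/1000 * \<rho> * N" .
  have up: "vnorm (Sb *\<^sub>v v) \<le> (1 + 31/100 * \<rho>) * N"
  proof -
    have "vnorm (Sb *\<^sub>v v) \<le> (1 + 29/100 * \<rho>) * N + 19/1000 * \<rho> * N"
      using vnorm_add_le[OF car] d sketch_Qb_bounds(2)[OF v] unfolding Sv N_def by linarith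
    also have "\<dots> \<le> (1 + 31/100 * \<rho>) * N"
      unfolding distrib_right[symmetric] using \<rho>_bounds(3) by (intro mult_right_mono) (auto simp: N_def)
    finally show ?thesis .
  qed
  have low: "(1 - 31/100 * \<rho>) * N \<le> vnorm (Sb *\<^sub>v v)"
  proof -
    have "(1 - 31/100 * \<rho>) * N \<le> (1 - 29/100 * \<rho> - 19/1000 * \<rho>) * N"
      using \<rho>_bounds(3) by (intro mult_right_mono) (auto simp: N_def)
    also have "\<dots> = (1 - 29/100 * \<rho>) * N - 19/1000 * \<rho> * N" by (simp add: algebra_simps)
    also have "\<dots> \<le> vnorm (Sb *\<^sub>v v)"
      using vnorm_diff_ge(2)[OF car] d sketch_Qb_bounds(1)[OF v] unfolding Sv N_def by linarith
    finally show ?thesis .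
  qed
  have \<rho>2: "\<rho> * \<rho> \<le> 1/1000 * \<rho>" using \<rho>_bounds by (intro mult_right_mono) auto
  have N2: "0 \<le> N\<^sup>2" by simp
  have "(vnorm (Sb *\<^sub>v v))\<^sup>2 \<le> ((1 + 31/100 * \<rho>) * N)\<^sup>2" using up by (intro power_mono) auto
  also have "\<dots> = (1 + 62/100 * \<rho> + 961/10000 * (\<rho> * \<rho>)) * N\<^sup>2"
    by (simp add: power2_eq_square algebra_simps)
  also have "\<dots> \<le> (1 + 65/100 * \<rho>) * N\<^sup>2" using \<rho>2 \<rho>_bounds(3) by (intro mult_right_mono[OF _ N2]) linarith
  finally have 1: "(vnorm (Sb *\<^sub>v v))\<^sup>2 \<le> N\<^sup>2 + 65/100 * \<rho> * N\<^sup>2" by (simp add: algebra_simps)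
  have "N\<^sup>2 - 65/100 * \<rho> * N\<^sup>2 = (1 - 65/100 * \<rho>) * N\<^sup>2" by (simp add: algebra_simps)
  also have "\<dots> \<le> (1 - 62/100 * \<rho> + 961/10000 * (\<rho> * \<rho>)) * N\<^sup>2"
    using \<rho>_bounds(3) mult_nonneg_nonneg[of \<rho> \<rho>] by (intro mult_right_mono[OF _ N2]) linarith
  also have "\<dots> = ((1 - 31/100 * \<rho>) * N)\<^sup>2" by (simp add: power2_eq_square algebra_simps)
  also have "\<dots> \<le> (vnorm (Sb *\<^sub>v v))\<^sup>2" using low \<rho>_bounds by (intro power_mono) (auto simp: N_def)
  finally show "\<bar>(vnorm v)\<^sup>2 - (vnorm (Sb *\<^sub>v v))\<^sup>2\<bar> \<le> 65/100 * \<rho> * (vnorm v)\<^sup>2"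
    using 1 unfolding N_def by linarith
qed

lemma sketch_error_Rc: "fro_norm ((S0 - \<Theta> * Q0) * Rc) \<le> 24/1000 * u * w"
proof -
  have "fro_norm ((S0 - \<Theta> * Q0) * Rc) \<le> fro_norm (S0 - \<Theta> * Q0) * fro_norm Rc"
    by (rule fro_norm_mult_le[OF carriers(10) Rc])
  also have "\<dots> \<le> (1/80 * (u / r) * fro_norm Q0) * fro_norm Rc"
    using sketch_S0 by (intro mult_right_mono) auto
  also have "\<dots> = 1/80 * (u / r) * (fro_norm Q0 * fro_norm Rc)" by simp
  also have "\<dots> \<le> 1/80 * (u / r) * (18415/10000 * (r * w))"
    using u r by (intro mult_left_mono Q0_Rc_le) auto
  also have "\<dots> = 18415/800000 * (u * w)" using r by simp
  also have "\<dots> \<le> 24/1000 * u * w" using u w_bounds(2) by simp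
  finally show ?thesis .
qed

text \<open>Bounding \<open>\<Theta> * Qp\<close> by the norm of \<open>Qp\<close> would cost a factor \<open>r\<close>. The least-squares residual is at most
  the right-hand side \<open>Pb\<close>, and \<open>\<Theta> * Qp\<close> is this residual up to rounding errors.\<close>

lemma sketch_Qp_le: "fro_norm (\<Theta> * Qp) \<le> 123/100 * w"
proof -
  have eq: "\<Theta> * Qp = (Pb - S0 * Rc) - (Pb - \<Theta> * Wb) + (S0 - \<Theta> * Q0) * Rc + \<Theta> * D"
  proof -
    have 1: "\<Theta> * D = \<Theta> * Qp - (\<Theta> * Wb - \<Theta> * (Q0 * Rc))"
      unfolding mult_minus_distrib_mat[OF \<Theta> Qp minus_carrier_mat[OF carriers(7)]]
        mult_minus_distrib_mat[OF \<Theta> Wb carriers(7)] ..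
    have 2: "(S0 - \<Theta> * Q0) * Rc = S0 * Rc - \<Theta> * (Q0 * Rc)"
      unfolding minus_mult_distrib_mat[OF S0 carriers(2) Rc] assoc_mult_mat[OF \<Theta> Q0 Rc] ..
    show ?thesis unfolding 1 2
      by (rule eq_matI) (use \<Theta> Qp Wb Q0 Rc Pb S0 in auto)
  qed
  have c: "(S0 - \<Theta> * Q0) * Rc \<in> carrier_mat k b" "\<Theta> * D \<in> carrier_mat k b"
    using mult_carrier_mat[OF carriers(10) Rc] mult_carrier_mat[OF \<Theta> carriers(13)] by auto
  have c': "(Pb - S0 * Rc) - (Pb - \<Theta> * Wb) \<in> carrier_mat k b" by (rule minus_carrier_mat[OF carriers(9)])
  have "fro_norm (\<Theta> * Qp) \<le> fro_norm (Pb - S0 * Rc) + fro_norm (Pb - \<Theta> * Wb)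
      + fro_norm ((S0 - \<Theta> * Q0) * Rc) + fro_norm (\<Theta> * D)"
    unfolding eq
    using fro_norm_add_le[OF add_carrier_mat[OF c(1)] c(2), of "(Pb - S0 * Rc) - (Pb - \<Theta> * Wb)"]
      fro_norm_add_le[OF c' c(1)] fro_norm_diff_le[OF carriers(12,9)] by linarith
  moreover have "1/80 * (u / r) * w \<le> 1/80000 * w" "24/1000 * u * w \<le> 24/1000000 * w"
      "u * r^3 * w \<le> 1/1000 * w"
    by (rule mult_right_mono[OF _ fro_norm_nonneg], use w_bounds in linarith)+
  ultimately show ?thesis
    using sketch_P sketch_error_Rc update_bounds(2) least_squares_bounds(2) w_bounds(2) by linarith
qed

lemma qr_sketch_le: "fro_norm (\<Theta> * (Qp - Qb * Rb)) \<le> 151/1000 * u * fro_norm Rb"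
proof -
  have "1/10 * u * (spec_norm Qb * spec_norm Rb) \<le> 1/10 * u * (151/100 * fro_norm Rb)"
    using u by (intro mult_left_mono mult_mono sketch_Qb_bounds(3) spec_norm_le_fro) auto
  then show ?thesis using qr_sketch by simp
qed

lemma sketch_QbRb: "(\<Theta> * Qb) * Rb = \<Theta> * Qp - \<Theta> * (Qp - Qb * Rb)"
  unfolding mult_minus_distrib_mat[OF \<Theta> Qp carriers(8)] assoc_mult_mat[OF \<Theta> Qb Rb]
  by (rule eq_matI) (use \<Theta> Qp Qb Rb in auto)

text \<open>The bound for the QR error in \<open>qr_sketch_le\<close> is itself proportional to \<open>Rb\<close>; it is absorbed on the left.\<close>

lemma Rb_le: "fro_norm Rb \<le> 124/100 * w"
proof -
  have c: "\<Theta> * (Qp - Qb * Rb) \<in> carrier_mat k b" by (rule mult_carrier_mat[OF \<Theta> carriers(14)])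
  have "(1 - 29/100 * \<rho>) * fro_norm Rb \<le> fro_norm ((\<Theta> * Qb) * Rb)"
    using \<rho>_bounds(2) by (intro fro_norm_mult_ge_bound[OF carriers(3) Rb _ sketch_Qb_bounds(1)]) auto
  also have "\<dots> \<le> fro_norm (\<Theta> * Qp) + fro_norm (\<Theta> * (Qp - Qb * Rb))"
    unfolding sketch_QbRb by (rule fro_norm_diff_le[OF carriers(4) c])
  finally have 1: "(1 - 29/100 * \<rho>) * fro_norm Rb \<le> 123/100 * w + 151/1000 * u * fro_norm Rb"
    using sketch_Qp_le qr_sketch_le by linarith
  have "(9997/10000) * fro_norm Rb \<le> (1 - 29/100 * \<rho>) * fro_norm Rb"
    "151/1000 * u * fro_norm Rb \<le> 151/1000000 * fro_norm Rb"
    by (rule mult_right_mono[OF _ fro_norm_nonneg], use \<rho>_bounds(2) w_bounds(9) in linarith)+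
  then show ?thesis using 1 w_bounds(2) by linarith
qed

lemma block_defect_eq: "Q0 * Rc + Qb * Rb - Wb = D - (Qp - Qb * Rb)"
  by (rule eq_matI) (use Qp Wb Q0 Rc Qb Rb in auto)

text \<open>The current block of \<open>F = Q R - W\<close> is the update error minus the QR error (\<open>block_defect_eq\<close>). The former
  dominates, because of the factor \<open>r^3\<close> in its bound.\<close>

lemma block_defect_bounds:
  shows "fro_norm (Q0 * Rc + Qb * Rb - Wb) \<le> 15/4 * (u * r^3) * w"
    and "fro_norm (\<Theta> * (Q0 * Rc + Qb * Rb - Wb)) \<le> 15/4 * (u * r^3) * w"
proof -
  have up: "u * r * w \<le> u * r^3 * w" "u * w \<le> u * r^3 * w" "0 \<le> u * r^3 * w"
    using w_bounds u r by (auto intro!: mult_right_mono)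
  have "1/10 * u * (fro_norm Qb * fro_norm Rb) \<le> 1/10 * u * ((151/100 * r) * (124/100 * w))"
    using u r by (intro mult_left_mono mult_mono Qb_fro_le Rb_le) auto
  then have "fro_norm (Qp - Qb * Rb) \<le> 18724/100000 * (u * r * w)" using qr by simp
  then show "fro_norm (Q0 * Rc + Qb * Rb - Wb) \<le> 15/4 * (u * r^3) * w"
    unfolding block_defect_eq using fro_norm_diff_le[OF carriers(13,14)] update_bounds(1) up by linarith
  have "151/1000 * u * fro_norm Rb \<le> 151/1000 * u * (124/100 * w)"
    using u by (intro mult_left_mono Rb_le) auto
  then have "fro_norm (\<Theta> * (Qp - Qb * Rb)) \<le> 18724/100000 * (u * w)" using qr_sketch_le by simp
  then show "fro_norm (\<Theta> * (Q0 * Rc + Qb * Rb - Wb)) \<le> 15/4 * (u * r^3) * w"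
    unfolding block_defect_eq mult_minus_distrib_mat[OF \<Theta> carriers(13,14)]
    using fro_norm_diff_le[OF mult_carrier_mat[OF \<Theta> carriers(13)] mult_carrier_mat[OF \<Theta> carriers(14)]]
      update_bounds(2) up by linarith
qed

text \<open>Sketching \<open>Wb + F = Q0 Rc + Qb Rb\<close> expresses the residual through \<open>\<Theta> F\<close> and the three sketching errors.\<close>

lemma sketch_residual_le: "fro_norm (Pb - (S0 * Rc + Sb * Rb)) \<le> 39/10 * (u * r^3) * w"
proof -
  define F where "F = Q0 * Rc + Qb * Rb - Wb"
  have F: "F \<in> carrier_mat n b" unfolding F_def using Wb by auto
  have eq: "Pb - (S0 * Rc + Sb * Rb) = ((Pb - \<Theta> * Wb) - \<Theta> * F) - ((S0 - \<Theta> * Q0) * Rc + (Sb - \<Theta> * Qb) * Rb)"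
  proof -
    have 1: "\<Theta> * F = \<Theta> * (Q0 * Rc) + \<Theta> * (Qb * Rb) - \<Theta> * Wb"
      unfolding F_def mult_minus_distrib_mat[OF \<Theta> add_carrier_mat[OF carriers(8)] Wb]
        mult_add_distrib_mat[OF \<Theta> carriers(7,8)] ..
    have 2: "(S0 - \<Theta> * Q0) * Rc = S0 * Rc - \<Theta> * (Q0 * Rc)"
      unfolding minus_mult_distrib_mat[OF S0 carriers(2) Rc] assoc_mult_mat[OF \<Theta> Q0 Rc] ..
    have 3: "(Sb - \<Theta> * Qb) * Rb = Sb * Rb - \<Theta> * (Qb * Rb)"
      unfolding minus_mult_distrib_mat[OF Sb carriers(3) Rb] assoc_mult_mat[OF \<Theta> Qb Rb] ..
    show ?thesis unfolding 1 2 3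
      by (rule eq_matI) (use \<Theta> Wb Q0 Rc Pb S0 Qb Rb Sb in auto)
  qed
  have c: "\<Theta> * F \<in> carrier_mat k b" "(S0 - \<Theta> * Q0) * Rc \<in> carrier_mat k b" "(Sb - \<Theta> * Qb) * Rb \<in> carrier_mat k b"
    using mult_carrier_mat[OF \<Theta> F] mult_carrier_mat[OF carriers(10) Rc] mult_carrier_mat[OF carriers(11) Rb] by auto
  have "fro_norm ((Sb - \<Theta> * Qb) * Rb) \<le> fro_norm (Sb - \<Theta> * Qb) * fro_norm Rb"
    by (rule fro_norm_mult_le[OF carriers(11) Rb])
  also have "\<dots> \<le> (19/1000 * u) * (124/100 * w)"
    using u by (intro mult_mono Sb_sketch_error Rb_le) auto
  finally have 4: "fro_norm ((Sb - \<Theta> * Qb) * Rb) \<le> 2356/100000 * (u * w)" by simp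
  have "fro_norm (Pb - (S0 * Rc + Sb * Rb)) \<le> fro_norm (Pb - \<Theta> * Wb) + fro_norm (\<Theta> * F)
      + (fro_norm ((S0 - \<Theta> * Q0) * Rc) + fro_norm ((Sb - \<Theta> * Qb) * Rb))"
    unfolding eq
    using fro_norm_diff_le[OF minus_carrier_mat[OF c(1)] add_carrier_mat[OF c(3)],
          of "Pb - \<Theta> * Wb" "(S0 - \<Theta> * Q0) * Rc"]
      fro_norm_diff_le[OF carriers(9) c(1)] fro_norm_add_le[OF c(2,3)] by linarith
  moreover have "1/80 * (u / r) * w \<le> 1/80 * u * w" "u * w \<le> u * r^3 * w"
    by (rule mult_right_mono[OF _ fro_norm_nonneg], use w_bounds in linarith)+
  moreover have "0 \<le> u * w" using u by simp
  ultimately show ?thesis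
    using sketch_P sketch_error_Rc 4 block_defect_bounds(2) unfolding F_def by linarith
qed

text \<open>A vector \<open>Rb y\<close> is almost as long as \<open>\<Theta> Qb Rb y\<close>, hence as \<open>\<Theta> Qp y\<close>, and the sketch shrinks
  \<open>Qp y\<close>, of length at least \<open>99/100 \<sigma> |y|\<close>, by at most the factor 2/3.\<close>

lemma Rb_lower:
  assumes y: "y \<in> carrier_vec b"
  shows "65/100 * \<sigma> * vnorm y \<le> vnorm (Rb *\<^sub>v y)"
proof -
  define N where "N = vnorm y"
  define E where "E = \<Theta> * (Qp - Qb * Rb)"
  have E: "E \<in> carrier_mat k b" unfolding E_def by (rule mult_carrier_mat[OF \<Theta> carriers(14)])
  have Ry: "Rb *\<^sub>v y \<in> carrier_vec b" using Rb y by auto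
  have "u * r^3 * w \<le> \<sigma> / 1000" by (rule w_bounds(4))
  moreover have "u * w \<le> u * r^3 * w" using w_bounds by (intro mult_right_mono) auto
  moreover have "151/1000 * u * fro_norm Rb \<le> 151/1000 * u * (124/100 * w)"
    using u by (intro mult_left_mono Rb_le) auto
  ultimately have "fro_norm E \<le> 1/1000 * \<sigma>" using qr_sketch_le \<sigma> by (simp add: E_def)
  then have Ey: "vnorm (E *\<^sub>v y) \<le> 1/1000 * \<sigma> * N"
    using vnorm_mult_le_fro[OF E y] mult_right_mono[OF _ vnorm_nonneg[of y]] unfolding N_def by (meson order_trans)
  have Qpy: "(\<Theta> * Qp) *\<^sub>v y \<in> carrier_vec k" by (rule mult_mat_vec_carrier[OF carriers(4) y])
  have N: "0 \<le> \<sigma> * N" using \<sigma> by (simp add: N_def)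
  have "66/100 * (\<sigma> * N) \<le> vnorm ((\<Theta> * Qp) *\<^sub>v y)"
    using Qp_sketch_lower[OF y] Qp_lower[OF y] assoc_mult_mat_vec[OF \<Theta> Qp y] by (simp add: N_def)
  then have "66/100 * (\<sigma> * N) - 1/1000 * (\<sigma> * N) \<le> vnorm ((\<Theta> * Qp) *\<^sub>v y - E *\<^sub>v y)"
    using vnorm_diff_ge(1)[OF Qpy mult_mat_vec_carrier[OF E y]] Ey by linarith
  also have "(\<Theta> * Qp) *\<^sub>v y - E *\<^sub>v y = (\<Theta> * Qb) *\<^sub>v (Rb *\<^sub>v y)"
    unfolding assoc_mult_mat_vec[OF carriers(3) Rb y, symmetric] sketch_QbRb E_def
    using minus_mult_distrib_mat_vec[OF carriers(4) E y] by (simp add: E_def)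
  also have "vnorm \<dots> \<le> (1 + 29/100 * \<rho>) * vnorm (Rb *\<^sub>v y)" by (rule sketch_Qb_bounds(2)[OF Ry])
  also have "\<dots> \<le> 1001/1000 * vnorm (Rb *\<^sub>v y)"
    using \<rho>_bounds(2) by (intro mult_right_mono) auto
  finally have "659/1000 * (\<sigma> * N) \<le> 1001/1000 * vnorm (Rb *\<^sub>v y)" by simp
  then show ?thesis using N unfolding N_def by linarith
qed

text \<open>Apply \<open>S0^T\<close> to \<open>Sb Rb = (Pb - S0 Rc) - (Pb - S0 Rc - Sb Rb)\<close>: the first term is of order \<open>u\<close> by the
  perturbed normal equations, the second is the residual of \<open>sketch_residual_le\<close>. Dividing by \<open>Rb\<close>
  produces \<open>1 / \<sigma>\<close>.\<close>

lemma cross_gram_le: "fro_norm (S0\<^sup>T * Sb) \<le> 66/10 * (u * r^3 / \<sigma>) * w"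
proof -
  define E where "E = Pb - (S0 * Rc + Sb * Rb)"
  have E: "E \<in> carrier_mat k b" unfolding E_def by (rule minus_carrier_mat[OF add_carrier_mat[OF carriers(6)]])
  have S0T: "S0\<^sup>T \<in> carrier_mat s k" using S0 by simp
  have S0TSb: "S0\<^sup>T * Sb \<in> carrier_mat s b" by (rule mult_carrier_mat[OF S0T Sb])
  have "Sb * Rb = (Pb - S0 * Rc) - E"
    unfolding E_def by (rule eq_matI) (use Rc Pb S0 Rb Sb in auto)
  then have "(S0\<^sup>T * Sb) * Rb = S0\<^sup>T * (Pb - S0 * Rc) - S0\<^sup>T * E"
    using mult_minus_distrib_mat[OF S0T carriers(12) E] assoc_mult_mat[OF S0T Sb Rb] by simp
  then have "fro_norm ((S0\<^sup>T * Sb) * Rb) \<le> fro_norm (S0\<^sup>T * (Pb - S0 * Rc)) + fro_norm (S0\<^sup>T * E)"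
    using fro_norm_diff_le[OF mult_carrier_mat[OF S0T carriers(12)] mult_carrier_mat[OF S0T E]] by simp
  also have "fro_norm (S0\<^sup>T * E) \<le> 101/100 * fro_norm E"
  proof (rule fro_norm_mult_le_bound[OF S0T E])
    fix v :: "real vec" assume "v \<in> carrier_vec k"
    then show "vnorm (S0\<^sup>T *\<^sub>v v) \<le> 101/100 * vnorm v"
      by (intro transpose_bound[OF S0 _ near_orthonormal_bounds(2)[OF S0 S0_near]]) auto
  qed simp
  finally have "fro_norm ((S0\<^sup>T * Sb) * Rb) \<le> 4/100 * u * w + 101/100 * (39/10 * (u * r^3) * w)"
    using least_squares_bounds(3) sketch_residual_le unfolding E_def by linarith
  moreover have "u * w \<le> u * r^3 * w" "0 \<le> u * w" using w_bounds u by (auto intro!: mult_right_mono)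
  moreover have "65/100 * \<sigma> * fro_norm (S0\<^sup>T * Sb) \<le> fro_norm ((S0\<^sup>T * Sb) * Rb)"
    using \<sigma> by (intro fro_norm_mult_right_ge[OF S0TSb Rb _ Rb_lower]) auto
  ultimately have "\<sigma> * fro_norm (S0\<^sup>T * Sb) \<le> 66/10 * (u * r^3 * w)" by simp
  then show ?thesis using \<sigma> by (simp add: field_simps)
qed

end


section \<open>Blocks of a matrix\<close>

text \<open>The submatrix of \<open>r\<close> rows from row \<open>a\<close> on and \<open>d\<close> columns from column \<open>c\<close> on. Offset and length, rather
  than first and last index, avoid the truncated subtractions of block numbers that start from 1.\<close>

definition window :: "'a mat \<Rightarrow> nat \<Rightarrow> nat \<Rightarrow> nat \<Rightarrow> nat \<Rightarrow> 'a mat" where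
  "window X a r c d = mat r d (\<lambda>(i, j). X $$ (a + i, c + j))"

lemma window_carrier [simp]: "window X a r c d \<in> carrier_mat r d"
  by (simp add: window_def)

lemma window_dim [simp]: "dim_row (window X a r c d) = r" "dim_col (window X a r c d) = d"
  by (simp_all add: window_def)

lemma window_index [simp]: "i < r \<Longrightarrow> j < d \<Longrightarrow> window X a r c d $$ (i, j) = X $$ (a + i, c + j)"
  by (simp add: window_def)

lemma window_full: "X \<in> carrier_mat r c \<Longrightarrow> window X 0 r 0 c = X"
  by (intro eq_matI) auto

lemma col_blocks_window:
  "col_blocks mp X 1 q = window X 0 (dim_row X) 0 (q * mp)"
  "col_block mp X (Suc q) = window X 0 (dim_row X) (q * mp) mp"
  by (auto simp: col_blocks_def window_def)

lemma sub_blocks_window: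
  "sub_blocks mp X 1 q (Suc q) (Suc q) = window X 0 (q * mp) (q * mp) mp"
  "sub_blocks mp X (Suc q) (Suc q) (Suc q) (Suc q) = window X (q * mp) mp (q * mp) mp"
  by (auto simp: sub_blocks_def window_def)

lemma sum_lessThan_add: "(\<Sum>i<s + b. f i) = (\<Sum>i<s. f i) + (\<Sum>i<b. f (s + i :: nat) :: 'a :: comm_monoid_add)"
  by (induction b) (auto simp: add.assoc)

lemma fro_norm_sq_window_add:
  "(fro_norm (window X 0 r 0 (s + b)))\<^sup>2 = (fro_norm (window X 0 r 0 s))\<^sup>2 + (fro_norm (window X 0 r s b))\<^sup>2"
  by (simp add: fro_norm_sq sum_lessThan_add sum.distrib)

lemma window_mult_left:
  assumes "A \<in> carrier_mat a r" "X \<in> carrier_mat r c" "s + b \<le> c"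
  shows "window (A * X) 0 a s b = A * window X 0 r s b"
proof (rule eq_matI)
  fix i j assume "i < dim_row (A * window X 0 r s b)" "j < dim_col (A * window X 0 r s b)"
  then show "window (A * X) 0 a s b $$ (i, j) = (A * window X 0 r s b) $$ (i, j)"
    using assms by (simp add: scalar_prod_def)
qed (use assms in auto)

lemma window_minus:
  assumes "X \<in> carrier_mat r c" "Y \<in> carrier_mat r c" "s + b \<le> c"
  shows "window (X - Y) 0 r s b = window X 0 r s b - window Y 0 r s b"
  using assms by (intro eq_matI) auto

lemma mult_upper_triangular_index:
  fixes R :: "'a :: comm_ring_1 mat"
  assumes "X \<in> carrier_mat a m" "R \<in> carrier_mat m m" "upper_triangular R" "i < a" "j < c" "c \<le> m"
  shows "(X * R) $$ (i, j) = (\<Sum>l<c. X $$ (i, l) * R $$ (l, j))"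
proof -
  have "(X * R) $$ (i, j) = (\<Sum>l\<in>{0..<m}. X $$ (i, l) * R $$ (l, j))"
    using assms by (simp add: scalar_prod_def)
  also have "\<dots> = (\<Sum>l<c. X $$ (i, l) * R $$ (l, j))"
    using assms by (intro sum.mono_neutral_right) (auto simp: upper_triangular_def)
  finally show ?thesis .
qed

lemma window_mult_upper_triangular:
  fixes R :: "'a :: comm_ring_1 mat"
  assumes "X \<in> carrier_mat a m" "R \<in> carrier_mat m m" "upper_triangular R" "s + b \<le> m"
  shows "window (X * R) 0 a 0 s = window X 0 a 0 s * window R 0 s 0 s"
    and "window (X * R) 0 a s b = window X 0 a 0 s * window R 0 s s b + window X 0 a s b * window R s b s b"
proof -
  show "window (X * R) 0 a 0 s = window X 0 a 0 s * window R 0 s 0 s"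
    by (rule eq_matI) (use assms mult_upper_triangular_index[OF assms(1-3), of _ _ s] in
        \<open>auto simp: scalar_prod_def lessThan_atLeast0 simp del: index_mult_mat(1)\<close>,
        simp add: scalar_prod_def)
  show "window (X * R) 0 a s b = window X 0 a 0 s * window R 0 s s b + window X 0 a s b * window R s b s b"
  proof (rule eq_matI)
    fix i j assume "i < dim_row (window X 0 a 0 s * window R 0 s s b + window X 0 a s b * window R s b s b)"
      "j < dim_col (window X 0 a 0 s * window R 0 s s b + window X 0 a s b * window R s b s b)"
    then have ij: "i < a" "j < b" by auto
    have "window (X * R) 0 a s b $$ (i, j) = (X * R) $$ (i, s + j)" using ij by simp
    also have "\<dots> = (\<Sum>l<s + b. X $$ (i, l) * R $$ (l, s + j))"
      using ij assms by (intro mult_upper_triangular_index) auto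
    also have "\<dots> = (\<Sum>l<s. X $$ (i, l) * R $$ (l, s + j)) + (\<Sum>l<b. X $$ (i, s + l) * R $$ (s + l, s + j))"
      by (rule sum_lessThan_add)
    finally show "window (X * R) 0 a s b $$ (i, j) =
        (window X 0 a 0 s * window R 0 s s b + window X 0 a s b * window R s b s b) $$ (i, j)"
      using ij by (simp add: scalar_prod_def lessThan_atLeast0)
  qed auto
qed

text \<open>The vector \<open>v\<close> is \<open>z\<close> followed by \<open>y\<close> and padded with zeros.\<close>

lemma window_combination:
  assumes X: "X \<in> carrier_mat r m" and sb: "s + b \<le> m" and z: "z \<in> carrier_vec s" and y: "y \<in> carrier_vec b"
  obtains v where "v \<in> carrier_vec m" "window X 0 r 0 s *\<^sub>v z + window X 0 r s b *\<^sub>v y = X *\<^sub>v v"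
    "vnorm z \<le> vnorm v" "vnorm y \<le> vnorm v"
proof
  define t where "t = m - (s + b)"
  have m: "m = s + b + t" using sb by (simp add: t_def)
  define v where "v = vec m (\<lambda>i. if i < s then z $ i else if i < s + b then y $ (i - s) else 0)"
  show "v \<in> carrier_vec m" by (simp add: v_def)
  show "window X 0 r 0 s *\<^sub>v z + window X 0 r s b *\<^sub>v y = X *\<^sub>v v"
  proof (rule eq_vecI)
    fix i assume "i < dim_vec (X *\<^sub>v v)"
    then have i: "i < r" using X by simp
    have "(X *\<^sub>v v) $ i = (\<Sum>l<s + b + t. X $$ (i, l) * v $ l)"
      using X i m by (simp add: scalar_prod_def v_def lessThan_atLeast0)
    also have "\<dots> = (\<Sum>l<s. X $$ (i, l) * z $ l) + (\<Sum>l<b. X $$ (i, s + l) * y $ l)"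
      by (simp add: sum_lessThan_add v_def m)
    finally show "(window X 0 r 0 s *\<^sub>v z + window X 0 r s b *\<^sub>v y) $ i = (X *\<^sub>v v) $ i"
      using i z y by (simp add: scalar_prod_def lessThan_atLeast0)
  qed (use X in auto)
  have "(vnorm v)\<^sup>2 = (\<Sum>l<s + b + t. v $ l * v $ l)"
    by (simp add: vnorm_sq scalar_prod_def lessThan_atLeast0 m v_def)
  also have "\<dots> = (\<Sum>l<s. z $ l * z $ l) + (\<Sum>l<b. y $ l * y $ l)"
    by (simp add: sum_lessThan_add v_def m)
  also have "\<dots> = (vnorm z)\<^sup>2 + (vnorm y)\<^sup>2"
    using z y by (simp add: vnorm_sq scalar_prod_def lessThan_atLeast0)
  finally have "(vnorm v)\<^sup>2 = (vnorm z)\<^sup>2 + (vnorm y)\<^sup>2" .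
  then show "vnorm z \<le> vnorm v" "vnorm y \<le> vnorm v"
    by (auto intro!: power2_le_imp_le[of "vnorm z"] power2_le_imp_le[of "vnorm y"])
qed

lemma gram_defect_window_add:
  assumes S: "S \<in> carrier_mat k m" and "s + b \<le> m"
  shows "(fro_norm (1\<^sub>m (s + b) - (window S 0 k 0 (s + b))\<^sup>T * window S 0 k 0 (s + b)))\<^sup>2
    = (fro_norm (1\<^sub>m s - (window S 0 k 0 s)\<^sup>T * window S 0 k 0 s))\<^sup>2
      + 2 * (fro_norm ((window S 0 k 0 s)\<^sup>T * window S 0 k s b))\<^sup>2
      + (fro_norm (1\<^sub>m b - (window S 0 k s b)\<^sup>T * window S 0 k s b))\<^sup>2"
proof -
  define h where "h = (\<lambda>i j. \<Sum>l\<in>{0..<k}. S $$ (l, i) * S $$ (l, j))"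
  define g where "g = (\<lambda>i j. (if i = j then 1 else 0) - h i j)"
  have sym: "h i j = h j i" for i j by (simp add: h_def mult.commute)
  have 1: "(fro_norm (1\<^sub>m t - (window S 0 k c t)\<^sup>T * window S 0 k c t))\<^sup>2 = (\<Sum>i<t. \<Sum>j<t. (g (c + i) (c + j))\<^sup>2)" for c t
    by (simp add: fro_norm_sq g_def h_def scalar_prod_def)
  have 2: "(fro_norm ((window S 0 k 0 s)\<^sup>T * window S 0 k s b))\<^sup>2 = (\<Sum>i<s. \<Sum>j<b. (g i (s + j))\<^sup>2)"
    by (simp add: fro_norm_sq g_def h_def scalar_prod_def)
  have 3: "(\<Sum>i<b. \<Sum>j<s. (g (s + i) j)\<^sup>2) = (\<Sum>i<s. \<Sum>j<b. (g i (s + j))\<^sup>2)"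
    by (subst sum.swap) (simp add: g_def sym)
  show ?thesis unfolding 1 2 by (simp add: sum_lessThan_add sum.distrib 3)
qed

lemma sketch_embedding_lower:
  assumes X: "X \<in> carrier_mat n m" and \<Theta>: "\<Theta> \<in> carrier_mat k n" and "s \<le> t" "t \<le> m"
    and emb: "eps_embedding_mat \<epsilon> \<Theta> (window X 0 n 0 t)" and "\<epsilon> \<le> 1/2"
  shows "(fro_norm (window X 0 n 0 s))\<^sup>2 \<le> 2 * (fro_norm (\<Theta> * window X 0 n 0 s))\<^sup>2"
proof -
  have "(vnorm (col (window X 0 n 0 s) j))\<^sup>2 \<le> 2 * (vnorm (\<Theta> *\<^sub>v col (window X 0 n 0 s) j))\<^sup>2" if j: "j < s" for j
  proof -
    define x where "x = col (window X 0 n 0 s) j"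
    have "x = window X 0 n 0 t *\<^sub>v unit_vec t j"
      unfolding x_def using j \<open>s \<le> t\<close> by (intro eq_vecI) auto
    then have "\<bar>x \<bullet> x - (\<Theta> *\<^sub>v x) \<bullet> (\<Theta> *\<^sub>v x)\<bar> \<le> \<epsilon> * vnorm x * vnorm x"
      using emb unfolding eps_embedding_mat_iff[OF window_carrier] by simp
    then have "\<bar>(vnorm x)\<^sup>2 - (vnorm (\<Theta> *\<^sub>v x))\<^sup>2\<bar> \<le> \<epsilon> * (vnorm x)\<^sup>2"
      by (simp only: vnorm_sq mult.assoc flip: power2_eq_square)
    also have "\<dots> \<le> 1/2 * (vnorm x)\<^sup>2" using \<open>\<epsilon> \<le> 1/2\<close> by (intro mult_right_mono) auto
    finally show ?thesis unfolding x_def by linarith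
  qed
  then have "(\<Sum>j<s. (vnorm (col (window X 0 n 0 s) j))\<^sup>2) \<le> (\<Sum>j<s. 2 * (vnorm (\<Theta> *\<^sub>v col (window X 0 n 0 s) j))\<^sup>2)"
    by (intro sum_mono) auto
  then show ?thesis
    by (simp add: fro_norm_sq_cols col_mult_vec sum_distrib_left del: col_mult2)
qed


section \<open>The whole run\<close>

lemma fro_norm_window_mono:
  assumes X: "X \<in> carrier_mat r c" and "s + b \<le> c"
  shows "fro_norm (window X 0 r s b) \<le> fro_norm X"
proof -
  have "c = (s + b) + (c - (s + b))" using assms by simp
  then have "(fro_norm X)\<^sup>2 = (fro_norm (window X 0 r 0 ((s + b) + (c - (s + b)))))\<^sup>2"
    using window_full[OF X] by simp
  also have "\<dots> = (fro_norm (window X 0 r 0 s))\<^sup>2 + (fro_norm (window X 0 r s b))\<^sup>2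
      + (fro_norm (window X 0 r (s + b) (c - (s + b))))\<^sup>2"
    by (simp only: fro_norm_sq_window_add)
  finally have "(fro_norm (window X 0 r s b))\<^sup>2 \<le> (fro_norm X)\<^sup>2" by simp
  then show ?thesis by (rule power2_le_imp_le) simp
qed

text \<open>An entrywise bound restricts to every column block, so the sketching error of a block is relative to
  the norm of that block alone.\<close>

lemma sketch_computed_window:
  assumes sk: "sketch_computed f \<Theta> X Y" and \<Theta>: "\<Theta> \<in> carrier_mat k n"
    and X: "X \<in> carrier_mat n m" and Y: "Y \<in> carrier_mat k m" and sb: "s + b \<le> m" and f: "0 \<le> f"
  shows "fro_norm (window Y 0 k s b - \<Theta> * window X 0 n s b)
    \<le> (102/100 * real n * f * fro_norm \<Theta>) * fro_norm (window X 0 n s b)"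
proof -
  define c where "c = 1.02 * real (dim_col \<Theta>) * f"
  have le: "mat_abs (Y - \<Theta> * X) \<le> c \<cdot>\<^sub>m (mat_abs \<Theta> * mat_abs X)"
    using sk by (simp add: sketch_computed_def c_def)
  have "mat_abs (window Y 0 k s b - \<Theta> * window X 0 n s b) \<le> c \<cdot>\<^sub>m (mat_abs \<Theta> * mat_abs (window X 0 n s b))"
    unfolding less_eq_mat_def
  proof (intro conjI allI impI)
    fix i j assume "i < dim_row (c \<cdot>\<^sub>m (mat_abs \<Theta> * mat_abs (window X 0 n s b)))"
      and "j < dim_col (c \<cdot>\<^sub>m (mat_abs \<Theta> * mat_abs (window X 0 n s b)))"
    then have ij: "i < k" "j < b" "s + j < m" using \<Theta> sb by auto
    have "mat_abs (Y - \<Theta> * X) $$ (i, s + j) \<le> (c \<cdot>\<^sub>m (mat_abs \<Theta> * mat_abs X)) $$ (i, s + j)"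
      using le ij \<Theta> X unfolding less_eq_mat_def by auto
    then show "mat_abs (window Y 0 k s b - \<Theta> * window X 0 n s b) $$ (i, j)
        \<le> (c \<cdot>\<^sub>m (mat_abs \<Theta> * mat_abs (window X 0 n s b))) $$ (i, j)"
      using ij \<Theta> X Y by (simp add: scalar_prod_def)
  qed (use \<Theta> in auto)
  then have "fro_norm (window Y 0 k s b - \<Theta> * window X 0 n s b)
      \<le> fro_norm (c \<cdot>\<^sub>m (mat_abs \<Theta> * mat_abs (window X 0 n s b)))"
    by (rule fro_norm_abs_mono)
  also have "\<dots> = c * fro_norm (mat_abs \<Theta> * mat_abs (window X 0 n s b))"
    using f by (simp add: c_def)
  also have "\<dots> \<le> c * (fro_norm \<Theta> * fro_norm (window X 0 n s b))"
  proof (rule mult_left_mono)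
    show "fro_norm (mat_abs \<Theta> * mat_abs (window X 0 n s b)) \<le> fro_norm \<Theta> * fro_norm (window X 0 n s b)"
      using fro_norm_mult_le[of "mat_abs \<Theta>" k n "mat_abs (window X 0 n s b)" b] \<Theta> by simp
  qed (use f in \<open>simp add: c_def\<close>)
  also have "\<dots> = (102/100 * real n * f * fro_norm \<Theta>) * fro_norm (window X 0 n s b)"
    using \<Theta> by (simp add: c_def)
  finally show ?thesis .
qed

locale rbgs_run =
  fixes n k m mp p :: nat
    and \<epsilon> \<epsilon>0 ucrs ufine :: real
    and \<Theta> W P Q Q' S R :: "real mat"
  assumes m: "m = mp * p" and mp: "1 \<le> mp" and p: "1 \<le> p" and mk: "m \<le> k" and kn: "k \<le> n"
    and \<Theta>: "\<Theta> \<in> carrier_mat k n" and W: "W \<in> carrier_mat n m" and P: "P \<in> carrier_mat k m"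
    and Q: "Q \<in> carrier_mat n m" and Q': "Q' \<in> carrier_mat n m" and S: "S \<in> carrier_mat k m"
    and R: "R \<in> carrier_mat m m" and R_upper: "upper_triangular R"
    and ufine: "0 < ufine" "ufine \<le> ucrs"
    and sketch_P: "sketch_computed ufine \<Theta> W P" and sketch_S: "sketch_computed ufine \<Theta> Q S"
    and solver: "\<forall>i\<in>{1..p}. ls_backward_stable mp ucrs P S R i"
    and \<epsilon>0: "\<epsilon>0 \<le> 1/2" and \<Theta>_norm: "sketch_norm_bound \<epsilon>0 \<Theta>"
    and update: "\<forall>i\<in>{1..p}. update_stable mp \<epsilon>0 ucrs \<Theta> W Q Q' R i"
    and qr: "\<forall>i\<in>{1..p}. qr_backward_stable mp ucrs ufine \<Theta> Q Q' R i"
    and qr_orth: "\<forall>i\<in>{1..p}. qr_sketch_orthonormal mp ucrs \<Theta> Q Q' i"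
    and \<epsilon>: "\<epsilon> \<le> 1/2"
    and embed_Q: "eps_embedding_mat \<epsilon> \<Theta> (col_blocks mp Q 1 (p - 1))"
    and embed_W: "eps_embedding_mat \<epsilon> \<Theta> W"
    and ucrs_small: "ereal ucrs \<le> ereal (1 / 10 ^ 3) * inverse (cond W) * ereal (1 / (real m)\<^sup>2)"
    and ufine_small: "ufine \<le> 1 / 10 ^ 2 * real m powr (-1/2) * real n powr (-3/2) * ucrs"
begin

definition r :: real where "r = sqrt (real m)"
definition \<sigma> :: real where "\<sigma> = sigma_min W"
definition \<omega> :: real where "\<omega> = r * sigma_max W"

lemma m_pos: "1 \<le> m" using m mp p by simp

lemma r_bounds: "1 \<le> r" "r\<^sup>2 = real m" "r * r = real m"
  using m_pos by (auto simp: r_def)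

lemma u_pos: "0 < ucrs" using ufine by simp

lemma mn: "m \<le> n" using mk kn by simp

lemmas W_singular = extremal_singular_values[OF W mn m_pos]

text \<open>A singular \<open>W\<close> has infinite condition number, which would force the roundoff to be nonpositive. In
  terms of \<open>r\<close>, \<open>\<sigma>\<close> and \<open>\<omega>\<close>, the smallness assumption on the roundoff is the last claim.\<close>

lemma \<sigma>_pos: "0 < \<sigma>" and cond_W: "cond W = ereal (sigma_max W / \<sigma>)"
  and small: "ucrs * r^3 * \<omega> \<le> \<sigma> / 1000"
proof -
  have nn: "0 \<le> \<sigma>" "0 \<le> sigma_max W"
    using singular_values_attained(1)[OF W mn W_singular(1)] singular_values_attained(1)[OF W mn W_singular(2)]
    by (auto simp: \<sigma>_def)
  have "\<sigma> \<noteq> 0"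
  proof
    assume "\<sigma> = 0"
    then have "cond W = \<infinity>" by (simp add: cond_def \<sigma>_def)
    then have "ereal ucrs \<le> 0" using ucrs_small by simp
    then show False using u_pos by simp
  qed
  then show pos: "0 < \<sigma>" using nn by simp
  show cond: "cond W = ereal (sigma_max W / \<sigma>)" using pos by (simp add: cond_def \<sigma>_def)
  have "\<sigma> \<le> sigma_max W" unfolding \<sigma>_def sigma_min_def sigma_max_def
    using finite_singular_values W_singular(1) Min_le Max_ge by (meson order_trans)
  then have max: "0 < sigma_max W" using pos by simp
  have "ucrs \<le> 1/1000 * (\<sigma> / sigma_max W) * (1 / (real m)\<^sup>2)"
    using ucrs_small pos max by (simp add: cond)
  then have "ucrs * ((real m)\<^sup>2 * sigma_max W) \<le> \<sigma> / 1000"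
    using max m_pos by (simp add: field_simps)
  moreover have "(real m)\<^sup>2 = r^3 * r" by (simp flip: r_bounds(2) add: power2_eq_square power3_eq_cube)
  ultimately show "ucrs * r^3 * \<omega> \<le> \<sigma> / 1000" by (simp add: \<omega>_def ac_simps)
qed

lemma fro_W_le: "fro_norm W \<le> \<omega>"
  unfolding \<omega>_def r_def
  by (rule fro_norm_le_sqrt_spec[OF W _ W_singular(4)])
    (use singular_values_attained(1)[OF W mn W_singular(2)] in auto)

lemma sqrt_\<epsilon>0: "sqrt (1 + \<epsilon>0) \<le> 1225/1000"
  using \<epsilon>0 by (intro real_le_lsqrt) (auto simp: power2_eq_square)

text \<open>The power of \<open>n\<close> in the bound for the fine roundoff cancels the dimension factor \<open>n\<close> of the sketch and
  the factor \<open>sqrt n\<close> in the norm of \<open>\<Theta>\<close>; the power of \<open>m\<close> is kept as \<open>1 / r\<close>, to offset \<open>fro_norm Q0\<close>,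
  which grows like \<open>r\<close>.\<close>

lemma sketch_constant: "102/100 * real n * ufine * fro_norm \<Theta> \<le> 1/80 * (ucrs / r)"
proof -
  have n: "1 \<le> n" using m_pos mn by simp
  have "fro_norm \<Theta> \<le> sqrt (1 + \<epsilon>0) * sqrt (real n)"
    using \<Theta>_norm \<Theta> by (simp add: sketch_norm_bound_def)
  also have "\<dots> \<le> 1225/1000 * sqrt (real n)" by (intro mult_right_mono sqrt_\<epsilon>0) simp
  finally have 1: "fro_norm \<Theta> \<le> 1225/1000 * sqrt (real n)" .
  have "real m powr (-1/2) = 1 / r"
    by (simp add: r_def powr_minus_divide powr_half_sqrt flip: minus_divide_left)
  moreover have "real n powr (-3/2) = 1 / (real n * sqrt (real n))"
  proof -
    have "real n powr (3/2) = real n powr (1 + 1/2)" by simp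
    also have "\<dots> = real n * sqrt (real n)" using n by (subst powr_add) (simp add: powr_half_sqrt)
    finally show ?thesis by (simp add: powr_minus_divide flip: minus_divide_left)
  qed
  ultimately have 2: "ufine \<le> 1/100 * (1 / r) * (1 / (real n * sqrt (real n))) * ucrs"
    using ufine_small by simp
  have "102/100 * real n * ufine * fro_norm \<Theta>
      \<le> 102/100 * real n * (1/100 * (1 / r) * (1 / (real n * sqrt (real n))) * ucrs) * (1225/1000 * sqrt (real n))"
    using 1 2 ufine u_pos r_bounds(1) by (intro mult_mono mult_left_mono) auto
  also have "\<dots> = 102/100 * (1/100) * (1225/1000) * (ucrs / r)" using n by (simp add: field_simps)
  also have "\<dots> \<le> 1/80 * (ucrs / r)" using u_pos r_bounds(1) by (intro mult_right_mono) auto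
  finally show ?thesis .
qed

lemma sketch_window:
  assumes "sketch_computed ufine \<Theta> X Y" "X \<in> carrier_mat n m" "Y \<in> carrier_mat k m" "s + b \<le> m"
  shows "fro_norm (window Y 0 k s b - \<Theta> * window X 0 n s b) \<le> 1/80 * (ucrs / r) * fro_norm (window X 0 n s b)"
  using sketch_computed_window[OF assms(1) \<Theta> assms(2-4)] ufine(1)
    mult_right_mono[OF sketch_constant fro_norm_nonneg[of "window X 0 n s b"]] by linarith

text \<open>The state after \<open>q\<close> blocks. All bounds are for squares of norms, since these add over blocks: the
  off-diagonal blocks of the Gram matrix contribute the term with the norm of \<open>W\<close> (twice, by symmetry), each
  diagonal block one of the \<open>q\<close> equal terms.\<close>

definition invariant :: "nat \<Rightarrow> bool" where
  "invariant q \<longleftrightarrow>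
     (let s = q * mp; w2 = (fro_norm (window W 0 n 0 s))\<^sup>2 in
       (fro_norm (1\<^sub>m s - (window S 0 k 0 s)\<^sup>T * window S 0 k 0 s))\<^sup>2
          \<le> 2 * (66/10 * (ucrs * r^3 / \<sigma>))\<^sup>2 * w2 + real q * (real mp * (65/100 * (ucrs * r * \<omega> / \<sigma>)))\<^sup>2
       \<and> (fro_norm (window (Q * R - W) 0 n 0 s))\<^sup>2 \<le> (15/4 * (ucrs * r^3))\<^sup>2 * w2
       \<and> (fro_norm (window (\<Theta> * (Q * R - W)) 0 k 0 s))\<^sup>2 \<le> (15/4 * (ucrs * r^3))\<^sup>2 * w2
       \<and> (fro_norm (window (P - S * R) 0 k 0 s))\<^sup>2 \<le> (39/10 * (ucrs * r^3))\<^sup>2 * w2)"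

lemma invariant_0: "invariant 0"
  by (simp add: invariant_def Let_def fro_norm_def)

text \<open>The invariant gives \<open>2 * 6.6^2 + 1/2 < 100\<close>. In the induction the factor 10 makes the defect at most
  1/100, below the 1/50 that the block step requires.\<close>

lemma orthogonality_defect_le:
  assumes "invariant q" "q \<le> p"
  shows "fro_norm (1\<^sub>m (q * mp) - (window S 0 k 0 (q * mp))\<^sup>T * window S 0 k 0 (q * mp)) \<le> 10 * (ucrs * r^3 * \<omega> / \<sigma>)"
proof -
  define e where "e = ucrs * r^3 * \<omega> / \<sigma>"
  have \<omega>: "0 \<le> \<omega>" using fro_W_le fro_norm_nonneg[of W] by linarith
  have e: "0 \<le> e" using u_pos \<sigma>_pos r_bounds(1) \<omega> by (simp add: e_def)
  have qm: "q * mp \<le> m" using assms(2) m by (simp add: mult.commute)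
  have w: "fro_norm (window W 0 n 0 (q * mp)) \<le> \<omega>"
    using fro_norm_window_mono[OF W, of 0 "q * mp"] qm fro_W_le by simp
  have "2 * (66/10 * (ucrs * r^3 / \<sigma>))\<^sup>2 * (fro_norm (window W 0 n 0 (q * mp)))\<^sup>2
      \<le> 2 * (66/10 * (ucrs * r^3 / \<sigma>))\<^sup>2 * \<omega>\<^sup>2"
    using w by (intro mult_left_mono power_mono) auto
  also have "\<dots> = 2 * (66/10)\<^sup>2 * e\<^sup>2" by (simp add: e_def power_mult_distrib power_divide)
  finally have 1: "2 * (66/10 * (ucrs * r^3 / \<sigma>))\<^sup>2 * (fro_norm (window W 0 n 0 (q * mp)))\<^sup>2 \<le> 8712/100 * e\<^sup>2"
    by (simp add: power2_eq_square)
  have "real q * (real mp)\<^sup>2 \<le> r^4"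
  proof -
    have "real q * real mp \<le> real m" using qm by (metis of_nat_le_iff of_nat_mult)
    moreover have "mp * 1 \<le> m" unfolding m using p by (intro mult_left_mono) auto
    then have "real mp \<le> real m" by simp
    ultimately have "(real q * real mp) * real mp \<le> real m * real m" by (intro mult_mono) auto
    moreover have "r^4 = real m * real m" by (simp flip: r_bounds(3) add: power4_eq_xxxx)
    ultimately show ?thesis by (simp add: power2_eq_square mult.assoc)
  qed
  then have "real q * (real mp)\<^sup>2 * (65/100 * (ucrs * r * \<omega> / \<sigma>))\<^sup>2 \<le> r^4 * (65/100 * (ucrs * r * \<omega> / \<sigma>))\<^sup>2"
    by (rule mult_right_mono) simp
  also have "\<dots> = (65/100)\<^sup>2 * e\<^sup>2" 
    by (simp add: e_def power_mult_distrib power_divide flip: power_mult power_add)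
  also have "\<dots> \<le> 1/2 * e\<^sup>2" by (rule mult_right_mono) (auto simp: power2_eq_square)
  finally have 2: "real q * (real mp * (65/100 * (ucrs * r * \<omega> / \<sigma>)))\<^sup>2 \<le> 1/2 * e\<^sup>2"
    by (simp only: power_mult_distrib[of "real mp"] mult.assoc)
  have "(fro_norm (1\<^sub>m (q * mp) - (window S 0 k 0 (q * mp))\<^sup>T * window S 0 k 0 (q * mp)))\<^sup>2 \<le> (10 * e)\<^sup>2"
  proof -
    have "(10 * e)\<^sup>2 = 100 * e\<^sup>2" by (simp add: power_mult_distrib)
    then show ?thesis
      using conjunct1[OF assms(1)[unfolded invariant_def Let_def]] 1 2 zero_le_power2[of e] by linarith
  qed
  then show ?thesis unfolding e_def[symmetric] by (rule power2_le_imp_le) (simp add: e)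
qed

text \<open>The hypotheses on the computed quantities, read off for block \<open>q + 1\<close>, together with the invariant.\<close>

lemma block_step_at:
  assumes inv: "invariant q" and q: "q < p"
  shows "block_step n k (q * mp) mp r ucrs \<sigma> \<omega> \<Theta>
    (window W 0 n 0 (q * mp)) (window W 0 n (q * mp) mp) (window P 0 k (q * mp) mp)
    (window Q 0 n 0 (q * mp)) (window Q 0 n (q * mp) mp) (window Q' 0 n (q * mp) mp)
    (window S 0 k 0 (q * mp)) (window S 0 k (q * mp) mp)
    (window R 0 (q * mp) 0 (q * mp)) (window R 0 (q * mp) (q * mp) mp) (window R (q * mp) mp (q * mp) mp)"
proof -
  define s where "s = q * mp"
  have "Suc q * mp \<le> p * mp" using q by (intro mult_right_mono) auto
  then have sb: "s + mp \<le> m" by (simp add: s_def m mult.commute)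
  have i: "Suc q \<in> {1..p}" using q by auto
  have \<omega>: "0 \<le> \<omega>" using fro_W_le fro_norm_nonneg[of W] by linarith
  have QRc: "Q * R \<in> carrier_mat n m" and E: "Q * R - W \<in> carrier_mat n m" using Q R W by auto
  have dims: "dim_row W = n" "dim_row P = k" "dim_row Q = n" "dim_row Q' = n" "dim_row S = k" "dim_col Q = m"
    using W P Q Q' S by auto
  note windows = col_blocks_window sub_blocks_window diff_Suc_1 dims s_def[symmetric] Let_def
  have F_bound: "x \<le> 15/4 * (ucrs * r^3) * \<omega>"
    if "x\<^sup>2 \<le> (15/4 * (ucrs * r^3))\<^sup>2 * (fro_norm (window W 0 n 0 s))\<^sup>2" for x
  proof -
    have nn: "0 \<le> 15/4 * (ucrs * r^3)" using u_pos r_bounds(1) by simp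
    have "x\<^sup>2 \<le> (15/4 * (ucrs * r^3) * fro_norm (window W 0 n 0 s))\<^sup>2"
      using that unfolding power_mult_distrib[of "15/4 * (ucrs * r^3)" "fro_norm (window W 0 n 0 s)"] .
    then have "x \<le> 15/4 * (ucrs * r^3) * fro_norm (window W 0 n 0 s)"
      by (rule power2_le_imp_le) (use nn in \<open>auto intro!: mult_nonneg_nonneg\<close>)
    also have "\<dots> \<le> 15/4 * (ucrs * r^3) * \<omega>"
      using fro_norm_window_mono[OF W, of 0 s] sb fro_W_le nn by (intro mult_left_mono) auto
    finally show ?thesis .
  qed
  show ?thesis unfolding s_def[symmetric]
  proof (rule block_step.intro)
    show "1 \<le> mp" "mp \<le> k" "k \<le> n" "1 \<le> r" "0 < ucrs" "0 < \<sigma>" "ucrs * r^3 * \<omega> \<le> \<sigma> / 1000"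
      using mp sb mk kn r_bounds(1) u_pos \<sigma>_pos small by auto
    show "real s + real mp \<le> r\<^sup>2" unfolding r_bounds(2) using sb by linarith
    show "fro_norm (window W 0 n s mp) \<le> \<omega>" using fro_norm_window_mono[OF W sb] fro_W_le by simp
    show "\<sigma> * vnorm z \<le> vnorm (window W 0 n 0 s *\<^sub>v z + window W 0 n s mp *\<^sub>v y) \<and>
          \<sigma> * vnorm y \<le> vnorm (window W 0 n 0 s *\<^sub>v z + window W 0 n s mp *\<^sub>v y)"
      if zy: "z \<in> carrier_vec s" "y \<in> carrier_vec mp" for z y
    proof -
      obtain v where v: "v \<in> carrier_vec m" "window W 0 n 0 s *\<^sub>v z + window W 0 n s mp *\<^sub>v y = W *\<^sub>v v"
        "vnorm z \<le> vnorm v" "vnorm y \<le> vnorm v"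
        by (rule window_combination[OF W sb zy])
      have "\<sigma> * vnorm z \<le> \<sigma> * vnorm v" "\<sigma> * vnorm y \<le> \<sigma> * vnorm v"
        using v(3,4) \<sigma>_pos by auto
      then show ?thesis using W_singular(3)[OF v(1)] unfolding v(2) \<sigma>_def by linarith
    qed
    show "\<bar>(window W 0 n 0 s *\<^sub>v z + window W 0 n s mp *\<^sub>v y) \<bullet> (window W 0 n 0 s *\<^sub>v z' + window W 0 n s mp *\<^sub>v y')
        - (\<Theta> *\<^sub>v (window W 0 n 0 s *\<^sub>v z + window W 0 n s mp *\<^sub>v y))
            \<bullet> (\<Theta> *\<^sub>v (window W 0 n 0 s *\<^sub>v z' + window W 0 n s mp *\<^sub>v y'))\<bar>
      \<le> 1/2 * (vnorm (window W 0 n 0 s *\<^sub>v z + window W 0 n s mp *\<^sub>v y)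
           * vnorm (window W 0 n 0 s *\<^sub>v z' + window W 0 n s mp *\<^sub>v y'))"
      if zy: "z \<in> carrier_vec s" "y \<in> carrier_vec mp" and zy': "z' \<in> carrier_vec s" "y' \<in> carrier_vec mp" for z y z' y'
    proof -
      obtain v where v: "v \<in> carrier_vec m" "window W 0 n 0 s *\<^sub>v z + window W 0 n s mp *\<^sub>v y = W *\<^sub>v v"
        by (rule window_combination[OF W sb zy])
      obtain v' where v': "v' \<in> carrier_vec m" "window W 0 n 0 s *\<^sub>v z' + window W 0 n s mp *\<^sub>v y' = W *\<^sub>v v'"
        by (rule window_combination[OF W sb zy'])
      have "\<epsilon> * (vnorm (W *\<^sub>v v) * vnorm (W *\<^sub>v v')) \<le> 1/2 * (vnorm (W *\<^sub>v v) * vnorm (W *\<^sub>v v'))"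
        using \<epsilon> by (intro mult_right_mono) auto
      then show ?thesis
        using embed_W v(1) v'(1) unfolding eps_embedding_mat_iff[OF W] v(2) v'(2) mult.assoc by (meson order_trans)
    qed
    show "(fro_norm (window Q 0 n 0 s))\<^sup>2 \<le> 2 * (fro_norm (\<Theta> * window Q 0 n 0 s))\<^sup>2"
    proof (rule sketch_embedding_lower[OF Q \<Theta> _ _ _ \<epsilon>])
      show "s \<le> (p - 1) * mp" "(p - 1) * mp \<le> m" using q by (auto simp: s_def m mult.commute)
      show "eps_embedding_mat \<epsilon> \<Theta> (window Q 0 n 0 ((p - 1) * mp))"
        using embed_Q unfolding col_blocks_window dims .
    qed
    show "fro_norm (window P 0 k s mp - \<Theta> * window W 0 n s mp) \<le> 1/80 * (ucrs / r) * fro_norm (window W 0 n s mp)"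
      by (rule sketch_window[OF sketch_P W P sb])
    show "fro_norm (window S 0 k 0 s - \<Theta> * window Q 0 n 0 s) \<le> 1/80 * (ucrs / r) * fro_norm (window Q 0 n 0 s)"
      by (rule sketch_window[OF sketch_S Q S]) (use sb in simp)
    show "fro_norm (window S 0 k s mp - \<Theta> * window Q 0 n s mp) \<le> 1/80 * (ucrs / r) * fro_norm (window Q 0 n s mp)"
      by (rule sketch_window[OF sketch_S Q S sb])
    show "\<exists>dS\<in>carrier_mat k s. \<exists>dp\<in>carrier_vec k.
        is_arg_min (\<lambda>y. vnorm ((window S 0 k 0 s + dS) *\<^sub>v y - (col (window P 0 k s mp) j + dp)))
          (\<lambda>y. y \<in> carrier_vec s) (col (window R 0 s s mp) j)
        \<and> fro_norm dS \<le> 1/100 * ucrs * spec_norm (window S 0 k 0 s)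
        \<and> vnorm dp \<le> 1/100 * ucrs * vnorm (col (window P 0 k s mp) j)" if j: "j < mp" for j
    proof -
      have c: "0.01 * ucrs = 1/100 * ucrs" by simp
      from solver i have "ls_backward_stable mp ucrs P S R (Suc q)" by blast
      then show ?thesis using j unfolding ls_backward_stable_def windows c window_dim by blast
    qed
    have upd: "update_stable mp \<epsilon>0 ucrs \<Theta> W Q Q' R (Suc q)" using update i by blast
    define B where "B = mat_abs (window W 0 n s mp) + real (Suc q * mp) \<cdot>\<^sub>m
                (mat_abs (window Q 0 n 0 s) * mat_abs (window R 0 s s mp))"
    have B: "fro_norm B \<le> fro_norm (window W 0 n s mp) + r\<^sup>2 * (fro_norm (window Q 0 n 0 s) * fro_norm (window R 0 s s mp))"
    proof -
      have c: "mat_abs (window Q 0 n 0 s) * mat_abs (window R 0 s s mp) \<in> carrier_mat n mp"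
        by (rule mult_carrier_mat[of _ n s]) auto
      have "fro_norm B \<le> fro_norm (mat_abs (window W 0 n s mp)) + fro_norm (real (Suc q * mp) \<cdot>\<^sub>m
                (mat_abs (window Q 0 n 0 s) * mat_abs (window R 0 s s mp)))"
        unfolding B_def by (rule fro_norm_add_le[of _ n mp]) (use c in auto)
      also have "\<dots> = fro_norm (window W 0 n s mp) + real (Suc q * mp) * fro_norm (mat_abs (window Q 0 n 0 s) * mat_abs (window R 0 s s mp))"
        by simp
      also have "real (Suc q * mp) * fro_norm (mat_abs (window Q 0 n 0 s) * mat_abs (window R 0 s s mp))
          \<le> r\<^sup>2 * (fro_norm (window Q 0 n 0 s) * fro_norm (window R 0 s s mp))"
      proof (rule mult_mono)
        have "Suc q * mp \<le> m" using sb by (simp add: s_def)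
        then show "real (Suc q * mp) \<le> r\<^sup>2" unfolding r_bounds(2) by (rule of_nat_mono)
        show "fro_norm (mat_abs (window Q 0 n 0 s) * mat_abs (window R 0 s s mp))
          \<le> fro_norm (window Q 0 n 0 s) * fro_norm (window R 0 s s mp)"
          using fro_norm_mult_le[of "mat_abs (window Q 0 n 0 s)" n s "mat_abs (window R 0 s s mp)" mp] by simp
      qed auto
      finally show ?thesis by simp
    qed
    have le: "mat_abs (window Q' 0 n s mp - (window W 0 n s mp - window Q 0 n 0 s * window R 0 s s mp)) \<le> (1.02 * ucrs) \<cdot>\<^sub>m B"
      and sk: "fro_norm (\<Theta> * (window Q' 0 n s mp - (window W 0 n s mp - window Q 0 n 0 s * window R 0 s s mp)))
          \<le> 1.02 * ucrs * sqrt (1 + \<epsilon>0) * fro_norm B"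
      using upd unfolding update_stable_def update_error_def windows B_def by auto
    from fro_norm_abs_mono[OF le]
    have "fro_norm (window Q' 0 n s mp - (window W 0 n s mp - window Q 0 n 0 s * window R 0 s s mp)) \<le> 102/100 * ucrs * fro_norm B"
      using u_pos by simp
    also have "\<dots> \<le> 102/100 * ucrs * (fro_norm (window W 0 n s mp) + r\<^sup>2 * (fro_norm (window Q 0 n 0 s) * fro_norm (window R 0 s s mp)))"
      using u_pos by (intro mult_left_mono B) auto
    finally show "fro_norm (window Q' 0 n s mp - (window W 0 n s mp - window Q 0 n 0 s * window R 0 s s mp))
      \<le> 102/100 * ucrs * (fro_norm (window W 0 n s mp) + r\<^sup>2 * (fro_norm (window Q 0 n 0 s) * fro_norm (window R 0 s s mp)))" .
    note sk
    also have "1.02 * ucrs * sqrt (1 + \<epsilon>0) * fro_norm B = (102/100 * ucrs) * sqrt (1 + \<epsilon>0) * fro_norm B" by simp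
    also have "\<dots> \<le> (102/100 * ucrs) * (1225/1000) * fro_norm B"
      using u_pos by (intro mult_left_mono mult_right_mono sqrt_\<epsilon>0) auto
    also have "\<dots> \<le> (102/100 * ucrs) * (1225/1000) * (fro_norm (window W 0 n s mp) + r\<^sup>2 * (fro_norm (window Q 0 n 0 s) * fro_norm (window R 0 s s mp)))"
      using u_pos by (intro mult_left_mono B) auto
    finally show "fro_norm (\<Theta> * (window Q' 0 n s mp - (window W 0 n s mp - window Q 0 n 0 s * window R 0 s s mp)))
      \<le> 102/100 * ucrs * (1225/1000) * (fro_norm (window W 0 n s mp) + r\<^sup>2 * (fro_norm (window Q 0 n 0 s) * fro_norm (window R 0 s s mp)))" .
    have qrs: "qr_backward_stable mp ucrs ufine \<Theta> Q Q' R (Suc q)" using qr i by blast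
    then have le: "mat_abs (window Q' 0 n s mp - window Q 0 n s mp * window R s mp s mp)
        \<le> (0.1 * ucrs) \<cdot>\<^sub>m (mat_abs (window Q 0 n s mp) * mat_abs (window R s mp s mp))"
      and sk: "fro_norm (\<Theta> * (window Q' 0 n s mp - window Q 0 n s mp * window R s mp s mp))
        \<le> 0.1 * ucrs * spec_norm (window Q 0 n s mp) * spec_norm (window R s mp s mp)"
      unfolding qr_backward_stable_def windows by (auto intro: order_trans)
    from fro_norm_abs_mono[OF le]
    have "fro_norm (window Q' 0 n s mp - window Q 0 n s mp * window R s mp s mp)
        \<le> 1/10 * ucrs * fro_norm (mat_abs (window Q 0 n s mp) * mat_abs (window R s mp s mp))"
      using u_pos by simp
    also have "\<dots> \<le> 1/10 * ucrs * (fro_norm (window Q 0 n s mp) * fro_norm (window R s mp s mp))"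
      using fro_norm_mult_le[of "mat_abs (window Q 0 n s mp)" n mp "mat_abs (window R s mp s mp)" mp] u_pos
      by (intro mult_left_mono) auto
    finally show "fro_norm (window Q' 0 n s mp - window Q 0 n s mp * window R s mp s mp)
      \<le> 1/10 * ucrs * (fro_norm (window Q 0 n s mp) * fro_norm (window R s mp s mp))" .
    show "fro_norm (\<Theta> * (window Q' 0 n s mp - window Q 0 n s mp * window R s mp s mp))
        \<le> 1/10 * ucrs * (spec_norm (window Q 0 n s mp) * spec_norm (window R s mp s mp))"
      using sk by simp
    show "1 - ereal (1/10 * ucrs) * cond (window Q' 0 n s mp) \<le> ereal (sigma_min (\<Theta> * window Q 0 n s mp))
        \<and> ereal (sigma_max (\<Theta> * window Q 0 n s mp)) \<le> 1 + ereal (1/10 * ucrs) * cond (window Q' 0 n s mp)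
        \<and> spec_norm (window Q 0 n s mp) \<le> (1 - \<eta>) powr (-1/2) * spec_norm (\<Theta> * window Q 0 n s mp)"
      if "\<eta> < 1" "eps_embedding_mat \<eta> \<Theta> (window Q' 0 n s mp)" for \<eta>
    proof -
      from qr_orth i have "qr_sketch_orthonormal mp ucrs \<Theta> Q Q' (Suc q)" by blast
      from this[unfolded qr_sketch_orthonormal_def windows, rule_format, OF that]
      show ?thesis by blast
    qed
    show "fro_norm (1\<^sub>m s - (window S 0 k 0 s)\<^sup>T * window S 0 k 0 s) \<le> 1/50"
    proof -
      have "ucrs * r^3 * \<omega> / \<sigma> \<le> 1/1000" using small \<sigma>_pos by (simp add: field_simps)
      then show ?thesis using orthogonality_defect_le[OF inv less_imp_le[OF q]] unfolding s_def by linarith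
    qed
    have win: "window (Q * R - W) 0 n 0 s = window Q 0 n 0 s * window R 0 s 0 s - window W 0 n 0 s"
      using window_minus[OF QRc W, of 0 s] window_mult_upper_triangular(1)[OF Q R R_upper sb] sb by simp
    show "fro_norm (window Q 0 n 0 s * window R 0 s 0 s - window W 0 n 0 s) \<le> 15/4 * (ucrs * r^3) * \<omega>"
      by (rule F_bound) (use inv in \<open>simp add: invariant_def Let_def win flip: s_def\<close>)
    have "window (\<Theta> * (Q * R - W)) 0 k 0 s = \<Theta> * window (Q * R - W) 0 n 0 s"
      by (rule window_mult_left[OF \<Theta> E]) (use sb in simp)
    then show "fro_norm (\<Theta> * (window Q 0 n 0 s * window R 0 s 0 s - window W 0 n 0 s)) \<le> 15/4 * (ucrs * r^3) * \<omega>"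
      by (intro F_bound) (use inv in \<open>simp add: invariant_def Let_def win flip: s_def\<close>)
  qed (use \<Theta> in auto)
qed

lemma invariant_Suc:
  assumes inv: "invariant q" and q: "q < p"
  shows "invariant (Suc q)"
proof -
  define s where "s = q * mp"
  interpret step: block_step n k s mp r ucrs \<sigma> \<omega> \<Theta>
    "window W 0 n 0 s" "window W 0 n s mp" "window P 0 k s mp"
    "window Q 0 n 0 s" "window Q 0 n s mp" "window Q' 0 n s mp"
    "window S 0 k 0 s" "window S 0 k s mp"
    "window R 0 s 0 s" "window R 0 s s mp" "window R s mp s mp"
    unfolding s_def by (rule block_step_at[OF inv q])
  have "Suc q * mp \<le> p * mp" using q by (intro mult_right_mono) auto
  then have sb: "s + mp \<le> m" by (simp add: s_def m mult.commute)
  have s': "Suc q * mp = s + mp" by (simp add: s_def)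
  define v where "v = fro_norm (window W 0 n s mp)"
  define w2 where "w2 = (fro_norm (window W 0 n 0 s))\<^sup>2"
  have w2': "(fro_norm (window W 0 n 0 (s + mp)))\<^sup>2 = w2 + v\<^sup>2"
    by (simp only: fro_norm_sq_window_add w2_def v_def)
  have lead_W: "(fro_norm (1\<^sub>m s - (window S 0 k 0 s)\<^sup>T * window S 0 k 0 s))\<^sup>2
      \<le> 2 * (66/10 * (ucrs * r^3 / \<sigma>))\<^sup>2 * w2 + real q * (real mp * (65/100 * (ucrs * r * \<omega> / \<sigma>)))\<^sup>2"
    and lead_E: "(fro_norm (window (Q * R - W) 0 n 0 s))\<^sup>2 \<le> (15/4 * (ucrs * r^3))\<^sup>2 * w2"
    and lead_\<Theta>E: "(fro_norm (window (\<Theta> * (Q * R - W)) 0 k 0 s))\<^sup>2 \<le> (15/4 * (ucrs * r^3))\<^sup>2 * w2"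
    and lead_P: "(fro_norm (window (P - S * R) 0 k 0 s))\<^sup>2 \<le> (39/10 * (ucrs * r^3))\<^sup>2 * w2"
    using inv unfolding invariant_def Let_def s_def w2_def by blast+
  have QR: "Q * R \<in> carrier_mat n m" and E: "Q * R - W \<in> carrier_mat n m"
    and SR: "S * R \<in> carrier_mat k m" using Q R W S by auto
  \<comment> \<open>Squared Frobenius norms add up over blocks, so a bound proportional to the norm of each block
    carries over to the leading blocks.\<close>
  have add: "(fro_norm (window X 0 l 0 (s + mp)))\<^sup>2 \<le> c\<^sup>2 * (w2 + v\<^sup>2)"
    if "(fro_norm (window X 0 l 0 s))\<^sup>2 \<le> c\<^sup>2 * w2" "fro_norm (window X 0 l s mp) \<le> c * v" for X :: "real mat" and l c
  proof -
    have "(fro_norm (window X 0 l s mp))\<^sup>2 \<le> (c * v)\<^sup>2" using that(2) by (rule power_mono) simp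
    then show ?thesis using that(1) unfolding fro_norm_sq_window_add power_mult_distrib distrib_left by linarith
  qed
  have "window (Q * R - W) 0 n s mp = window Q 0 n 0 s * window R 0 s s mp
      + window Q 0 n s mp * window R s mp s mp - window W 0 n s mp"
    unfolding window_minus[OF QR W sb] window_mult_upper_triangular(2)[OF Q R R_upper sb] ..
  note blk = this
  have 1: "(fro_norm (window (Q * R - W) 0 n 0 (s + mp)))\<^sup>2 \<le> (15/4 * (ucrs * r^3))\<^sup>2 * (w2 + v\<^sup>2)"
    using step.block_defect_bounds(1) by (intro add[OF lead_E]) (simp only: blk v_def)
  have 2: "(fro_norm (window (\<Theta> * (Q * R - W)) 0 k 0 (s + mp)))\<^sup>2 \<le> (15/4 * (ucrs * r^3))\<^sup>2 * (w2 + v\<^sup>2)"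
    using step.block_defect_bounds(2) by (intro add[OF lead_\<Theta>E]) (simp only: window_mult_left[OF \<Theta> E sb] blk v_def)
  have blkP: "window (P - S * R) 0 k s mp = window P 0 k s mp
      - (window S 0 k 0 s * window R 0 s s mp + window S 0 k s mp * window R s mp s mp)"
    unfolding window_minus[OF P SR sb] window_mult_upper_triangular(2)[OF S R R_upper sb] ..
  have 3: "(fro_norm (window (P - S * R) 0 k 0 (s + mp)))\<^sup>2 \<le> (39/10 * (ucrs * r^3))\<^sup>2 * (w2 + v\<^sup>2)"
    using step.sketch_residual_le by (intro add[OF lead_P]) (simp only: blkP v_def)
  define a where "a = 66/10 * (ucrs * r^3 / \<sigma>)"
  define d where "d = real mp * (65/100 * (ucrs * r * \<omega> / \<sigma>))"
  have cross: "(fro_norm ((window S 0 k 0 s)\<^sup>T * window S 0 k s mp))\<^sup>2 \<le> a\<^sup>2 * v\<^sup>2"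
    unfolding power_mult_distrib[symmetric]
    using step.cross_gram_le by (intro power_mono) (auto simp: a_def v_def)
  have diag: "(fro_norm (1\<^sub>m mp - (window S 0 k s mp)\<^sup>T * window S 0 k s mp))\<^sup>2 \<le> d\<^sup>2"
  proof (rule power_mono)
    have "step.\<rho> \<le> ucrs * r * \<omega> / \<sigma>"
      unfolding step.\<rho>_def using step.w_bounds(3) u_pos r_bounds(1) \<sigma>_pos
      by (intro divide_right_mono mult_left_mono) auto
    then have "real mp * (65/100 * step.\<rho>) \<le> d" unfolding d_def by (intro mult_left_mono) auto
    then show "fro_norm (1\<^sub>m mp - (window S 0 k s mp)\<^sup>T * window S 0 k s mp) \<le> d"
      using step.Sb_near by linarith
  qed simp
  have lead: "(fro_norm (1\<^sub>m s - (window S 0 k 0 s)\<^sup>T * window S 0 k 0 s))\<^sup>2 \<le> 2 * a\<^sup>2 * w2 + real q * d\<^sup>2"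
    using lead_W unfolding a_def d_def .
  have "(fro_norm (1\<^sub>m (s + mp) - (window S 0 k 0 (s + mp))\<^sup>T * window S 0 k 0 (s + mp)))\<^sup>2
      \<le> (2 * a\<^sup>2 * w2 + real q * d\<^sup>2) + 2 * (a\<^sup>2 * v\<^sup>2) + d\<^sup>2"
    unfolding gram_defect_window_add[OF S sb] using lead cross diag by linarith
  also have "\<dots> = 2 * a\<^sup>2 * (w2 + v\<^sup>2) + real (Suc q) * d\<^sup>2" by (simp add: algebra_simps)
  finally show ?thesis
    using 1 2 3 unfolding invariant_def Let_def s' w2' a_def d_def by blast
qed

lemma invariant_all: "q \<le> p \<Longrightarrow> invariant q"
  by (induction q) (auto intro: invariant_0 invariant_Suc)

lemma p_mp: "p * mp = m" by (simp add: m mult.commute)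

lemma residual_le: "fro_norm (P - S * R) \<le> 39/10 * (ucrs * r^3) * fro_norm W"
proof -
  have "P - S * R \<in> carrier_mat k m" using P S R by auto
  then have "(fro_norm (P - S * R))\<^sup>2 \<le> (39/10 * (ucrs * r^3))\<^sup>2 * (fro_norm W)\<^sup>2"
    using invariant_all[of p] unfolding invariant_def Let_def p_mp by (simp add: window_full[OF W] window_full)
  then have "(fro_norm (P - S * R))\<^sup>2 \<le> (39/10 * (ucrs * r^3) * fro_norm W)\<^sup>2"
    unfolding power_mult_distrib[of "39/10 * (ucrs * r^3)" "fro_norm W"] .
  then show ?thesis by (rule power2_le_imp_le) (use u_pos r_bounds(1) in simp)
qed

text \<open>The sketch does not shrink \<open>W\<close> by more than \<open>sqrt 2\<close>, and \<open>4.2 * sqrt 2\<close>, about \<open>5.94\<close>, leaves room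
  for the error of the computed sketch \<open>P\<close>.\<close>

lemma fro_W_le_P: "42/10 * fro_norm W \<le> 6 * fro_norm P" and fro_W_pos: "0 < fro_norm W"
proof -
  have car: "\<Theta> * W \<in> carrier_mat k m" "P - \<Theta> * W \<in> carrier_mat k m" using \<Theta> W P by auto
  have "vnorm (W *\<^sub>v unit_vec m 0) \<le> fro_norm W" using vnorm_mult_le_fro[OF W, of "unit_vec m 0"] m_pos by simp
  then show pos: "0 < fro_norm W"
    using W_singular(3)[of "unit_vec m 0"] \<sigma>_pos m_pos by (simp add: \<sigma>_def)
  have "(fro_norm W)\<^sup>2 \<le> 2 * (fro_norm (\<Theta> * W))\<^sup>2"
    using sketch_embedding_lower[OF W \<Theta> order_refl order_refl _ \<epsilon>] embed_W by (simp add: window_full[OF W])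
  also have "\<dots> \<le> (1415/1000)\<^sup>2 * (fro_norm (\<Theta> * W))\<^sup>2"
    by (rule mult_right_mono) (auto simp: power2_eq_square)
  finally have "fro_norm W \<le> 1415/1000 * fro_norm (\<Theta> * W)"
    unfolding power_mult_distrib[symmetric] by (rule power2_le_imp_le) simp
  moreover have "\<Theta> * W = P - (P - \<Theta> * W)" by (rule eq_matI) (use \<Theta> W P in auto)
  then have "fro_norm (\<Theta> * W) \<le> fro_norm P + fro_norm (P - \<Theta> * W)"
    using fro_norm_diff_le[OF P car(2)] by simp
  moreover have "fro_norm (P - \<Theta> * W) \<le> 1/80 * (ucrs / r) * fro_norm W"
    using sketch_window[OF sketch_P W P, of 0 m] by (simp add: window_full[OF W] window_full[OF P])
  moreover have "1/80 * (ucrs / r) * fro_norm W \<le> 1/80000 * fro_norm W"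
  proof (rule mult_right_mono)
    interpret step: block_step n k 0 mp r ucrs \<sigma> \<omega> \<Theta>
      "window W 0 n 0 0" "window W 0 n 0 mp" "window P 0 k 0 mp"
      "window Q 0 n 0 0" "window Q 0 n 0 mp" "window Q' 0 n 0 mp"
      "window S 0 k 0 0" "window S 0 k 0 mp"
      "window R 0 0 0 0" "window R 0 0 0 mp" "window R 0 mp 0 mp"
      using block_step_at[OF invariant_0] p by simp
    show "1/80 * (ucrs / r) \<le> 1/80000" using step.w_bounds(9,10) by linarith
  qed simp
  ultimately show "42/10 * fro_norm W \<le> 6 * fro_norm P" using pos by linarith
qed

lemma r_cubed: "real m powr (3/2) = r^3"
proof -
  have "real m powr (3/2) = real m powr (1 + 1/2)" by simp
  also have "\<dots> = real m * r" using m_pos by (subst powr_add) (simp add: powr_half_sqrt r_def)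
  also have "\<dots> = r^3" by (simp add: power3_eq_cube flip: r_bounds(3))
  finally show ?thesis .
qed

lemma relative_residual_le:
  "fro_norm (P - S * R) / fro_norm P \<le> 4.2 * ucrs * real m powr (3/2) * (fro_norm W / fro_norm P)"
proof -
  have P_pos: "0 < fro_norm P" using fro_W_le_P fro_W_pos by linarith
  have "0 \<le> ucrs * r^3 * fro_norm W" using u_pos r_bounds(1) by simp
  then have "fro_norm (P - S * R) \<le> 42/10 * (ucrs * r^3 * fro_norm W)" using residual_le by linarith
  then show ?thesis using P_pos unfolding r_cubed by (simp add: field_simps)
qed

lemma residual_constant_le:
  "4.2 * ucrs * real m powr (3/2) * (fro_norm W / fro_norm P) \<le> 6 * ucrs * real m powr (3/2)"
proof -
  have P_pos: "0 < fro_norm P" using fro_W_le_P fro_W_pos by linarith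
  have "42/10 * (fro_norm W / fro_norm P) \<le> 6" using fro_W_le_P P_pos by (simp add: field_simps)
  then have "(ucrs * r^3) * (42/10 * (fro_norm W / fro_norm P)) \<le> (ucrs * r^3) * 6"
    using u_pos r_bounds(1) by (intro mult_left_mono) auto
  then show ?thesis unfolding r_cubed by (simp add: mult.commute mult.left_commute)
qed

lemma loss_of_orthogonality_le:
  "ereal (fro_norm (1\<^sub>m m - S\<^sup>T * S)) \<le> ereal (20 * ucrs * (real m)\<^sup>2) * cond W"
proof -
  have 1: "fro_norm (1\<^sub>m m - S\<^sup>T * S) \<le> 10 * (ucrs * r^3 * \<omega> / \<sigma>)"
    using orthogonality_defect_le[OF invariant_all, of p] unfolding p_mp window_full[OF S] by simp
  have r4: "r^3 * r = (real m)\<^sup>2" by (simp add: power2_eq_square power3_eq_cube flip: r_bounds(3))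
  have "ucrs * r^3 * \<omega> / \<sigma> = ucrs * (r^3 * r) * (sigma_max W / \<sigma>)" by (simp add: \<omega>_def)
  also have "\<dots> = ucrs * (real m)\<^sup>2 * (sigma_max W / \<sigma>)" unfolding r4 ..
  finally have 2: "fro_norm (1\<^sub>m m - S\<^sup>T * S) \<le> 10 * (ucrs * (real m)\<^sup>2 * (sigma_max W / \<sigma>))"
    using 1 by (simp only:)
  have "0 \<le> sigma_max W" using singular_values_attained(1)[OF W mn W_singular(2)] .
  then have "0 \<le> ucrs * (real m)\<^sup>2 * (sigma_max W / \<sigma>)" using u_pos \<sigma>_pos by simp
  then have "10 * (ucrs * (real m)\<^sup>2 * (sigma_max W / \<sigma>)) \<le> 20 * (ucrs * (real m)\<^sup>2 * (sigma_max W / \<sigma>))"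
    by (rule mult_right_mono[rotated]) simp
  with 2 have "fro_norm (1\<^sub>m m - S\<^sup>T * S) \<le> 20 * (ucrs * (real m)\<^sup>2 * (sigma_max W / \<sigma>))"
    by (rule order_trans)
  then show "ereal (fro_norm (1\<^sub>m m - S\<^sup>T * S)) \<le> ereal (20 * ucrs * (real m)\<^sup>2) * cond W"
    unfolding cond_W by simp
qed

end

theorem theorem3p4:
  fixes n k m mp p :: nat
    and \<epsilon> \<epsilon>0 ucrs ufine :: real
    and \<Theta> W P Q Q' S R :: "real mat"
  assumes "m = mp * p" and "mp \<ge> 1" and "p \<ge> 1" and "m \<le> k" and "k \<le> n"
    and "\<Theta> \<in> carrier_mat k n" and "W \<in> carrier_mat n m" and "P \<in> carrier_mat k m"
    and "Q \<in> carrier_mat n m" and "Q' \<in> carrier_mat n m" and "S \<in> carrier_mat k m"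
    and "R \<in> carrier_mat m m" and "upper_triangular R"
    and "0 < ufine" and "ufine \<le> ucrs"
    and "sketch_computed ufine \<Theta> W P" and "sketch_computed ufine \<Theta> Q S"
    and "\<forall>i\<in>{1..p}. ls_backward_stable mp ucrs P S R i"
    and "\<epsilon>0 \<le> 1/2"
    and "sketch_norm_bound \<epsilon>0 \<Theta>"
    and "\<forall>i\<in>{1..p}. update_stable mp \<epsilon>0 ucrs \<Theta> W Q Q' R i"
    and "\<forall>i\<in>{1..p}. qr_backward_stable mp ucrs ufine \<Theta> Q Q' R i"
    and "\<forall>i\<in>{1..p}. qr_sketch_orthonormal mp ucrs \<Theta> Q Q' i"
    and "\<epsilon> \<le> 1/2"
    and "eps_embedding_mat \<epsilon> \<Theta> (col_blocks mp Q 1 (p - 1))"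
    and "eps_embedding_mat \<epsilon> \<Theta> W"
    and "ereal ucrs \<le> ereal (1 / 10 ^ 3) * inverse (cond W) * ereal (1 / (real m)\<^sup>2)"
    and "ufine \<le> 1 / 10 ^ 2 * real m powr (-1/2) * real n powr (-3/2) * ucrs"
  shows "fro_norm (P - S * R) / fro_norm P
           \<le> 4.2 * ucrs * real m powr (3/2) * (fro_norm W / fro_norm P)
       \<and> 4.2 * ucrs * real m powr (3/2) * (fro_norm W / fro_norm P) \<le> 6 * ucrs * real m powr (3/2)
       \<and> ereal (fro_norm (1\<^sub>m m - S\<^sup>T * S)) \<le> ereal (20 * ucrs * (real m)\<^sup>2) * cond W"
proof -
  interpret rbgs_run n k m mp p \<epsilon> \<epsilon>0 ucrs ufine \<Theta> W P Q Q' S R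
    by (rule rbgs_run.intro) (fact assms)+
  show ?thesis by (intro conjI relative_residual_le residual_constant_le loss_of_orthogonality_le)
qed

end
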